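(* Let $\mathcal{G}$ be a locally compact non-compact group and let $\mathcal{X}$ be a $\mathcal{G}$-space. Then the following assertions are equivalent. (a) $\mathfrak{Z}(\mathcal{X},\mathcal{G})=M(\mathcal{G})$. (b) $\mathcal{CLS}(\mathcal{X},\mathcal{G})=LUC(\mathcal{G})$. (c) The action of $LUC(\mathcal{G})^*$ on $LUC(\mathcal{X},\mathcal{G})^*$ is faithful.
   Context: A (left) $\mathcal{G}$-space is a locally compact Hausdorff space $\mathcal{X}$ with a continuous map $\mathcal{G}\times\mathcal{X}\to\mathcal{X}$, $(s,x)\mapsto s\cdot x$, such that $(st)\cdot x=s\cdot(t\cdot x)$ and $e\cdot x=x$ for all $s,t\in\mathcal{G}$, $x\in\mathcal{X}$, where $e$ is the identity of $\mathcal{G}$. $C_b(\mathcal{X})$ is the space of bounded continuous complex-valued functions on $\mathcal{X}$ with the supremum norm. For $F\in C_b(\mathcal{X})$ and $s\in\mathcal{G}$ put $(l_sF)(x)=F(s\cdot x)$, and let $$LUC(\mathcal{X},\mathcal{G})=\{F\in C_b(\mathcal{X}): s\mapsto l_sF \text{ is continuous from } \mathcal{G} \text{ into } (C_b(\mathcal{X}),\|\cdot\|_\infty)\},$$ a closed subspace of $C_b(\mathcal{X})$ invariant under all $l_s$. $LUC(\mathcal{G})=LUC(\mathcal{G},\mathcal{G})$, with $\mathcal{G}$ acting on itself by left translation. $M(\mathcal{G})$, the space of complex regular Borel measures on $\mathcal{G}$, is viewed as a subspace of $LUC(\mathcal{G})^*$ via $\langle\mu,f\rangle=\int_{\mathcal{G}}f\,d\mu$.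 For $M\in LUC(\mathcal{X},\mathcal{G})^*$ and $F\in LUC(\mathcal{X},\mathcal{G})$, the function $MF\in LUC(\mathcal{G})$ is given by $(MF)(s)=\langle M,l_sF\rangle$. For $m\in LUC(\mathcal{G})^*$, the functional $m\cdot M\in LUC(\mathcal{X},\mathcal{G})^*$ is given by $\langle m\cdot M,F\rangle=\langle m,MF\rangle$. This action of $LUC(\mathcal{G})^*$ on $LUC(\mathcal{X},\mathcal{G})^*$ is called faithful if, whenever $m\in LUC(\mathcal{G})^*$ satisfies $m\cdot M=0$ for all $M\in LUC(\mathcal{X},\mathcal{G})^*$, one has $m=0$. Define $$\mathfrak{Z}(\mathcal{X},\mathcal{G})=\{m\in LUC(\mathcal{G})^*: M\mapsto m\cdot M \text{ is weak}^*\text{ to weak}^*\text{ continuous on } LUC(\mathcal{X},\mathcal{G})^*\}.$$ $\mathcal{CLS}(\mathcal{X},\mathcal{G})$ is the norm closure in $LUC(\mathcal{G})$ of the linear span of $\{MF: M\in LUC(\mathcal{X},\mathcal{G})^*,\ F\in LUC(\mathcal{X},\mathcal{G})\}$. *)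

theory Defs
  imports "HOL-Analysis.Analysis" "HOL-Library.Function_Algebras"
begin

text \<open>
  The group is a type of class \<^class>\<open>topological_group_add\<close>. Commutativity is not part of
  that class; the group law is written additively, so \<open>s + t\<close> is the product \<open>st\<close> and
  \<open>0\<close> is the identity \<open>e\<close>. The space on which it acts is an abstract topology, possibly empty.
\<close>

definition G_space :: "'x topology \<Rightarrow> ('g::topological_group_add \<Rightarrow> 'x \<Rightarrow> 'x) \<Rightarrow> bool"
  where "G_space X act \<longleftrightarrow>
    locally_compact_space X \<and> Hausdorff_space X \<and>
    continuous_map (prod_topology euclidean X) X (\<lambda>(s, x). act s x) \<and>
    (\<forall>s t. \<forall>x \<in> topspace X. act (s + t) x = act s (act t x)) \<and>
    (\<forall>x \<in> topspace X. act 0 x = x)"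

text \<open>
  Elements of \<open>Cb X\<close> are extensional on \<open>topspace X\<close>; the metric is the supremum metric.
\<close>

abbreviation Cb :: "'x topology \<Rightarrow> ('x \<Rightarrow> complex) metric"
  where "Cb X \<equiv> cfunspace X euclidean_metric"

definition sup_norm :: "'x topology \<Rightarrow> ('x \<Rightarrow> complex) \<Rightarrow> real"
  where "sup_norm X F = mdist (Cb X) F (\<lambda>x\<in>topspace X. 0)"

definition ltrans ::
    "'x topology \<Rightarrow> ('g \<Rightarrow> 'x \<Rightarrow> 'x) \<Rightarrow> 'g \<Rightarrow> ('x \<Rightarrow> complex) \<Rightarrow> 'x \<Rightarrow> complex"
  where "ltrans X act s F = (\<lambda>x\<in>topspace X. F (act s x))"

definition LUC ::
    "'x topology \<Rightarrow> ('g::topological_space \<Rightarrow> 'x \<Rightarrow> 'x) \<Rightarrow> ('x \<Rightarrow> complex) set"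
  where "LUC X act =
    {F \<in> mspace (Cb X). continuous_map euclidean (mtopology_of (Cb X)) (\<lambda>s. ltrans X act s F)}"

abbreviation LUC_group :: "('g::topological_group_add \<Rightarrow> complex) set"
  where "LUC_group \<equiv> LUC euclidean (+)"

text \<open>
  The dual of a linear subspace \<open>V\<close> of \<open>Cb X\<close>. Functionals are extensional on \<open>V\<close>, so that
  equality of functions is equality of functionals.
\<close>

definition cdual :: "'x topology \<Rightarrow> ('x \<Rightarrow> complex) set \<Rightarrow> (('x \<Rightarrow> complex) \<Rightarrow> complex) set"
  where "cdual X V = {M \<in> extensional V.
    (\<forall>a b. \<forall>F \<in> V. \<forall>H \<in> V. M (\<lambda>x\<in>topspace X. a * F x + b * H x) = a * M F + b * M H) \<and>
    (\<exists>C. \<forall>F \<in> V. cmod (M F) \<le> C * sup_norm X F)}"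

definition weak_star ::
    "'x topology \<Rightarrow> ('x \<Rightarrow> complex) set \<Rightarrow> (('x \<Rightarrow> complex) \<Rightarrow> complex) topology"
  where "weak_star X V = subtopology (product_topology (\<lambda>_. euclidean) V) (cdual X V)"

text \<open>The function \<open>MF\<close> and the functional \<open>m \<cdot> M\<close>.\<close>

definition fun_act ::
    "'x topology \<Rightarrow> ('g \<Rightarrow> 'x \<Rightarrow> 'x) \<Rightarrow> (('x \<Rightarrow> complex) \<Rightarrow> complex) \<Rightarrow> ('x \<Rightarrow> complex)
      \<Rightarrow> 'g \<Rightarrow> complex"
  where "fun_act X act M F = (\<lambda>s. M (ltrans X act s F))"

definition dual_act ::
    "'x topology \<Rightarrow> ('g::topological_space \<Rightarrow> 'x \<Rightarrow> 'x) \<Rightarrow> (('g \<Rightarrow> complex) \<Rightarrow> complex)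
      \<Rightarrow> (('x \<Rightarrow> complex) \<Rightarrow> complex) \<Rightarrow> ('x \<Rightarrow> complex) \<Rightarrow> complex"
  where "dual_act X act m M = (\<lambda>F \<in> LUC X act. m (fun_act X act M F))"

definition faithful_action ::
    "'x topology \<Rightarrow> ('g::topological_group_add \<Rightarrow> 'x \<Rightarrow> 'x) \<Rightarrow> bool"
  where "faithful_action X act \<longleftrightarrow>
    (\<forall>m \<in> cdual euclidean LUC_group.
      (\<forall>M \<in> cdual X (LUC X act). dual_act X act m M = (\<lambda>F \<in> LUC X act. 0)) \<longrightarrow>
      m = (\<lambda>f \<in> LUC_group. 0))"

definition Zcenter ::
    "'x topology \<Rightarrow> ('g::topological_group_add \<Rightarrow> 'x \<Rightarrow> 'x) \<Rightarrow> (('g \<Rightarrow> complex) \<Rightarrow> complex) set"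
  where "Zcenter X act = {m \<in> cdual euclidean LUC_group.
    continuous_map (weak_star X (LUC X act)) (weak_star X (LUC X act)) (dual_act X act m)}"

definition CLS ::
    "'x topology \<Rightarrow> ('g::topological_group_add \<Rightarrow> 'x \<Rightarrow> 'x) \<Rightarrow> ('g \<Rightarrow> complex) set"
  where "CLS X act =
    subtopology (mtopology_of (Cb euclidean)) LUC_group closure_of
      module.span (\<lambda>c f s. c * f s)
        {fun_act X act M F | M F. M \<in> cdual X (LUC X act) \<and> F \<in> LUC X act}"

text \<open>
  Complex Borel measures are set functions whose values outside \<open>sets borel\<close> are irrelevant.
\<close>

definition complex_borel_measure :: "('g::topological_space set \<Rightarrow> complex) \<Rightarrow> bool"
  where "complex_borel_measure \<mu> \<longleftrightarrow>
    (\<forall>A :: nat \<Rightarrow> 'g set. range A \<subseteq> sets borel \<longrightarrow> disjoint_family A \<longrightarrow>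
      (\<lambda>n. \<mu> (A n)) sums \<mu> (\<Union>n. A n))"

definition total_variation :: "('g::topological_space set \<Rightarrow> complex) \<Rightarrow> 'g set \<Rightarrow> ennreal"
  where "total_variation \<mu> E =
    (SUP A \<in> {A :: nat \<Rightarrow> 'g set. range A \<subseteq> sets borel \<and> disjoint_family A \<and> (\<Union>n. A n) = E}.
      \<Sum>n. ennreal (cmod (\<mu> (A n))))"

definition regular_complex_measure :: "('g::topological_space set \<Rightarrow> complex) \<Rightarrow> bool"
  where "regular_complex_measure \<mu> \<longleftrightarrow> complex_borel_measure \<mu> \<and>
    (\<forall>E \<in> sets borel.
      total_variation \<mu> E = (INF U \<in> {U. open U \<and> E \<subseteq> U}. total_variation \<mu> U) \<and>
      total_variation \<mu> E = (SUP K \<in> {K. compact K \<and> K \<subseteq> E}. total_variation \<mu> K))"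

text \<open>
  The positive part \<open>\<nu>\<^sup>+\<close> in the Jordan decomposition of a finite signed measure \<open>\<nu>\<close>, given by
  \<open>\<nu>\<^sup>+(E) = sup {\<nu>(A) | A \<subseteq> E Borel}\<close>; the negative part is \<open>(-\<nu>)\<^sup>+\<close>. Truncation by
  \<^const>\<open>ennreal\<close> is harmless because \<open>A = {}\<close> contributes \<open>0\<close>.
\<close>

definition pos_part :: "('g::topological_space set \<Rightarrow> real) \<Rightarrow> 'g measure"
  where "pos_part \<nu> = measure_of UNIV (sets borel)
    (\<lambda>E. SUP A \<in> {A \<in> sets borel. A \<subseteq> E}. ennreal (\<nu> A))"

definition signed_integral :: "('g::topological_space set \<Rightarrow> real) \<Rightarrow> ('g \<Rightarrow> complex) \<Rightarrow> complex"
  where "signed_integral \<nu> f = (LINT x|pos_part \<nu>. f x) - (LINT x|pos_part (\<lambda>A. - \<nu> A). f x)"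

definition complex_integral :: "('g::topological_space set \<Rightarrow> complex) \<Rightarrow> ('g \<Rightarrow> complex) \<Rightarrow> complex"
  where "complex_integral \<mu> f =
    signed_integral (\<lambda>A. Re (\<mu> A)) f + \<i> * signed_integral (\<lambda>A. Im (\<mu> A)) f"

text \<open>\<open>M(G)\<close> as a subspace of the dual of \<open>LUC(G)\<close>.\<close>

definition measure_functionals :: "(('g::topological_group_add \<Rightarrow> complex) \<Rightarrow> complex) set"
  where "measure_functionals =
    {(\<lambda>f \<in> LUC_group. complex_integral \<mu> f) | \<mu>. regular_complex_measure \<mu>}"

end

theory Submission
  imports Defs
begin

text \<open>
  The key point is a factorization at infinity. Since \<open>G\<close> is not compact, a compact cover of minimal
  cardinality allows one to choose, by transfinite recursion, translates of large compact sets that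
  are pairwise disjoint. Planting the cut-offs of a given \<open>g \<in> LUC(G)\<close> on these translates yields
  \<open>F \<in> LUC(G)\<close> and a functional \<open>n\<close> with \<open>n F = g\<close> and \<open>n = 0\<close> on \<open>C\<^sub>c(G)\<close>. It is a limit of functionals
  \<open>n\<^sub>0\<close> with \<open>n\<^sub>0 F \<in> C\<^sub>c(G)\<close>, each of which is a limit of evaluations running to infinity.

  If \<open>Z(X,G) = M(G)\<close> and \<open>m\<close> annihilates the action, then so does \<open>m \<cdot> n\<close>, which is therefore central,
  hence a measure; it vanishes on \<open>C\<^sub>c(G)\<close>, hence is zero, and \<open>m(g) = (m \<cdot> n)(F) = 0\<close>. Faithfulness
  gives \<open>CLS = LUC(G)\<close> by Hahn--Banach, and the converse is continuity. Finally let \<open>CLS = LUC(G)\<close>.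
  For central \<open>m\<close> the map \<open>n \<mapsto> m(n f)\<close> is then evaluation at some function of \<open>LUC(G)\<close>, for every
  \<open>f\<close>. The same holds for measures, in particular for the one that represents \<open>m\<close> on \<open>C\<^sub>c(G)\<close>. Their
  difference \<open>d\<close> vanishes on \<open>C\<^sub>c(G)\<close>, so \<open>d(n\<^sub>0 F) = 0\<close>. By this property at \<open>F\<close> the relation passes to
  the limit, and \<open>d(g) = d(n F) = 0\<close>.
\<close>

text \<open>A weak-star limit does not commute with a functional \<open>d\<close>: that
  \<open>n\<close> is a limit of functionals \<open>n0\<close> says nothing about
  \<open>d(n F)\<close> and \<open>d(n0 F)\<close>. Representability, \<open>d(n F) = n(F')\<close>
  for all \<open>n\<close>, is what allows the exchange, since \<open>n(F')\<close> is determined by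
  the numbers \<open>n0(F') = d(n0 F)\<close>. Centrality gives this only for functions of the form
  \<open>M F\<close>, through which alone \<open>X\<close> is visible in the group; density of their
  span carries it to every \<open>f\<close>.

  The limit is iterated because of two conflicting demands: vanishing on \<open>Cc\<close> needs
  points leaving every compact set, while \<open>n0 F\<close> in \<open>Cc\<close> needs a fixed
  cut-off. So the points carry two finite subfamilies of the cover: with \<open>A\<close> fixed,
  \<open>B\<close> drives them to infinity, and only then does \<open>A\<close> exhaust the group.
  Without sigma-compactness no sequence of compact sets would do. For a cover of least cardinality
  \<open>k\<close> there are still at most \<open>k\<close> pairs \<open>(A, B)\<close>, and at each
  stage of the recursion fewer than \<open>k\<close> compact sets are to be avoided, which cannot
  fill the group.

  A functional annihilating the action is central because its action map is constantly zero.\<close>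

section \<open>A Hahn--Banach theorem\<close>

definition sublinear_on :: "(real \<Rightarrow> 'v \<Rightarrow> 'v) \<Rightarrow> 'v::plus set \<Rightarrow> ('v \<Rightarrow> real) \<Rightarrow> bool"
  where "sublinear_on sc V q \<longleftrightarrow> (\<forall>x\<in>V. \<forall>y\<in>V. q (x + y) \<le> q x + q y) \<and>
    (\<forall>x\<in>V. \<forall>t\<ge>0. q (sc t x) = t * q x)"

context
  fixes sc :: "real \<Rightarrow> 'v::ab_group_add \<Rightarrow> 'v" and V :: "'v set"
  assumes vs: "vector_space sc" and sub: "module.subspace sc V"
begin

interpretation vector_space sc by (rule vs)

abbreviation (input) sublin :: "('v \<Rightarrow> real) \<Rightarrow> bool"
  where "sublin \<equiv> sublinear_on sc V"

lemma sublin_add: "sublin q \<Longrightarrow> x \<in> V \<Longrightarrow> y \<in> V \<Longrightarrow> q (x + y) \<le> q x + q y"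
  by (auto simp: sublinear_on_def)

lemma sublin_scale: "sublin q \<Longrightarrow> x \<in> V \<Longrightarrow> 0 \<le> t \<Longrightarrow> q (sc t x) = t * q x"
  by (auto simp: sublinear_on_def)

lemma sublin_zero: "sublin q \<Longrightarrow> q 0 = 0"
  using sublin_scale[of q 0 0] subspace_0[OF sub] by simp

lemma sublin_minus: "sublin q \<Longrightarrow> x \<in> V \<Longrightarrow> - q (- x) \<le> q x"
  using sublin_add[of q x "- x"] subspace_neg[OF sub, of x] sublin_zero[of q] by simp

text \<open>The largest sublinear functional below \<open>q\<close> whose value at \<open>- g\<close> is at most \<open>- q g\<close>.\<close>

definition tilt :: "'v \<Rightarrow> ('v \<Rightarrow> real) \<Rightarrow> 'v \<Rightarrow> real"
  where "tilt g q = (\<lambda>f\<in>V. INF t\<in>{0..}. q (f + sc t g) - t * q g)"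

context
  fixes q :: "'v \<Rightarrow> real" and g :: 'v
  assumes q: "sublin q" and g: "g \<in> V"
begin

lemma V_comb: "f \<in> V \<Longrightarrow> f + sc t g \<in> V"
  using subspace_add[OF sub] subspace_scale[OF sub] g by blast

text \<open>Subadditivity at \<open>f + sc t g\<close> and \<open>- f\<close> gives a bound free of
  \<open>t\<close>, so the infimum in \<open>tilt\<close> is finite.\<close>

lemma tilt_lower:
  assumes f: "f \<in> V" and t: "0 \<le> t"
  shows "- q (- f) \<le> q (f + sc t g) - t * q g"
proof -
  have "t * q g = q ((f + sc t g) + (- f))"
    using sublin_scale[OF q g t] by simp
  also have "\<dots> \<le> q (f + sc t g) + q (- f)"
    by (intro sublin_add[OF q] V_comb f subspace_neg[OF sub])
  finally show ?thesis by simp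
qed

lemma tilt_bdd: "f \<in> V \<Longrightarrow> bdd_below ((\<lambda>t. q (f + sc t g) - t * q g) ` {0..})"
  using tilt_lower[of f] by (auto intro!: bdd_belowI[where m = "- q (- f)"])

lemma tilt_le: "f \<in> V \<Longrightarrow> 0 \<le> t \<Longrightarrow> tilt g q f \<le> q (f + sc t g) - t * q g"
  unfolding tilt_def by (auto intro!: cINF_lower tilt_bdd)

lemma tilt_ge: "f \<in> V \<Longrightarrow> (\<And>t. 0 \<le> t \<Longrightarrow> c \<le> q (f + sc t g) - t * q g) \<Longrightarrow> c \<le> tilt g q f"
  unfolding tilt_def by (auto intro!: cINF_greatest)

lemma tilt_approx:
  assumes f: "f \<in> V" and e: "0 < e"
  obtains t where "0 \<le> t" "q (f + sc t g) - t * q g < tilt g q f + e"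
proof -
  have "\<exists>t\<ge>0. q (f + sc t g) - t * q g < tilt g q f + e"
  proof (rule ccontr)
    assume "\<not> ?thesis"
    then have "tilt g q f + e \<le> tilt g q f"
      by (intro tilt_ge f) (auto simp: not_less)
    with e show False by simp
  qed
  with that show ?thesis by blast
qed

text \<open>Near-optimal parameters \<open>s\<close> for \<open>x\<close> and \<open>t\<close> for
  \<open>y\<close> add up to a competitor \<open>s + t\<close> for \<open>x + y\<close>. Homogeneity
  is the substitution of \<open>t / c\<close> for \<open>t\<close>, whence the separate case
  \<open>c = 0\<close>.\<close>

lemma sublin_tilt: "sublin (tilt g q)"
  unfolding sublinear_on_def
proof (intro conjI ballI allI impI)
  fix x y assume x: "x \<in> V" and y: "y \<in> V"
  show "tilt g q (x + y) \<le> tilt g q x + tilt g q y"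
  proof (rule field_le_epsilon)
    fix e :: real assume "0 < e"
    then obtain s t where s: "0 \<le> s" "q (x + sc s g) - s * q g < tilt g q x + e/2"
      and t: "0 \<le> t" "q (y + sc t g) - t * q g < tilt g q y + e/2"
      using tilt_approx[OF x, of "e/2"] tilt_approx[OF y, of "e/2"] half_gt_zero by metis
    have "tilt g q (x + y) \<le> q ((x + y) + sc (s + t) g) - (s + t) * q g"
      using s t x y by (intro tilt_le subspace_add[OF sub]) auto
    also have "(x + y) + sc (s + t) g = (x + sc s g) + (y + sc t g)"
      by (simp add: scale_left_distrib algebra_simps)
    also have "q \<dots> \<le> q (x + sc s g) + q (y + sc t g)"
      by (intro sublin_add[OF q] V_comb x y)
    finally show "tilt g q (x + y) \<le> tilt g q x + tilt g q y + e"
      using s t by (simp add: algebra_simps)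
  qed
next
  fix x c assume x: "x \<in> V" and c: "0 \<le> (c::real)"
  have xc: "sc c x \<in> V" by (intro subspace_scale[OF sub] x)
  show "tilt g q (sc c x) = c * tilt g q x"
  proof (cases "c = 0")
    case True
    have "0 \<in> V" by (rule subspace_0[OF sub])
    then have "tilt g q 0 \<le> 0" "0 \<le> tilt g q 0"
      using tilt_le[of 0 0] tilt_ge[of 0 0] sublin_zero[OF q] sublin_scale[OF q g] by auto
    with True show ?thesis by simp
  next
    case False
    with c have c: "0 < c" by simp
    have eq: "q (sc c x + sc t g) - t * q g = c * (q (x + sc (t / c) g) - (t / c) * q g)" if "0 \<le> t" for t
    proof -
      have "sc c x + sc t g = sc c (x + sc (t / c) g)"
        using c by (simp add: scale_right_distrib)
      then have "q (sc c x + sc t g) = c * q (x + sc (t / c) g)"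
        using sublin_scale[OF q V_comb[OF x]] c by simp
      then show ?thesis using c by (simp add: field_simps)
    qed
    show ?thesis
    proof (rule antisym)
      have "tilt g q (sc c x) / c \<le> tilt g q x"
      proof (rule tilt_ge[OF x])
        fix t :: real assume "0 \<le> t"
        then show "tilt g q (sc c x) / c \<le> q (x + sc t g) - t * q g"
          using tilt_le[OF xc, of "c * t"] eq[of "c * t"] c by (simp add: field_simps)
      qed
      then show "tilt g q (sc c x) \<le> c * tilt g q x"
        using c by (simp add: field_simps)
    next
      show "c * tilt g q x \<le> tilt g q (sc c x)"
      proof (rule tilt_ge[OF xc])
        fix t :: real assume "0 \<le> t"
        then show "c * tilt g q x \<le> q (sc c x + sc t g) - t * q g"
          using tilt_le[OF x, of "t / c"] eq[of t] c by simp
      qed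
    qed
  qed
qed

end

text \<open>Zorn's lemma: along a chain the pointwise infimum stays sublinear, and it is finite
  because every member satisfies \<open>- p (- x) <= - q (- x) <= q x\<close>. The minimal
  functionals will turn out to be linear.\<close>

lemma minimal_sublin_below:
  assumes p: "sublin p"
  obtains q where "sublin q" "\<And>x. x \<in> V \<Longrightarrow> q x \<le> p x"
    "\<And>r x. sublin r \<Longrightarrow> (\<And>x. x \<in> V \<Longrightarrow> r x \<le> q x) \<Longrightarrow> x \<in> V \<Longrightarrow> r x = q x"
proof -
  \<comment> \<open>Extensionality on \<open>V\<close> makes the pointwise order antisymmetric, as
    Zorn's lemma requires.\<close>
  define A where "A = {q \<in> extensional V. sublin q \<and> (\<forall>x\<in>V. q x \<le> p x)}"
  define P where "P q r \<longleftrightarrow> (\<forall>x\<in>V. r x \<le> q x)" for q r :: "'v \<Rightarrow> real"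
  have sublin_restrict: "sublin (restrict q V)" if "sublin q" for q
    using that unfolding sublinear_on_def
    by (simp add: subspace_add[OF sub] subspace_scale[OF sub])
  have "\<exists>m\<in>A. \<forall>a\<in>A. P m a \<longrightarrow> a = m"
  proof (rule predicate_Zorn)
    show "partial_order_on A (relation_of P A)"
      unfolding partial_order_on_def preorder_on_def
      by (auto simp: refl_on_def trans_on_def antisym_on_def relation_of_def P_def A_def
        intro: order_trans antisym intro!: extensionalityI[of _ V])
  next
    fix C assume C: "C \<in> Chains (relation_of P A)"
    then have CA: "C \<subseteq> A" and chain: "\<And>a b. a \<in> C \<Longrightarrow> b \<in> C \<Longrightarrow> P a b \<or> P b a"
      by (auto simp: Chains_def relation_of_def)
    show "\<exists>u\<in>A. \<forall>a\<in>C. P a u"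
    proof (cases "C = {}")
      case True
      have "restrict p V \<in> A" using sublin_restrict[OF p] by (auto simp: A_def)
      with True show ?thesis by auto
    next
      case False
      define u where "u = (\<lambda>x\<in>V. INF a\<in>C. a x)"
      have bdd: "bdd_below ((\<lambda>a. a x) ` C)" if "x \<in> V" for x
      proof (rule bdd_belowI2)
        fix a assume "a \<in> C"
        then have "sublin a" "a (- x) \<le> p (- x)"
          using CA subspace_neg[OF sub that] by (auto simp: A_def)
        then show "- p (- x) \<le> a x" using sublin_minus[of a x] that by linarith
      qed
      have le: "u x \<le> a x" if "x \<in> V" "a \<in> C" for x a
        using that bdd[of x] by (auto simp: u_def intro: cINF_lower)
      have ge: "c \<le> u x" if "x \<in> V" "\<And>a. a \<in> C \<Longrightarrow> c \<le> a x" for x c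
        using that False by (auto simp: u_def intro: cINF_greatest)
      have "sublin u"
        unfolding sublinear_on_def
      proof (intro conjI ballI allI impI)
        fix x y assume x: "x \<in> V" and y: "y \<in> V"
        have xy: "x + y \<in> V" by (intro subspace_add[OF sub] x y)
        have *: "u (x + y) - a x \<le> u y" if a: "a \<in> C" for a
        proof (rule ge[OF y])
          fix b assume b: "b \<in> C"
          \<comment> \<open>The smaller of \<open>a\<close> and \<open>b\<close> lies below both, so
            its subadditivity serves the two infima at once.\<close>
          obtain c where c: "c \<in> C" "c x \<le> a x" "c y \<le> b y"
            using chain[OF a b] a b x y unfolding P_def by (metis order_refl)
          then have "c (x + y) \<le> c x + c y"
            using CA x y by (intro sublin_add) (auto simp: A_def)
          then show "u (x + y) - a x \<le> b y" using le[OF xy c(1)] c by simp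
        qed
        have "u (x + y) - u y \<le> u x"
          by (rule ge[OF x]) (use * in force)
        then show "u (x + y) \<le> u x + u y" by simp
      next
        fix x t assume x: "x \<in> V" and t: "0 \<le> (t::real)"
        have tx: "sc t x \<in> V" by (intro subspace_scale[OF sub] x)
        have a: "a (sc t x) = t * a x" if "a \<in> C" for a
          using that CA x t by (auto simp: A_def intro: sublin_scale)
        show "u (sc t x) = t * u x"
        proof (cases "t = 0")
          case True
          have z: "0 \<in> V" by (rule subspace_0[OF sub])
          have "a 0 = 0" if "a \<in> C" for a using a[OF that] True by simp
          then have "u 0 = 0"
            using False ge[OF z, of 0] le[OF z] by (metis antisym ex_in_conv order_refl)
          with True show ?thesis by simp
        next
          case nz: False
          with t have t: "0 < t" by simp
          show ?thesis
          proof (rule antisym)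
            have "u (sc t x) / t \<le> u x"
            proof (rule ge[OF x])
              fix b assume b: "b \<in> C"
              show "u (sc t x) / t \<le> b x" using le[OF tx b] a[OF b] t by (simp add: field_simps)
            qed
            then show "u (sc t x) \<le> t * u x" using t by (simp add: field_simps)
            show "t * u x \<le> u (sc t x)"
            proof (rule ge[OF tx])
              fix b assume b: "b \<in> C"
              show "t * u x \<le> b (sc t x)" using le[OF x b] a[OF b] t by simp
            qed
          qed
        qed
      qed
      moreover have "u x \<le> p x" if "x \<in> V" for x
      proof -
        obtain a where "a \<in> C" using False by blast
        with le[OF that this] CA that show ?thesis by (force simp: A_def)
      qed
      ultimately have "u \<in> A" by (auto simp: A_def u_def)
      moreover have "P a u" if "a \<in> C" for a using le that by (auto simp: P_def)
      ultimately show ?thesis by blast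
    qed
  qed
  then obtain q where q: "q \<in> A" and min: "\<And>a. a \<in> A \<Longrightarrow> P q a \<Longrightarrow> a = q" by blast
  show ?thesis
  proof (rule that[of q])
    show "sublin q" "\<And>x. x \<in> V \<Longrightarrow> q x \<le> p x" using q by (auto simp: A_def)
    fix r x assume r: "sublin r" "\<And>x. x \<in> V \<Longrightarrow> r x \<le> q x" and x: "x \<in> V"
    have "restrict r V \<in> A" "P q (restrict r V)"
      using sublin_restrict[OF r(1)] r(2) q by (force simp: A_def P_def)+
    then have "restrict r V = q" by (rule min)
    with x show "r x = q x" by auto
  qed
qed

text \<open>Minimality is sought below \<open>tilt f0 p\<close> rather than below \<open>p\<close>:
  the parameter value 1 in the infimum then forces \<open>u (- f0) <= - p f0\<close>, so the bound
  is attained at \<open>f0\<close>.\<close>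

lemma hahn_banach_vector:
  assumes p: "sublin p" and f0: "f0 \<in> V"
  obtains u where "\<And>x y. x \<in> V \<Longrightarrow> y \<in> V \<Longrightarrow> u (x + y) = u x + u y"
    "\<And>t x. x \<in> V \<Longrightarrow> u (sc t x) = t * u x" "\<And>x. x \<in> V \<Longrightarrow> u x \<le> p x" "u f0 = p f0"
proof -
  obtain u where u: "sublin u" "\<And>x. x \<in> V \<Longrightarrow> u x \<le> tilt f0 p x"
    and min: "\<And>r x. sublin r \<Longrightarrow> (\<And>x. x \<in> V \<Longrightarrow> r x \<le> u x) \<Longrightarrow> x \<in> V \<Longrightarrow> r x = u x"
    using minimal_sublin_below[OF sublin_tilt[OF p f0]] by blast
  have neg: "- x \<in> V" if "x \<in> V" for x using that by (rule subspace_neg[OF sub])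
  have add: "u (x + y) = u x + u y" if x: "x \<in> V" and y: "y \<in> V" for x y
  proof -
    \<comment> \<open>Parameter 0 puts \<open>tilt y u\<close> below \<open>u\<close>, so minimality
      makes them equal; parameter 1 then yields \<open>u x + u y <= u (x + y)\<close>.\<close>
    have "tilt y u z \<le> u z" if "z \<in> V" for z
      using tilt_le[OF u(1) y that, of 0] by simp
    then have "tilt y u x = u x" by (rule min[OF sublin_tilt[OF u(1) y] _ x])
    then have "u x \<le> u (x + y) - u y" using tilt_le[OF u(1) y x, of 1] by simp
    with sublin_add[OF u(1) x y] show ?thesis by simp
  qed
  have minus: "u (- x) = - u x" if "x \<in> V" for x
    using add[OF that neg[OF that]] sublin_zero[OF u(1)] by simp
  have le_p: "u x \<le> p x" if "x \<in> V" for x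
    using u(2)[OF that] tilt_le[OF p f0 that, of 0] by simp
  show ?thesis
  proof (rule that[of u])
    show "u (sc t x) = t * u x" if "x \<in> V" for t x
    proof (cases "0 \<le> t")
      case False
      then have "u (sc (- t) x) = (- t) * u x" using that by (intro sublin_scale[OF u(1)]) auto
      then show ?thesis using minus[of "sc t x"] subspace_scale[OF sub that] by simp
    qed (use sublin_scale[OF u(1) that] in simp)
    have "u (- f0) \<le> p (- f0 + sc 1 f0) - 1 * p f0"
      using u(2)[OF neg[OF f0]] tilt_le[OF p f0 neg[OF f0], of 1] by simp
    then have "p f0 \<le> u f0" using minus[OF f0] sublin_zero[OF p] by simp
    with le_p[OF f0] show "u f0 = p f0" by simp
  qed (use add le_p in auto)
qed

end

lemma hahn_banach_complex:
  fixes V :: "('a \<Rightarrow> complex) set" and p :: "('a \<Rightarrow> complex) \<Rightarrow> real"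
  assumes V: "\<And>f g. f \<in> V \<Longrightarrow> g \<in> V \<Longrightarrow> (\<lambda>s. f s + g s) \<in> V" "\<And>c f. f \<in> V \<Longrightarrow> (\<lambda>s. c * f s) \<in> V"
    and p: "\<And>f g. f \<in> V \<Longrightarrow> g \<in> V \<Longrightarrow> p (\<lambda>s. f s + g s) \<le> p f + p g"
      "\<And>c f. f \<in> V \<Longrightarrow> p (\<lambda>s. c * f s) = cmod c * p f"
    and f0: "f0 \<in> V"
  obtains m where "\<And>a b f g. f \<in> V \<Longrightarrow> g \<in> V \<Longrightarrow> m (\<lambda>s. a * f s + b * g s) = a * m f + b * m g"
    "\<And>f. f \<in> V \<Longrightarrow> cmod (m f) \<le> p f" "Re (m f0) = p f0"
proof -
  define sc :: "real \<Rightarrow> ('a \<Rightarrow> complex) \<Rightarrow> 'a \<Rightarrow> complex" where "sc t f = (\<lambda>s. of_real t * f s)" for t f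
  have vs: "vector_space sc"
    by standard (auto simp: sc_def algebra_simps fun_eq_iff)
  interpret vector_space sc by (rule vs)
  have "(\<lambda>s. 0) \<in> V" using V(2)[OF f0, of 0] by simp
  then have sub: "subspace V"
    using V by (auto simp: subspace_def sc_def plus_fun_def zero_fun_def)
  have "sublinear_on sc V p"
    using p by (auto simp: sublinear_on_def sc_def plus_fun_def)
  from hahn_banach_vector[OF vs sub this f0]
  obtain u where u: "\<And>x y. x \<in> V \<Longrightarrow> y \<in> V \<Longrightarrow> u (\<lambda>s. x s + y s) = u x + u y"
    "\<And>t x. x \<in> V \<Longrightarrow> u (\<lambda>s. of_real t * x s) = t * u x" "\<And>x. x \<in> V \<Longrightarrow> u x \<le> p x" "u f0 = p f0"
    unfolding plus_fun_def sc_def by blast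
  \<comment> \<open>The only complex linear functional whose real part is \<open>u\<close>.\<close>
  define m where "m f = Complex (u f) (- u (\<lambda>s. \<i> * f s))" for f
  have add: "m (\<lambda>s. f s + g s) = m f + m g" if "f \<in> V" "g \<in> V" for f g
    using that u(1)[OF that] u(1)[OF V(2)[OF that(1), of \<i>] V(2)[OF that(2), of \<i>]]
    by (simp add: m_def complex_eq_iff distrib_left)
  have real: "m (\<lambda>s. of_real t * f s) = of_real t * m f" if "f \<in> V" for f t
    using u(2)[OF that, of t] u(2)[OF V(2)[OF that, of \<i>], of t]
    by (simp add: m_def complex_eq_iff mult.left_commute)
  have im: "m (\<lambda>s. \<i> * f s) = \<i> * m f" if "f \<in> V" for f
  proof -
    have "u (\<lambda>s. - f s) = - u f" using u(2)[OF that, of "-1"] by simp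
    then show ?thesis by (simp add: m_def complex_eq_iff mult.assoc[symmetric])
  qed
  have scale: "m (\<lambda>s. c * f s) = c * m f" if f: "f \<in> V" for c f
  proof -
    have "(\<lambda>s. c * f s) = (\<lambda>s. of_real (Re c) * f s + of_real (Im c) * (\<i> * f s))"
      by (auto simp: complex_eq_iff)
    then have "m (\<lambda>s. c * f s) = of_real (Re c) * m f + of_real (Im c) * (\<i> * m f)"
      using add[OF V(2)[OF f] V(2)[OF V(2)[OF f]]] real[OF f] real[OF V(2)[OF f]] im[OF f] by simp
    also have "\<dots> = c * m f" by (auto simp: complex_eq_iff)
    finally show ?thesis .
  qed
  show ?thesis
  proof (rule that[of m])
    show "m (\<lambda>s. a * f s + b * g s) = a * m f + b * m g" if "f \<in> V" "g \<in> V" for a b f g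
      using add[OF V(2)[OF that(1)] V(2)[OF that(2)]] scale that by simp
    show "cmod (m f) \<le> p f" if f: "f \<in> V" for f
    proof (cases "m f = 0")
      case True
      then have "0 \<le> p f" using u(3)[OF f] by (simp add: m_def complex_eq_iff)
      with True show ?thesis by simp
    next
      case False
      \<comment> \<open>\<open>c\<close> rotates \<open>m f\<close> onto the nonnegative real axis,
        where the modulus is the real part and the real bound applies.\<close>
      define c where "c = cnj (m f) / cmod (m f)"
      have c: "cmod c = 1" using False by (simp add: c_def norm_divide)
      have "c * m f = cmod (m f)"
        using False complex_norm_square[of "m f"]
        by (simp add: c_def field_simps power2_eq_square)
      then have "cmod (m f) = Re (m (\<lambda>s. c * f s))" using scale[OF f] by simp
      also have "\<dots> = u (\<lambda>s. c * f s)" by (simp add: m_def)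
      also have "\<dots> \<le> p (\<lambda>s. c * f s)" by (intro u(3) V(2) f)
      also have "\<dots> = p f" using p(2)[OF f] c by simp
      finally show ?thesis .
    qed
    show "Re (m f0) = p f0" using u(4) by (simp add: m_def)
  qed
qed

section \<open>Left uniformly continuous functions and their functionals\<close>

lemma Cb_iff:
  "F \<in> mspace (Cb X) \<longleftrightarrow> F \<in> extensional (topspace X) \<and> continuous_map X euclidean F \<and>
    (\<exists>B. \<forall>x\<in>topspace X. cmod (F x) \<le> B)"
  by (auto simp: bounded_iff)

lemma Cb_bound:
  assumes "F \<in> mspace (Cb X)"
  obtains B where "0 \<le> B" "\<And>x. x \<in> topspace X \<Longrightarrow> cmod (F x) \<le> B"
proof -
  from assms obtain B where "\<forall>x\<in>topspace X. cmod (F x) \<le> B" unfolding Cb_iff by blast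
  then have "\<And>x. x \<in> topspace X \<Longrightarrow> cmod (F x) \<le> max B 0" by (simp add: le_max_iff_disj)
  then show ?thesis using that[of "max B 0"] by simp
qed

lemma zero_Cb: "(\<lambda>x\<in>topspace X. 0) \<in> mspace (Cb X)"
  unfolding Cb_iff using continuous_map_eq[of X euclidean "\<lambda>x. 0::complex" "\<lambda>x\<in>topspace X. 0"]
  by (auto intro: exI[of _ 0])

lemma sup_norm_le:
  "0 \<le> B \<Longrightarrow> (\<And>x. x \<in> topspace X \<Longrightarrow> cmod (F x) \<le> B) \<Longrightarrow> sup_norm X F \<le> B"
  unfolding sup_norm_def by (rule mdist_cfunspace_le) auto

lemma sup_norm_nonneg: "0 \<le> sup_norm X F"
  by (simp add: sup_norm_def)

lemma le_sup_norm: "F \<in> mspace (Cb X) \<Longrightarrow> x \<in> topspace X \<Longrightarrow> cmod (F x) \<le> sup_norm X F"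
  using mdist_cfunspace_imp_mdist_le[OF _ zero_Cb order_refl, of F X x]
  by (simp add: sup_norm_def)

lemma Cb_continuous_mapI:
  assumes F: "\<And>s. F s \<in> mspace (Cb X)"
    and lim: "\<And>s e. 0 < e \<Longrightarrow> \<forall>\<^sub>F t in nhds s. \<forall>x\<in>topspace X. cmod (F t x - F s x) \<le> e"
  shows "continuous_map euclidean (mtopology_of (Cb X)) F"
  unfolding mtopology_of_def
proof (subst Metric_space.continuous_map_to_metric, rule Metric_space_mspace_mdist, intro ballI allI impI)
  fix s and e :: real assume "0 < e"
  then have "\<forall>\<^sub>F t in nhds s. \<forall>x\<in>topspace X. cmod (F t x - F s x) \<le> e/2"
    by (intro lim) simp
  then obtain U where U: "open U" "s \<in> U" "\<And>t. t \<in> U \<Longrightarrow> \<forall>x\<in>topspace X. cmod (F t x - F s x) \<le> e/2"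
    by (auto simp: eventually_nhds)
  have "F t \<in> Metric_space.mball (mspace (Cb X)) (mdist (Cb X)) (F s) e" if "t \<in> U" for t
  proof -
    have "mdist (Cb X) (F s) (F t) \<le> e/2"
      using U(3)[OF that] \<open>0 < e\<close> by (intro mdist_cfunspace_le) (auto simp: dist_norm norm_minus_commute)
    then show ?thesis
      using F \<open>0 < e\<close> by (simp add: Metric_space.in_mball[OF Metric_space_mspace_mdist] del: mspace_cfunspace)
  qed
  with U show "\<exists>U. openin euclidean U \<and> s \<in> U \<and>
      (\<forall>t\<in>U. F t \<in> Metric_space.mball (mspace (Cb X)) (mdist (Cb X)) (F s) e)"
    by auto
qed

lemma Cb_continuous_mapD:
  assumes "continuous_map euclidean (mtopology_of (Cb X)) F" and e: "0 < e"
  shows "\<forall>\<^sub>F t in nhds s. \<forall>x\<in>topspace X. cmod (F t x - F s x) \<le> e"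
proof -
  obtain U where U: "open U" "s \<in> U"
      "\<And>t. t \<in> U \<Longrightarrow> F t \<in> Metric_space.mball (mspace (Cb X)) (mdist (Cb X)) (F s) e"
  proof -
    have "\<exists>U. openin euclidean U \<and> s \<in> U \<and>
        (\<forall>t\<in>U. F t \<in> Metric_space.mball (mspace (Cb X)) (mdist (Cb X)) (F s) e)"
      using assms(1)[unfolded mtopology_of_def
          Metric_space.continuous_map_to_metric[OF Metric_space_mspace_mdist]] e
      by (metis UNIV_I topspace_euclidean)
    then show thesis using that by (metis open_openin)
  qed
  have "\<forall>x\<in>topspace X. cmod (F t x - F s x) \<le> e" if "t \<in> U" for t
  proof -
    have *: "F s \<in> mspace (Cb X)" "F t \<in> mspace (Cb X)" "mdist (Cb X) (F s) (F t) \<le> e"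
      using U(3)[OF that] by (auto simp: Metric_space.in_mball[OF Metric_space_mspace_mdist] simp del: mspace_cfunspace)
    show ?thesis
      using mdist_cfunspace_imp_mdist_le[OF *] by (auto simp: dist_norm norm_minus_commute)
  qed
  with U show ?thesis by (auto simp: eventually_nhds)
qed

lemma continuous_map_complex_iff:
  "continuous_map X euclidean (f :: 'x \<Rightarrow> complex) \<longleftrightarrow>
    (\<forall>x\<in>topspace X. \<forall>e>0. \<exists>U. openin X U \<and> x \<in> U \<and> (\<forall>y\<in>U. cmod (f y - f x) < e))"
  using Met_TC.continuous_map_to_metric[of X f]
  by (simp add: dist_norm norm_minus_commute)

lemma norm_add_diff_le: "norm (a + b - c) \<le> norm a + norm b + norm (c :: 'a::real_normed_vector)"
  using norm_triangle_ineq4[of "a + b" c] norm_triangle_ineq[of a b] by simp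

lemma Cb_uniform_limit:
  assumes ext: "F \<in> extensional (topspace X)"
    and lim: "\<And>e. 0 < e \<Longrightarrow> \<exists>H\<in>mspace (Cb X). \<forall>x\<in>topspace X. cmod (F x - H x) \<le> e"
  shows "F \<in> mspace (Cb X)"
proof -
  have "continuous_map X euclidean F"
    unfolding continuous_map_complex_iff
  proof (intro ballI allI impI)
    fix x and e :: real assume x: "x \<in> topspace X" and e: "0 < e"
    obtain H where H: "H \<in> mspace (Cb X)" "\<forall>x\<in>topspace X. cmod (F x - H x) \<le> e/4"
      using lim[of "e/4"] e by auto
    obtain U where U: "openin X U" "x \<in> U" "\<forall>y\<in>U. cmod (H y - H x) < e/2"
      using H(1)[unfolded Cb_iff continuous_map_complex_iff, THEN conjunct2, THEN conjunct1,
          rule_format, OF x, of "e/2"] e by auto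
    have "cmod (F y - F x) < e" if "y \<in> U" for y
    proof -
      have y: "y \<in> topspace X" using U(1) that openin_subset by blast
      have "F y - F x = (F y - H y) + (H y - H x) - (F x - H x)" by simp
      then have "cmod (F y - F x) \<le> cmod (F y - H y) + cmod (H y - H x) + cmod (F x - H x)"
        by (metis norm_add_diff_le)
      with H(2)[rule_format, OF x] H(2)[rule_format, OF y] U(3) that e show ?thesis by fastforce
    qed
    with U show "\<exists>U. openin X U \<and> x \<in> U \<and> (\<forall>y\<in>U. cmod (F y - F x) < e)" by blast
  qed
  moreover obtain H where H: "H \<in> mspace (Cb X)" "\<forall>x\<in>topspace X. cmod (F x - H x) \<le> 1"
    using lim[of 1] by auto
  obtain B where B: "\<And>x. x \<in> topspace X \<Longrightarrow> cmod (H x) \<le> B"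
    using Cb_bound[OF H(1)] by metis
  have "cmod (F x) \<le> 1 + B" if "x \<in> topspace X" for x
    using norm_triangle_ineq[of "F x - H x" "H x"] H(2) B[OF that] that by fastforce
  ultimately show ?thesis unfolding Cb_iff using ext by blast
qed

lemma ltrans_apply [simp]: "x \<in> topspace X \<Longrightarrow> ltrans X act s F x = F (act s x)"
  by (simp add: ltrans_def)

lemma ltrans_euclidean: "ltrans euclidean act s F = (\<lambda>x. F (act s x))"
  by (simp add: ltrans_def restrict_UNIV)

lemma G_space_act_in: "G_space X act \<Longrightarrow> x \<in> topspace X \<Longrightarrow> act s x \<in> topspace X"
  by (force simp: G_space_def continuous_map_def Pi_iff split_beta)

lemma G_space_act_add:
  "G_space X act \<Longrightarrow> x \<in> topspace X \<Longrightarrow> act (s + t) x = act s (act t x)"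
  by (simp add: G_space_def)

lemma G_space_act_0: "G_space X act \<Longrightarrow> x \<in> topspace X \<Longrightarrow> act 0 x = x"
  by (simp add: G_space_def)

lemma G_space_continuous_act:
  assumes "G_space X act"
  shows "continuous_map X X (act s)"
proof -
  have "continuous_map X (prod_topology euclidean X) (\<lambda>x. (s, x))"
    by (intro continuous_intros) auto
  then have "continuous_map X X ((\<lambda>(s, x). act s x) \<circ> (\<lambda>x. (s, x)))"
    using assms by (intro continuous_map_compose) (auto simp: G_space_def)
  then show ?thesis by (simp add: o_def)
qed

lemma ltrans_Cb:
  assumes "G_space X act" "F \<in> mspace (Cb X)"
  shows "ltrans X act s F \<in> mspace (Cb X)"
proof -
  have "continuous_map X euclidean (F \<circ> act s)"
    using G_space_continuous_act[OF assms(1)] assms(2)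
    unfolding Cb_iff by (blast intro: continuous_map_compose)
  then have "continuous_map X euclidean (ltrans X act s F)"
    by (rule continuous_map_eq) (simp add: ltrans_def)
  moreover obtain B where "\<And>x. x \<in> topspace X \<Longrightarrow> cmod (F x) \<le> B"
    using Cb_bound[OF assms(2)] by metis
  then have "\<forall>x\<in>topspace X. cmod (ltrans X act s F x) \<le> B"
    using G_space_act_in[OF assms(1)] by (simp add: ltrans_def)
  ultimately show ?thesis unfolding Cb_iff by (auto simp: ltrans_def)
qed

text \<open>The first shift moves neighbourhoods of 0 to \<open>s\<close>; the second is
  conjugation, which is nontrivial because the group law need not be commutative.\<close>

lemma eventually_nhds_shift:
  fixes s :: "'g::topological_group_add"
  assumes "\<forall>\<^sub>F t in nhds 0. P t"
  shows "\<forall>\<^sub>F t in nhds s. P (t - s)" "\<forall>\<^sub>F t in nhds 0. P (s + t - s)"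
proof -
  have "filterlim (\<lambda>t. t - s) (nhds (s - s)) (nhds s)"
    by (intro tendsto_intros filterlim_ident)
  then show "\<forall>\<^sub>F t in nhds s. P (t - s)"
    using assms eventually_compose_filterlim[of P "nhds 0"] by simp
  have "filterlim (\<lambda>t. s + t - s) (nhds (s + 0 - s)) (nhds 0)"
    by (intro tendsto_intros filterlim_ident)
  then show "\<forall>\<^sub>F t in nhds 0. P (s + t - s)"
    using assms eventually_compose_filterlim[of P "nhds 0"] by simp
qed

text \<open>Continuity of the orbit map at 0 suffices: since
  \<open>act t x = act (t - s) (act s x)\<close>, the difference of two translates is a difference
  at 0 taken at the point \<open>act s x\<close>, and the estimate at 0 is uniform over all
  points.\<close>

lemma LUC_iff:
  fixes act :: "'g::topological_group_add \<Rightarrow> 'x \<Rightarrow> 'x"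
  assumes G: "G_space X act"
  shows "F \<in> LUC X act \<longleftrightarrow> F \<in> mspace (Cb X) \<and>
    (\<forall>e>0. \<forall>\<^sub>F t in nhds 0. \<forall>x\<in>topspace X. cmod (F (act t x) - F x) \<le> e)"
proof (intro iffI conjI allI impI)
  assume F: "F \<in> LUC X act"
  then show "F \<in> mspace (Cb X)" by (simp add: LUC_def)
  fix e :: real assume "0 < e"
  then have "\<forall>\<^sub>F t in nhds 0. \<forall>x\<in>topspace X. cmod (ltrans X act t F x - ltrans X act 0 F x) \<le> e"
    using F by (intro Cb_continuous_mapD) (auto simp: LUC_def)
  then show "\<forall>\<^sub>F t in nhds 0. \<forall>x\<in>topspace X. cmod (F (act t x) - F x) \<le> e"
    by eventually_elim (simp add: G_space_act_0[OF G])
next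
  assume F: "F \<in> mspace (Cb X) \<and>
    (\<forall>e>0. \<forall>\<^sub>F t in nhds 0. \<forall>x\<in>topspace X. cmod (F (act t x) - F x) \<le> e)"
  have "continuous_map euclidean (mtopology_of (Cb X)) (\<lambda>s. ltrans X act s F)"
  proof (rule Cb_continuous_mapI)
    show "ltrans X act s F \<in> mspace (Cb X)" for s using ltrans_Cb[OF G] F by blast
    fix s and e :: real assume "0 < e"
    then have "\<forall>\<^sub>F t in nhds 0. \<forall>x\<in>topspace X. cmod (F (act t x) - F x) \<le> e" using F by blast
    from eventually_nhds_shift(1)[OF this, of s]
    show "\<forall>\<^sub>F t in nhds s. \<forall>x\<in>topspace X. cmod (ltrans X act t F x - ltrans X act s F x) \<le> e"
    proof eventually_elim
      case (elim t)
      show ?case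
      proof
        fix x assume x: "x \<in> topspace X"
        have "act t x = act (t - s) (act s x)"
          using G_space_act_add[OF G x, of "t - s" s] by simp
        with elim G_space_act_in[OF G x] x
        show "cmod (ltrans X act t F x - ltrans X act s F x) \<le> e" by simp
      qed
    qed
  qed
  with F show "F \<in> LUC X act" by (simp add: LUC_def)
qed

lemma LUC_Cb: "F \<in> LUC X act \<Longrightarrow> F \<in> mspace (Cb X)"
  by (simp add: LUC_def)

lemma LUC_bound:
  assumes "F \<in> LUC X act"
  obtains B where "0 \<le> B" "\<And>x. x \<in> topspace X \<Longrightarrow> cmod (F x) \<le> B"
  using Cb_bound[OF LUC_Cb[OF assms]] by metis

lemma LUC_small:
  "G_space X act \<Longrightarrow> F \<in> LUC X act \<Longrightarrow> 0 < e \<Longrightarrow>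
    \<forall>\<^sub>F t in nhds 0. \<forall>x\<in>topspace X. cmod (F (act t x) - F x) \<le> e"
  by (simp add: LUC_iff)

lemma LUC_zero: "G_space X act \<Longrightarrow> (\<lambda>x\<in>topspace X. 0) \<in> LUC X act"
  by (simp add: LUC_iff zero_Cb G_space_act_in del: mspace_cfunspace)

lemma continuous_map_cmult:
  "continuous_map X euclidean F \<Longrightarrow> continuous_map X euclidean (\<lambda>x. (c::complex) * F x)"
  using continuous_map_compose[of X euclidean F euclidean "\<lambda>z. c * z"]
  by (simp add: o_def continuous_on_mult_left)

lemma LUC_lincomb:
  assumes G: "G_space X act" and F: "F \<in> LUC X act" and H: "H \<in> LUC X act"
  shows "(\<lambda>x\<in>topspace X. a * F x + b * H x) \<in> LUC X act"
  unfolding LUC_iff[OF G]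
proof (intro conjI allI impI)
  have "continuous_map X euclidean (\<lambda>x. a * F x + b * H x)"
    using F H unfolding LUC_def Cb_iff
    by (auto intro!: continuous_map_add continuous_map_cmult)
  then have "continuous_map X euclidean (\<lambda>x\<in>topspace X. a * F x + b * H x)"
    by (rule continuous_map_eq) simp
  moreover obtain B where B: "\<And>x. x \<in> topspace X \<Longrightarrow> cmod (F x) \<le> B" using LUC_bound[OF F] by metis
  moreover obtain C where C: "\<And>x. x \<in> topspace X \<Longrightarrow> cmod (H x) \<le> C" using LUC_bound[OF H] by metis
  have "cmod (a * F x + b * H x) \<le> cmod a * B + cmod b * C" if "x \<in> topspace X" for x
    using B[OF that] C[OF that]
    by (intro order_trans[OF norm_triangle_ineq] add_mono) (auto simp: norm_mult intro: mult_left_mono)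
  ultimately show "(\<lambda>x\<in>topspace X. a * F x + b * H x) \<in> mspace (Cb X)"
    unfolding Cb_iff by auto
next
  fix e :: real assume e: "0 < e"
  define d where "d = e / (cmod a + cmod b + 1)"
  have pos: "0 < cmod a + cmod b + 1" by (simp add: add_nonneg_pos)
  then have d: "0 < d" using e by (simp add: d_def)
  show "\<forall>\<^sub>F t in nhds 0. \<forall>x\<in>topspace X. cmod ((\<lambda>x\<in>topspace X. a * F x + b * H x) (act t x) -
      (\<lambda>x\<in>topspace X. a * F x + b * H x) x) \<le> e"
    using LUC_small[OF G F d] LUC_small[OF G H d]
  proof eventually_elim
    case (elim t)
    show ?case
    proof
      fix x assume x: "x \<in> topspace X"
      have "cmod (a * (F (act t x) - F x) + b * (H (act t x) - H x)) \<le> cmod a * d + cmod b * d"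
        using elim x
        by (intro order_trans[OF norm_triangle_ineq] add_mono) (auto simp: norm_mult intro: mult_left_mono)
      also have "\<dots> \<le> (cmod a + cmod b + 1) * d" using d by (simp add: algebra_simps)
      also have "\<dots> = e" using pos by (simp add: d_def)
      finally show "cmod ((\<lambda>x\<in>topspace X. a * F x + b * H x) (act t x) -
          (\<lambda>x\<in>topspace X. a * F x + b * H x) x) \<le> e"
        using x G_space_act_in[OF G x] by (simp add: algebra_simps)
    qed
  qed
qed

lemma LUC_uniform_limit:
  assumes G: "G_space X act" and ext: "F \<in> extensional (topspace X)"
    and lim: "\<And>e. 0 < e \<Longrightarrow> \<exists>H\<in>LUC X act. \<forall>x\<in>topspace X. cmod (F x - H x) \<le> e"
  shows "F \<in> LUC X act"
  unfolding LUC_iff[OF G]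
proof (intro conjI allI impI)
  show "F \<in> mspace (Cb X)" using lim LUC_Cb by (intro Cb_uniform_limit ext) blast
  fix e :: real assume e: "0 < e"
  obtain H where H: "H \<in> LUC X act" "\<forall>x\<in>topspace X. cmod (F x - H x) \<le> e/3"
    using lim[of "e/3"] e by auto
  have "0 < e/3" using e by simp
  show "\<forall>\<^sub>F t in nhds 0. \<forall>x\<in>topspace X. cmod (F (act t x) - F x) \<le> e"
    using LUC_small[OF G H(1) \<open>0 < e/3\<close>]
  proof eventually_elim
    case (elim t)
    have "cmod (F (act t x) - F x) \<le> e" if x: "x \<in> topspace X" for x
    proof -
    have *: "F (act t x) - F x = (F (act t x) - H (act t x)) + (H (act t x) - H x) - (F x - H x)" by simp
    have "cmod (F (act t x) - F x) \<le> cmod (F (act t x) - H (act t x)) + cmod (H (act t x) - H x) + cmod (F x - H x)"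
      unfolding * by (rule norm_add_diff_le)
    also have "\<dots> \<le> e/3 + e/3 + e/3"
      using H(2) elim G_space_act_in[OF G] x by (intro add_mono) auto
    finally show ?thesis by simp
    qed
    then show ?case by blast
  qed
qed

text \<open>\<open>act s (act t x) = act (s + t - s) (act s x)\<close>, and conjugation by
  \<open>s\<close> is continuous at 0.\<close>

lemma LUC_ltrans:
  assumes G: "G_space X act" and F: "F \<in> LUC X act"
  shows "ltrans X act s F \<in> LUC X act"
  unfolding LUC_iff[OF G]
proof (intro conjI allI impI)
  show "ltrans X act s F \<in> mspace (Cb X)" using ltrans_Cb[OF G LUC_Cb[OF F]] .
  fix e :: real assume "0 < e"
  from eventually_nhds_shift(2)[OF LUC_small[OF G F this], of s]
  show "\<forall>\<^sub>F t in nhds 0. \<forall>x\<in>topspace X. cmod (ltrans X act s F (act t x) - ltrans X act s F x) \<le> e"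
  proof eventually_elim
    case (elim t)
    show ?case
    proof
      fix x assume x: "x \<in> topspace X"
      have "act s (act t x) = act (s + t - s) (act s x)"
        using G_space_act_add[OF G x, of "s + t - s" s] G_space_act_add[OF G x, of s t] by simp
      with elim x G_space_act_in[OF G x]
      show "cmod (ltrans X act s F (act t x) - ltrans X act s F x) \<le> e" by simp
    qed
  qed
qed

lemma ltrans_ltrans:
  "G_space X act \<Longrightarrow> ltrans X act s (ltrans X act t F) = ltrans X act (t + s) F"
  by (auto simp: ltrans_def fun_eq_iff G_space_act_in G_space_act_add)

lemma G_space_self:
  assumes "locally_compact_space (euclidean :: 'g::{topological_group_add, t2_space} topology)"
  shows "G_space (euclidean :: 'g topology) (+)"
proof -
  have "continuous_map (prod_topology euclidean euclidean) euclidean (\<lambda>(s::'g, t). s + t)"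
    unfolding case_prod_unfold
    by (simp add: euclidean_product_topology) (intro continuous_intros)
  moreover have "Hausdorff_space (euclidean :: 'g topology)"
    unfolding Hausdorff_space_def disjnt_def by (simp, metis hausdorff)
  ultimately show ?thesis using assms by (simp add: G_space_def add.assoc)
qed

lemma cdualI:
  assumes "M \<in> extensional V"
    and "\<And>a b F H. F \<in> V \<Longrightarrow> H \<in> V \<Longrightarrow> M (\<lambda>x\<in>topspace X. a * F x + b * H x) = a * M F + b * M H"
    and V: "V \<subseteq> mspace (Cb X)"
    and C: "\<And>F B. F \<in> V \<Longrightarrow> 0 \<le> B \<Longrightarrow> (\<And>x. x \<in> topspace X \<Longrightarrow> cmod (F x) \<le> B) \<Longrightarrow> cmod (M F) \<le> C * B"
  shows "M \<in> cdual X V"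
proof -
  have "cmod (M F) \<le> C * sup_norm X F" if "F \<in> V" for F
    using that V by (intro C sup_norm_nonneg le_sup_norm) auto
  with assms show ?thesis unfolding cdual_def by blast
qed

text \<open>Any pointwise bound \<open>B\<close> replaces the norm. On an empty space every real
  number is such a bound, hence \<open>0 <= B\<close>. The maximum with 0 covers a negative constant
  in the definition of the dual.\<close>

lemma cdual_bound:
  assumes "M \<in> cdual X V"
  obtains C where "0 \<le> C"
    "\<And>F B. F \<in> V \<Longrightarrow> 0 \<le> B \<Longrightarrow> (\<And>x. x \<in> topspace X \<Longrightarrow> cmod (F x) \<le> B) \<Longrightarrow> cmod (M F) \<le> C * B"
proof -
  obtain C where C: "\<forall>F\<in>V. cmod (M F) \<le> C * sup_norm X F" using assms by (auto simp: cdual_def)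
  have "cmod (M F) \<le> max C 0 * B"
    if "F \<in> V" "0 \<le> B" "\<And>x. x \<in> topspace X \<Longrightarrow> cmod (F x) \<le> B" for F B
  proof -
    have "cmod (M F) \<le> C * sup_norm X F" using C that by blast
    also have "\<dots> \<le> max C 0 * B"
      using sup_norm_le[OF that(2,3)] that(2) by (intro mult_mono sup_norm_nonneg) auto
    finally show ?thesis .
  qed
  then show ?thesis using that[of "max C 0"] by simp
qed

lemma cdual_lin:
  "M \<in> cdual X V \<Longrightarrow> F \<in> V \<Longrightarrow> H \<in> V \<Longrightarrow>
    M (\<lambda>x\<in>topspace X. a * F x + b * H x) = a * M F + b * M H"
  by (simp add: cdual_def)

lemma cdual_extensional: "M \<in> cdual X V \<Longrightarrow> M \<in> extensional V"
  by (simp add: cdual_def)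

lemma cdual_eqI:
  "M \<in> cdual X V \<Longrightarrow> N \<in> cdual X V \<Longrightarrow> (\<And>F. F \<in> V \<Longrightarrow> M F = N F) \<Longrightarrow> M = N"
  by (rule extensionalityI[of _ V]) (auto simp: cdual_extensional)

lemma zero_cdual: "V \<subseteq> mspace (Cb X) \<Longrightarrow>
    (\<And>a b F H. F \<in> V \<Longrightarrow> H \<in> V \<Longrightarrow> (\<lambda>x\<in>topspace X. a * F x + b * H x) \<in> V) \<Longrightarrow>
    (\<lambda>F\<in>V. 0) \<in> cdual X V"
  by (rule cdualI[where C = 0]) auto

lemma cdual_lincomb:
  assumes V: "V \<subseteq> mspace (Cb X)"
    "\<And>a b F H. F \<in> V \<Longrightarrow> H \<in> V \<Longrightarrow> (\<lambda>x\<in>topspace X. a * F x + b * H x) \<in> V"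
    and M: "M \<in> cdual X V" and N: "N \<in> cdual X V"
  shows "(\<lambda>F\<in>V. a * M F + b * N F) \<in> cdual X V"
proof -
  obtain C where C: "\<And>F B. F \<in> V \<Longrightarrow> 0 \<le> B \<Longrightarrow> (\<And>x. x \<in> topspace X \<Longrightarrow> cmod (F x) \<le> B) \<Longrightarrow> cmod (M F) \<le> C * B"
    using cdual_bound[OF M] by metis
  obtain D where D: "\<And>F B. F \<in> V \<Longrightarrow> 0 \<le> B \<Longrightarrow> (\<And>x. x \<in> topspace X \<Longrightarrow> cmod (F x) \<le> B) \<Longrightarrow> cmod (N F) \<le> D * B"
    using cdual_bound[OF N] by metis
  show ?thesis
  proof (rule cdualI[OF _ _ V(1), where C = "cmod a * C + cmod b * D"])
    fix F B assume F: "F \<in> V" "0 \<le> B" "\<And>x. x \<in> topspace X \<Longrightarrow> cmod (F x) \<le> B"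
    have "cmod (a * M F + b * N F) \<le> cmod a * (C * B) + cmod b * (D * B)"
      using C[OF F] D[OF F]
      by (intro order_trans[OF norm_triangle_ineq] add_mono) (auto simp: norm_mult intro: mult_left_mono)
    with F(1) show "cmod ((\<lambda>F\<in>V. a * M F + b * N F) F) \<le> (cmod a * C + cmod b * D) * B"
      by (simp add: algebra_simps)
  next
    fix p q F H assume FH: "F \<in> V" "H \<in> V"
    show "(\<lambda>F\<in>V. a * M F + b * N F) (\<lambda>x\<in>topspace X. p * F x + q * H x) =
        p * (\<lambda>F\<in>V. a * M F + b * N F) F + q * (\<lambda>F\<in>V. a * M F + b * N F) H"
      using V(2)[OF FH] FH cdual_lin[OF M FH] cdual_lin[OF N FH] by (simp add: algebra_simps)
  qed auto
qed

lemma LUC_groupI: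
  fixes f :: "'g::{topological_group_add, t2_space} \<Rightarrow> complex"
  assumes lc: "locally_compact_space (euclidean :: 'g topology)"
    and bdd: "\<And>s. cmod (f s) \<le> B"
    and small: "\<And>e. 0 < e \<Longrightarrow> \<forall>\<^sub>F t in nhds 0. \<forall>s. cmod (f (t + s) - f s) \<le> e"
  shows "f \<in> LUC_group"
proof -
  have "continuous_map euclidean euclidean f"
    unfolding continuous_map_complex_iff
  proof (intro ballI allI impI)
    fix s and e :: real assume "0 < e"
    then have "\<forall>\<^sub>F t in nhds 0. \<forall>s. cmod (f (t + s) - f s) \<le> e/2"
      by (intro small) simp
    from eventually_nhds_shift(1)[OF this, of s]
    obtain U where U: "open U" "s \<in> U" "\<And>t. t \<in> U \<Longrightarrow> \<forall>r. cmod (f (t - s + r) - f r) \<le> e/2"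
      unfolding eventually_nhds by blast
    have "cmod (f t - f s) < e" if "t \<in> U" for t
      using U(3)[OF that, rule_format, of s] \<open>0 < e\<close> by simp
    with U show "\<exists>U. openin euclidean U \<and> s \<in> U \<and> (\<forall>t\<in>U. cmod (f t - f s) < e)"
      by auto
  qed
  with bdd have "f \<in> mspace (Cb euclidean)"
    unfolding Cb_iff by auto
  with small show ?thesis by (simp add: LUC_iff[OF G_space_self[OF lc]] del: mspace_cfunspace)
qed

text \<open>The modulus of continuity of \<open>F\<close> transfers uniformly in \<open>s\<close>:
  the translates by \<open>t + s\<close> and \<open>s\<close> differ at \<open>x\<close> by the
  values of \<open>F\<close> at \<open>act t y\<close> and \<open>y\<close>, where
  \<open>y = act s x\<close>.\<close>

lemma fun_act_LUC:
  fixes act :: "'g::{topological_group_add, t2_space} \<Rightarrow> 'x \<Rightarrow> 'x"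
  assumes lc: "locally_compact_space (euclidean :: 'g topology)" and G: "G_space X act"
    and M: "M \<in> cdual X (LUC X act)" and F: "F \<in> LUC X act"
  shows "fun_act X act M F \<in> LUC_group"
proof -
  obtain C where C: "0 \<le> C" "\<And>F B. F \<in> LUC X act \<Longrightarrow> 0 \<le> B \<Longrightarrow>
      (\<And>x. x \<in> topspace X \<Longrightarrow> cmod (F x) \<le> B) \<Longrightarrow> cmod (M F) \<le> C * B"
    using cdual_bound[OF M] by metis
  obtain B where B: "0 \<le> B" "\<And>x. x \<in> topspace X \<Longrightarrow> cmod (F x) \<le> B" using LUC_bound[OF F] by metis
  have small: "\<forall>\<^sub>F t in nhds 0. \<forall>s. cmod (fun_act X act M F (t + s) - fun_act X act M F s) \<le> e"
    if e: "0 < e" for e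
  proof -
    \<comment> \<open>Adding 1 keeps the quotient positive when \<open>C = 0\<close>; the same
      device recurs below.\<close>
    define d where "d = e / (C + 1)"
    have d: "0 < d" "C * d \<le> e" using e C(1) by (auto simp: d_def field_simps)
    show ?thesis
      using LUC_small[OF G F d(1)]
    proof eventually_elim
      case (elim t)
      show ?case
      proof
        fix s
        let ?H = "\<lambda>x\<in>topspace X. 1 * ltrans X act (t + s) F x + (-1) * ltrans X act s F x"
        have "?H \<in> LUC X act" by (intro LUC_lincomb G LUC_ltrans F)
        moreover have "cmod (?H x) \<le> d" if "x \<in> topspace X" for x
          using elim G_space_act_in[OF G that] that by (simp add: G_space_act_add[OF G])
        ultimately have "cmod (M ?H) \<le> C * d" using d by (intro C) auto
        also have "M ?H = 1 * M (ltrans X act (t + s) F) + (-1) * M (ltrans X act s F)"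
          by (intro cdual_lin[OF M] LUC_ltrans G F)
        finally show "cmod (fun_act X act M F (t + s) - fun_act X act M F s) \<le> e"
          using d(2) by (simp add: fun_act_def)
      qed
    qed
  qed
  have "cmod (fun_act X act M F s) \<le> C * B" for s
    unfolding fun_act_def
    by (rule C(2)) (use B in \<open>auto intro!: LUC_ltrans G F simp: G_space_act_in[OF G]\<close>)
  then show ?thesis using small by (rule LUC_groupI[OF lc])
qed

lemma dual_act_cdual:
  fixes act :: "'g::{topological_group_add, t2_space} \<Rightarrow> 'x \<Rightarrow> 'x"
  assumes lc: "locally_compact_space (euclidean :: 'g topology)" and G: "G_space X act"
    and m: "m \<in> cdual euclidean LUC_group" and M: "M \<in> cdual X (LUC X act)"
  shows "dual_act X act m M \<in> cdual X (LUC X act)"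
proof -
  obtain C where C: "0 \<le> C" "\<And>F B. F \<in> LUC X act \<Longrightarrow> 0 \<le> B \<Longrightarrow>
      (\<And>x. x \<in> topspace X \<Longrightarrow> cmod (F x) \<le> B) \<Longrightarrow> cmod (M F) \<le> C * B"
    using cdual_bound[OF M] by metis
  obtain D where D: "\<And>F B. F \<in> LUC_group \<Longrightarrow> 0 \<le> B \<Longrightarrow>
      (\<And>x. x \<in> topspace (euclidean :: 'g topology) \<Longrightarrow> cmod (F x) \<le> B) \<Longrightarrow> cmod (m F) \<le> D * B"
    using cdual_bound[OF m] by metis
  show ?thesis
  proof (rule cdualI[where C = "D * C"])
    show "dual_act X act m M \<in> extensional (LUC X act)" by (simp add: dual_act_def)
    show "LUC X act \<subseteq> mspace (Cb X)" using LUC_Cb by blast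
  next
    fix a b F H assume F: "F \<in> LUC X act" and H: "H \<in> LUC X act"
    have FH: "(\<lambda>x\<in>topspace X. a * F x + b * H x) \<in> LUC X act" by (rule LUC_lincomb[OF G F H])
    have tr: "ltrans X act s (\<lambda>x\<in>topspace X. a * F x + b * H x) =
        (\<lambda>x\<in>topspace X. a * ltrans X act s F x + b * ltrans X act s H x)" for s
      by (auto simp: ltrans_def fun_eq_iff G_space_act_in[OF G])
    have "fun_act X act M (\<lambda>x\<in>topspace X. a * F x + b * H x) =
        (\<lambda>s\<in>topspace euclidean. a * fun_act X act M F s + b * fun_act X act M H s)"
      unfolding fun_act_def tr by (simp add: cdual_lin[OF M] LUC_ltrans G F H restrict_UNIV)
    then show "dual_act X act m M (\<lambda>x\<in>topspace X. a * F x + b * H x) =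
        a * dual_act X act m M F + b * dual_act X act m M H"
      using cdual_lin[OF m fun_act_LUC[OF lc G M F] fun_act_LUC[OF lc G M H]]
      by (simp add: dual_act_def F H FH)
  next
    fix F B assume F: "F \<in> LUC X act" and B: "0 \<le> B" "\<And>x. x \<in> topspace X \<Longrightarrow> cmod (F x) \<le> B"
    have "cmod (fun_act X act M F s) \<le> C * B" for s
      unfolding fun_act_def
      by (rule C(2)) (use B in \<open>auto intro!: LUC_ltrans G F simp: G_space_act_in[OF G]\<close>)
    then have "cmod (m (fun_act X act M F)) \<le> D * (C * B)"
      using B(1) C(1) by (intro D fun_act_LUC lc G M F) auto
    then show "cmod (dual_act X act m M F) \<le> D * C * B" by (simp add: dual_act_def F mult.assoc)
  qed
qed

lemma ltrans_fun_act:
  "G_space X act \<Longrightarrow> ltrans euclidean (+) s (fun_act X act M F) = fun_act X act M (ltrans X act s F)"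
  by (simp add: ltrans_euclidean fun_act_def ltrans_ltrans)

text \<open>Associativity of the action. It turns the action of the group on itself, applied to a
  function coming from \<open>X\<close>, into an action on functionals over
  \<open>X\<close>.\<close>

lemma fun_act_fun_act:
  assumes "G_space X act" "F \<in> LUC X act"
  shows "fun_act euclidean (+) n (fun_act X act M F) = fun_act X act (dual_act X act n M) F"
proof
  fix s
  have "fun_act euclidean (+) n (fun_act X act M F) s = n (fun_act X act M (ltrans X act s F))"
    by (simp add: fun_act_def[of euclidean] ltrans_fun_act[OF assms(1)])
  then show "fun_act euclidean (+) n (fun_act X act M F) s = fun_act X act (dual_act X act n M) F s"
    unfolding fun_act_def[of X act "dual_act X act n M"] by (simp add: dual_act_def LUC_ltrans assms)
qed

section \<open>Compactly supported functions\<close>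

definition Cc :: "('a::topological_space \<Rightarrow> complex) set"
  where "Cc = {f. continuous_on UNIV f \<and> (\<exists>K. compact K \<and> (\<forall>x. x \<notin> K \<longrightarrow> f x = 0))}"

lemma CcI: "continuous_on UNIV f \<Longrightarrow> compact K \<Longrightarrow> (\<And>x. x \<notin> K \<Longrightarrow> f x = 0) \<Longrightarrow> f \<in> Cc"
  by (auto simp: Cc_def)

lemma CcE:
  assumes "f \<in> Cc"
  obtains K where "compact K" "\<And>x. x \<notin> K \<Longrightarrow> f x = 0" "continuous_on UNIV f"
  using assms by (auto simp: Cc_def)

lemma Cc_mult: "f \<in> Cc \<Longrightarrow> continuous_on UNIV g \<Longrightarrow> (\<lambda>x. g x * f x) \<in> Cc"
  by (erule CcE) (auto intro!: CcI continuous_intros)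

lemma Cc_lincomb: "f \<in> Cc \<Longrightarrow> g \<in> Cc \<Longrightarrow> (\<lambda>x. a * f x + b * g x) \<in> Cc"
proof (elim CcE)
  fix K L
  assume "compact K" "compact L" "\<And>x. x \<notin> K \<Longrightarrow> f x = 0" "\<And>x. x \<notin> L \<Longrightarrow> g x = 0"
    "continuous_on UNIV f" "continuous_on UNIV g"
  then show ?thesis by (intro CcI[of _ "K \<union> L"]) (auto intro!: continuous_intros)
qed

lemma Cc_bounded:
  assumes "f \<in> Cc"
  obtains B where "0 \<le> B" "\<And>x. cmod (f x) \<le> B"
proof -
  obtain K where K: "compact K" "\<And>x. x \<notin> K \<Longrightarrow> f x = 0" "continuous_on UNIV f" using assms by (auto simp: Cc_def)
  have "compact (f ` K)" using K by (intro compact_continuous_image continuous_on_subset[OF K(3)]) auto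
  then obtain B where "\<And>x. x \<in> K \<Longrightarrow> cmod (f x) \<le> B"
    using compact_imp_bounded[of "f ` K"] by (auto simp: bounded_iff)
  then have "cmod (f x) \<le> max B 0" for x using K(2)[of x] by (cases "x \<in> K") (auto simp: le_max_iff_disj)
  then show ?thesis using that[of "max B 0"] by simp
qed

lemma compact_set_plus:
  fixes A B :: "'g::topological_group_add set"
  assumes "compact A" "compact B"
  shows "compact (A + B)"
proof -
  have "A + B = (\<lambda>p. fst p + snd p) ` (A \<times> B)" by (auto simp: set_plus_def image_def)
  moreover have "compact \<dots>"
    by (intro compact_continuous_image compact_Times assms continuous_intros)
  ultimately show ?thesis by simp
qed

lemma compact_uminus:
  fixes A :: "'g::topological_group_add set"
  shows "compact A \<Longrightarrow> compact (uminus ` A)"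
  by (intro compact_continuous_image continuous_on_minus continuous_on_id)

lemma locally_compact_nhd_compact:
  fixes K :: "'a::t2_space set"
  assumes lc: "locally_compact_space (euclidean :: 'a topology)" and K: "compact K"
  obtains U L where "open U" "compact L" "K \<subseteq> U" "U \<subseteq> L"
proof -
  have "Hausdorff_space (euclidean :: 'a topology)"
    unfolding Hausdorff_space_def disjnt_def by (simp, metis hausdorff)
  with lc have "\<exists>U L. openin euclidean U \<and> compactin euclidean L \<and> closedin euclidean L \<and> K \<subseteq> U \<and> U \<subseteq> L"
    using K locally_compact_space_compact_closed_compact[of "euclidean :: 'a topology"] by simp
  then show ?thesis using that by auto
qed

text \<open>The usual separating function may stay nonzero up to the boundary of \<open>U\<close>.
  Passing to \<open>max 0 (2 * f x - 1)\<close> confines it to the closed set where \<open>f\<close>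
  is at least 1/2, which is a compact subset of \<open>U\<close>.\<close>

lemma Urysohn_compact:
  fixes K U :: "'a::t2_space set"
  assumes lc: "locally_compact_space (euclidean :: 'a topology)"
    and K: "compact K" and U: "open U" "K \<subseteq> U"
  obtains f :: "'a \<Rightarrow> real" and C where "continuous_on UNIV f" "\<And>x. 0 \<le> f x" "\<And>x. f x \<le> 1"
    "\<And>x. x \<in> K \<Longrightarrow> f x = 1" "compact C" "C \<subseteq> U" "\<And>x. x \<notin> C \<Longrightarrow> f x = 0"
proof -
  obtain V L where V: "open V" "compact L" "K \<subseteq> V" "V \<subseteq> L"
    using locally_compact_nhd_compact[OF lc K] by blast
  have haus: "Hausdorff_space (euclidean :: 'a topology)"
    unfolding Hausdorff_space_def disjnt_def by (simp, metis hausdorff)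
  obtain f where f: "continuous_map euclidean (top_of_set {0..1::real}) f"
      "f ` (- (U \<inter> V)) \<subseteq> {0}" "f ` K \<subseteq> {1}"
    using Urysohn_completely_regular_compact_closed[of 0 1 "euclidean :: 'a topology" K "- (U \<inter> V)"]
      locally_compact_regular_imp_completely_regular_space[OF lc] haus K U V
    by (auto simp: compactin_euclidean_iff disjnt_def)
  have cont: "continuous_on UNIV f" and range: "\<And>x. f x \<in> {0..1}"
    using f(1) by (auto simp: continuous_map_in_subtopology)
  define C where "C = {x. 1/2 \<le> f x}"
  have "closed C" unfolding C_def by (intro closed_Collect_le cont continuous_intros)
  moreover have CUV: "C \<subseteq> U \<inter> V" using f(2) by (force simp: C_def)
  ultimately have "compact C"
    using V compact_Int_closed[of L C] by (metis Int_absorb1 le_infE subset_trans)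
  show ?thesis
  proof (rule that[of "\<lambda>x. max 0 (2 * f x - 1)" C])
    show "continuous_on UNIV (\<lambda>x. max 0 (2 * f x - 1))" by (intro continuous_intros cont)
    show "max 0 (2 * f x - 1) \<le> 1" for x using range[of x] by auto
  qed (use f(3) \<open>compact C\<close> CUV in \<open>auto simp: C_def image_subset_iff\<close>)
qed

context
  assumes lc: "locally_compact_space (euclidean :: 'g::{topological_group_add, t2_space} topology)"
begin

lemma compact_nhd_0:
  obtains W :: "'g set" and V where "compact W" "open V" "0 \<in> V" "V \<subseteq> W"
  using locally_compact_nhd_compact[OF lc, of "{0}"] by (metis compact_sing insert_subset)

text \<open>For \<open>t\<close> in a compact neighbourhood \<open>W\<close> of 0 and
  \<open>x\<close> outside \<open>- W + K\<close> both values of \<open>f\<close> vanish; on that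
  compact set joint continuity is uniform in \<open>x\<close>.\<close>

lemma Cc_subset_LUC: "(Cc :: ('g \<Rightarrow> complex) set) \<subseteq> LUC_group"
proof
  fix f :: "'g \<Rightarrow> complex" assume f: "f \<in> Cc"
  obtain K where K: "compact K" "\<And>x. x \<notin> K \<Longrightarrow> f x = 0" "continuous_on UNIV f" using f by (auto simp: Cc_def)
  obtain W :: "'g set" and V where W: "compact W" "open V" "0 \<in> V" "V \<subseteq> W" using compact_nhd_0 by blast
  have "f \<in> mspace (Cb euclidean)"
    using Cc_bounded[OF f] K(3) unfolding Cb_iff by (auto intro: continuous_on_subset)
  moreover have "\<forall>\<^sub>F t in nhds 0. \<forall>x. cmod (f (t + x) - f x) \<le> e" if e: "0 < e" for e
  proof -
    let ?C = "uminus ` W + K"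
    have C: "compact ?C" by (intro compact_set_plus compact_uminus W K)
    have cont: "continuous_on (UNIV \<times> ?C) (\<lambda>p. f (fst p + snd p))"
      by (intro continuous_on_compose2[OF K(3)] continuous_intros) auto
    obtain X0 where X0: "0 \<in> X0" "open X0"
        "\<And>t x. t \<in> X0 \<Longrightarrow> x \<in> ?C \<Longrightarrow> cmod (f (t + x) - f x) \<le> e"
    proof (rule continuous_on_prod_compactE[OF cont C UNIV_I e])
      fix X0 :: "'g set"
      assume "0 \<in> X0" "open X0"
        "\<forall>t\<in>X0 \<inter> UNIV. \<forall>x\<in>?C. dist (f (fst (t, x) + snd (t, x))) (f (fst (0, x) + snd (0, x))) \<le> e"
      then show thesis by (intro that[of X0]) (auto simp: dist_norm)
    qed
    have "cmod (f (t + x) - f x) \<le> e" if t: "t \<in> X0 \<inter> V" for t x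
    proof (cases "x \<in> ?C")
      case True
      with X0(3) t show ?thesis by blast
    next
      case False
      have "t + x \<notin> K"
      proof
        assume "t + x \<in> K"
        moreover have "x = (- t) + (t + x)" by (simp add: add.assoc[symmetric])
        ultimately show False using False t W(4) by (metis Int_iff imageI set_plus_intro subsetD)
      qed
      moreover have "x \<notin> K"
      proof
        assume "x \<in> K"
        moreover have "x = (- 0) + x" by simp
        ultimately show False using False W(3,4) by (metis imageI set_plus_intro subsetD)
      qed
      ultimately show ?thesis using K(2) e by simp
    qed
    then show ?thesis unfolding eventually_nhds
      using X0 W by (intro exI[of _ "X0 \<inter> V"]) auto
  qed
  ultimately show "f \<in> LUC_group" by (simp add: LUC_iff[OF G_space_self[OF lc]] del: mspace_cfunspace)
qed

text \<open>The cut-off functions \<open>h A\<close> are suprema of right translates of one compactly supported function,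
  hence have a common modulus of left uniform continuity.\<close>

lemma equi_LUC_cutoffs:
  obtains h :: "'g set \<Rightarrow> 'g \<Rightarrow> real" and W where "compact W" "0 \<in> W"
    "\<And>A s. 0 \<le> h A s" "\<And>A s. h A s \<le> 1" "\<And>A s. s \<in> A \<Longrightarrow> h A s = 1" "\<And>A s. s \<notin> W + A \<Longrightarrow> h A s = 0"
    "\<And>e. 0 < e \<Longrightarrow> \<forall>\<^sub>F t in nhds 0. \<forall>A s. \<bar>h A (t + s) - h A s\<bar> \<le> e"
proof -
  obtain p :: "'g \<Rightarrow> real" and W where p: "continuous_on UNIV p" "\<And>x. 0 \<le> p x" "\<And>x. p x \<le> 1"
    "p 0 = 1" "compact W" "\<And>x. x \<notin> W \<Longrightarrow> p x = 0"
    using Urysohn_compact[OF lc, of "{0}" UNIV] by auto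
  have "(\<lambda>x. of_real (p x)) \<in> (Cc :: ('g \<Rightarrow> complex) set)"
    by (rule CcI[OF _ p(5)]) (auto intro!: continuous_intros p(1) simp: p(6))
  then have pL: "(\<lambda>x. of_real (p x) :: complex) \<in> LUC_group" using Cc_subset_LUC by blast
  \<comment> \<open>A real supremum over the empty set is unspecified; the value 0 keeps every bound
    valid for \<open>A = {}\<close>.\<close>
  define h where "h A s = (if A = {} then 0 else SUP a\<in>A. p (s - a))" for A s
  have bdd: "bdd_above ((\<lambda>a. p (s - a)) ` A)" for A s by (rule bdd_aboveI2) (rule p(3))
  have le: "p (s - a) \<le> h A s" if "a \<in> A" for a A s
    using that bdd by (auto simp: h_def intro: cSUP_upper)
  have ge: "h A s \<le> c" if "\<And>a. a \<in> A \<Longrightarrow> p (s - a) \<le> c" "0 \<le> c" for A s c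
    using that by (auto simp: h_def intro: cSUP_least)
  have pos: "0 \<le> h A s" for A s
    using le[of _ A s] p(2) by (cases "A = {}") (auto simp: h_def intro: order_trans)
  have step: "h A r \<le> h A s + e" if "\<And>a. p (r - a) \<le> p (s - a) + e" "0 \<le> e" for A r s e
  proof (rule ge)
    show "p (r - a) \<le> h A s + e" if "a \<in> A" for a
      using \<open>p (r - a) \<le> p (s - a) + e\<close> le[OF that, of s] by linarith
  qed (use that(2) pos[of A s] in simp)
  show ?thesis
  proof (rule that[of W h])
    show "compact W" by (rule p(5))
    show "0 \<in> W" using p(4) p(6)[of 0] by auto
    show "0 \<le> h A s" for A s by (rule pos)
    show one: "h A s \<le> 1" for A s by (rule ge) (auto simp: p(3))
    show "h A s = 1" if "s \<in> A" for A s
      using le[OF that, of s] one[of A s] p(4) by simp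
    show "h A s = 0" if "s \<notin> W + A" for A s
    proof (rule antisym[OF ge pos])
      fix a assume "a \<in> A"
      then have "s - a \<notin> W" using that set_plus_intro[of "s - a" W a A] by auto
      then show "p (s - a) \<le> 0" using p(6) by simp
    qed simp
    fix e :: real assume e: "0 < e"
    show "\<forall>\<^sub>F t in nhds 0. \<forall>A s. \<bar>h A (t + s) - h A s\<bar> \<le> e"
      using LUC_small[OF G_space_self[OF lc] pL e]
    proof eventually_elim
      case (elim t)
      then have *: "\<bar>p (t + x) - p x\<bar> \<le> e" for x
        by (simp flip: of_real_diff)
      have d: "\<bar>p (t + s - a) - p (s - a)\<bar> \<le> e" for s a
        using *[of "s - a"] by (simp add: add_diff_eq)
      show ?case
      proof (intro allI)
        fix A s
        have "p (t + s - a) \<le> p (s - a) + e" "p (s - a) \<le> p (t + s - a) + e" for a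
          using d[of s a] by auto
        then have "h A (t + s) \<le> h A s + e" "h A s \<le> h A (t + s) + e"
          using e by (auto intro: step)
        then show "\<bar>h A (t + s) - h A s\<bar> \<le> e" by simp
      qed
    qed
  qed
qed

end

section \<open>Scattered translates and generalized limits\<close>

text \<open>A subset with \<open>Suc n\<close> elements arises by inserting a point into one with
  \<open>n\<close> elements, so by \<open>|A| * |A| = |A|\<close> each level has at most
  \<open>|A|\<close> members, and there are countably many levels.\<close>

lemma card_of_Fpow_infinite:
  includes cardinal_syntax
  assumes "infinite A"
  shows "|Fpow A| \<le>o |A|"
proof -
  define F where "F n = {B. B \<subseteq> A \<and> finite B \<and> card B = n}" for n
  have F: "|F n| \<le>o |A|" for n
  proof (induction n)
    case 0
    have "F 0 = {{}}" by (auto simp: F_def)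
    then show ?case using assms by (metis card_of_singl_ordLeq finite.emptyI)
  next
    case (Suc n)
    have "F (Suc n) \<subseteq> (\<lambda>(a, B). insert a B) ` (A \<times> F n)"
    proof
      fix B assume "B \<in> F (Suc n)"
      then have "card B = Suc n" "B \<subseteq> A" by (auto simp: F_def)
      then obtain a C where "B = insert a C" "a \<notin> C" "card C = n" "finite C" "B \<subseteq> A"
        by (auto simp: card_Suc_eq_finite)
      then show "B \<in> (\<lambda>(a, B). insert a B) ` (A \<times> F n)"
        by (auto simp: F_def image_def)
    qed
    then have "|F (Suc n)| \<le>o |(\<lambda>(a, B). insert a B) ` (A \<times> F n)|" by (rule card_of_mono1)
    also have "|(\<lambda>(a, B). insert a B) ` (A \<times> F n)| \<le>o |A \<times> F n|" by (rule card_of_image)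
    also have "|A \<times> F n| \<le>o |A|"
      using card_of_Times_ordLeq_infinite_Field[of "|A|" A "F n"] assms Suc
      by (simp add: Field_card_of card_of_card_order_on card_of_refl ordIso_imp_ordLeq)
    finally show ?case .
  qed
  have "Fpow A = (\<Union>n. F n)" by (auto simp: Fpow_def F_def)
  moreover have "|\<Union>n. F n| \<le>o |A|"
    using assms F infinite_iff_card_of_nat[of A] by (intro card_of_UNION_ordLeq_infinite) auto
  ultimately show ?thesis by simp
qed

context
  includes cardinal_syntax
  assumes lc: "locally_compact_space (euclidean :: 'g::{topological_group_add, t2_space} topology)"
    and nc: "\<not> compact (UNIV :: 'g set)"
begin

text \<open>Covers by interiors are wanted for extracting finite subcovers, whereas the compact sets
  avoided later may have empty interior. Adding a compact neighbourhood \<open>W\<close> of 0 turns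
  any compact cover into one by interiors without increasing its cardinality.\<close>

lemma minimal_compact_cover:
  obtains KK :: "'g set set" where "\<And>K. K \<in> KK \<Longrightarrow> compact K" "(\<Union>K\<in>KK. interior K) = UNIV" "infinite KK"
    "\<And>F. (\<And>K. K \<in> F \<Longrightarrow> compact K) \<Longrightarrow> |F| <o |KK| \<Longrightarrow> \<Union>F \<noteq> (UNIV :: 'g set)"
proof -
  obtain W :: "'g set" and V where W: "compact W" "open V" "0 \<in> V" "V \<subseteq> W"
    using compact_nhd_0[OF lc] by blast
  define S :: "'g set set set" where "S = {F. (\<forall>K\<in>F. compact K) \<and> (\<Union>K\<in>F. interior K) = UNIV}"
  have thick: "x \<in> interior (W + K)" if "x \<in> K" for x and K :: "'g set"
  proof -
    have "open ((\<lambda>t. t - x) -` V)"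
      using W(2) by (intro open_vimage continuous_on_diff continuous_on_id continuous_on_const)
    moreover have "(\<lambda>t. t - x) -` V \<subseteq> W + K"
    proof
      fix t assume "t \<in> (\<lambda>t. t - x) -` V"
      then have "(t - x) + x \<in> W + K" using W(4) that by (intro set_plus_intro) auto
      then show "t \<in> W + K" by simp
    qed
    ultimately show ?thesis using W(3) by (intro interiorI) auto
  qed
  have thick_S: "(\<lambda>K. W + K) ` F \<in> S" if "\<And>K. K \<in> F \<Longrightarrow> compact K" "\<Union>F = UNIV" for F
  proof -
    note cov = that(2)
    have "x \<in> (\<Union>K\<in>F. interior (W + K))" for x
    proof -
      have "x \<in> \<Union>F" by (simp add: cov)
      then obtain K where "K \<in> F" "x \<in> K" by blast
      with thick[of x K] show ?thesis by (intro UN_I[of K])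
    qed
    then show ?thesis using that(1) compact_set_plus[OF W(1)] by (auto simp: S_def)
  qed
  \<comment> \<open>Singletons show that the class \<open>S\<close>, over which the cardinality is
    minimized, is nonempty.\<close>
  have "\<Union>{{x} | x :: 'g. True} = UNIV" by auto
  then have "(\<lambda>K. W + K) ` {{x} | x. True} \<in> S" by (intro thick_S) auto
  then have "card_of ` S \<noteq> {}" by blast
  moreover have "\<forall>r\<in>card_of ` S. Well_order r" by (auto simp: card_of_Well_order)
  ultimately obtain KK where KK: "KK \<in> S" "\<And>F. F \<in> S \<Longrightarrow> |KK| \<le>o |F|"
    using exists_minim_Well_order[of "card_of ` S"] by auto
  show ?thesis
  proof (rule that[of KK])
    show comp: "compact K" if "K \<in> KK" for K using KK(1) that by (auto simp: S_def)
    show cov: "(\<Union>K\<in>KK. interior K) = UNIV" using KK(1) by (auto simp: S_def)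
    show "infinite KK"
    proof
      assume "finite KK"
      then have "compact (\<Union>KK)" by (intro compact_Union comp)
      moreover have "\<Union>KK = UNIV" using cov interior_subset by blast
      ultimately show False using nc by simp
    qed
    fix F :: "'g set set" assume F: "\<And>K. K \<in> F \<Longrightarrow> compact K" "|F| <o |KK|"
    show "\<Union>F \<noteq> UNIV"
    proof
      assume "\<Union>F = UNIV"
      then have "|KK| \<le>o |(\<lambda>K. W + K) ` F|" by (intro KK(2) thick_S F(1))
      then have "|KK| \<le>o |F|" using card_of_image ordLeq_transitive by blast
      with F(2) show False using not_ordLess_ordLeq by blast
    qed
  qed
qed

text \<open>Transfinite recursion along the initial well-order of the index set: each step has to avoid
  fewer compact sets than are needed to cover the group.\<close>

lemma disjoint_translates:
  fixes Q R :: "'i \<Rightarrow> 'g set"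
  assumes inf: "infinite KK" and min: "\<And>F. (\<And>K. K \<in> F \<Longrightarrow> compact K) \<Longrightarrow> |F| <o |KK| \<Longrightarrow> \<Union>F \<noteq> (UNIV :: 'g set)"
    and I: "|I| \<le>o |KK :: 'g set set|"
    and Q: "\<And>i. i \<in> I \<Longrightarrow> compact (Q i)" and R: "\<And>i. i \<in> I \<Longrightarrow> compact (R i)"
  obtains x where "\<And>i. i \<in> I \<Longrightarrow> x i \<notin> R i"
    "\<And>i j a b. i \<in> I \<Longrightarrow> j \<in> I \<Longrightarrow> i \<noteq> j \<Longrightarrow> a \<in> Q i \<Longrightarrow> b \<in> Q j \<Longrightarrow> a + x i \<noteq> b + x j"
proof -
  define r where "r = |I|"
  have r: "Card_order r" "Field r = I" "Well_order r"
    by (simp_all add: r_def Field_card_of card_of_card_order_on card_of_well_order_on)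
  then have wo: "wo_rel r" by (simp add: wo_rel_def)
  \<comment> \<open>\<open>a + v = b + f j\<close> with \<open>a\<close> in \<open>Q i\<close> and
    \<open>b\<close> in \<open>Q j\<close> places \<open>v\<close> in
    \<open>- Q i + Q j + f j\<close>, a compact set to be avoided.\<close>
  define P where "P f i v \<longleftrightarrow> (i \<in> I \<longrightarrow> v \<notin> R i \<and> (\<forall>j. (j, i) \<in> r - Id \<longrightarrow> v \<notin> uminus ` Q i + (Q j + {f j})))"
    for f :: "'i \<Rightarrow> 'g" and i v
  have "\<exists>f. \<forall>i. P f i (f i)"
  proof (rule dependent_wf_choice)
    show "wf (r - Id)" using r by (simp add: well_order_on_def)
    show "P f i v = P g i v" if "\<And>z. (z, i) \<in> r - Id \<Longrightarrow> f z = g z" for f g i v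
      using that by (simp add: P_def)
    fix i and f :: "'i \<Rightarrow> 'g"
    show "\<exists>v. P f i v"
    proof (cases "i \<in> I")
      case True
      define F where "F = {R i} \<union> (\<lambda>j. uminus ` Q i + (Q j + {f j})) ` underS r i"
      have sub: "underS r i \<subseteq> I" using r(2) by (auto simp: underS_def Field_def)
      \<comment> \<open>A proper initial segment of a cardinal order is strictly smaller than the
        whole; an arbitrary well-order of \<open>I\<close> would not give this.\<close>
      have "|underS r i| <o r" using r True by (intro card_of_underS) auto
      then have "|underS r i| <o |KK|" using I ordLess_ordLeq_trans unfolding r_def by blast
      then have "|(\<lambda>j. uminus ` Q i + (Q j + {f j})) ` underS r i| <o |KK|"
        using card_of_image ordLeq_ordLess_trans by blast
      moreover have "|{R i}| <o |KK|" using inf by (intro finite_ordLess_infinite) (auto simp: card_of_well_order_on Field_card_of)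
      ultimately have "|F| <o |KK|" unfolding F_def by (intro card_of_Un_ordLess_infinite inf)
      moreover have "compact K" if "K \<in> F" for K
        using that sub Q R True unfolding F_def
        by (auto intro!: compact_set_plus compact_uminus)
      ultimately have "\<Union>F \<noteq> UNIV" using min by blast
      then obtain v where "v \<notin> \<Union>F" by blast
      then have "P f i v" by (auto simp: P_def F_def underS_def)
      then show ?thesis by blast
    qed (simp add: P_def)
  qed
  then obtain x where x: "\<And>i. P x i (x i)" by blast
  have less: "a + x i \<noteq> b + x j" if "i \<in> I" "(j, i) \<in> r - Id" "a \<in> Q i" "b \<in> Q j" for i j a b
  proof
    assume "a + x i = b + x j"
    then have "x i = - a + (b + x j)" by (metis add.assoc add.left_neutral left_minus)
    also have "\<dots> \<in> uminus ` Q i + (Q j + {x j})" using that by (intro set_plus_intro) auto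
    finally show False using x[of i] that by (auto simp: P_def)
  qed
  show ?thesis
  proof (rule that[of x])
    show "x i \<notin> R i" if "i \<in> I" for i using x[of i] that by (simp add: P_def)
    fix i j a b assume *: "i \<in> I" "j \<in> I" "i \<noteq> j" "a \<in> Q i" "b \<in> Q j"
    then have "(i, j) \<in> r \<or> (j, i) \<in> r" using wo_rel.TOTALS[OF wo] r(2) by auto
    with * show "a + x i \<noteq> b + x j" using less[of i j a b] less[of j i b a] by fastforce
  qed
qed

end

text \<open>By Tychonoff's theorem the functionals \<open>D i\<close> have a cluster point along \<open>F\<close>.\<close>

lemma generalized_limit:
  fixes D :: "'i \<Rightarrow> ('x \<Rightarrow> complex) \<Rightarrow> complex"
  assumes F: "F \<noteq> bot" and V: "V \<subseteq> mspace (Cb X)"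
    "\<And>a b f g. f \<in> V \<Longrightarrow> g \<in> V \<Longrightarrow> (\<lambda>x\<in>topspace X. a * f x + b * g x) \<in> V"
    and D: "\<And>i. D i \<in> cdual X V"
      "\<And>i f B. f \<in> V \<Longrightarrow> 0 \<le> B \<Longrightarrow> (\<And>x. x \<in> topspace X \<Longrightarrow> cmod (f x) \<le> B) \<Longrightarrow> cmod (D i f) \<le> B"
  obtains n where "n \<in> cdual X V"
      "\<And>f B. f \<in> V \<Longrightarrow> 0 \<le> B \<Longrightarrow> (\<And>x. x \<in> topspace X \<Longrightarrow> cmod (f x) \<le> B) \<Longrightarrow> cmod (n f) \<le> B"
      "\<And>f c. f \<in> V \<Longrightarrow> (\<forall>\<^sub>F i in F. D i f = c) \<Longrightarrow> n f = c"
proof -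
  \<comment> \<open>The singleton off \<open>V\<close> makes every member of the product
    extensional, while each factor remains compact.\<close>
  define S where "S f = (if f \<in> V then cball 0 (sup_norm X f) else {undefined} :: complex set)" for f :: "'x \<Rightarrow> complex"
  define K where "K = PiE UNIV S"
  have "compact K"
  proof -
    have "compactin (product_topology (\<lambda>_. euclidean) UNIV) K"
    proof -
      have "compact (S f)" for f by (simp add: S_def compact_cball)
      then show ?thesis unfolding K_def compactin_PiE by simp
    qed
    then show ?thesis by (simp add: euclidean_product_topology)
  qed
  moreover have DK: "D i \<in> K" for i
  proof -
    have "cmod (D i f) \<le> sup_norm X f" if "f \<in> V" for f
      using that V(1) by (intro D(2) sup_norm_nonneg le_sup_norm) auto
    then show ?thesis
      using cdual_extensional[OF D(1)[of i]] by (auto simp: K_def S_def extensional_def)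
  qed
  then have "\<forall>\<^sub>F m in filtermap D F. m \<in> K"
    by (simp add: eventually_filtermap)
  moreover have "filtermap D F \<noteq> bot" using F by (simp add: filtermap_bot_iff)
  ultimately obtain n where n: "n \<in> K" "inf (nhds n) (filtermap D F) \<noteq> bot"
    unfolding compact_filter le_principal by blast
  \<comment> \<open>A cluster point stays in every closed set that eventually contains the
    \<open>D i\<close>; linearity and prescribed values are closed conditions, each involving
    finitely many coordinates.\<close>
  have closed: "n \<in> C" if "closed C" "\<forall>\<^sub>F i in F. D i \<in> C" for C
  proof (rule ccontr)
    assume "n \<notin> C"
    then have "eventually (\<lambda>f. f \<in> - C) (nhds n)"
      using that(1) by (auto simp: eventually_nhds intro!: exI[of _ "- C"])
    moreover have "eventually (\<lambda>f. f \<in> C) (filtermap D F)" using that(2) by (simp add: eventually_filtermap)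
    ultimately have "eventually (\<lambda>f. False) (inf (nhds n) (filtermap D F))"
      unfolding eventually_inf by blast
    with n(2) show False by (simp add: trivial_limit_def)
  qed
  have nS: "n f \<in> S f" for f using n(1) by (simp add: K_def PiE_iff)
  have bound: "cmod (n f) \<le> B" if "f \<in> V" "0 \<le> B" "\<And>x. x \<in> topspace X \<Longrightarrow> cmod (f x) \<le> B" for f B
  proof -
    have "cmod (n f) \<le> sup_norm X f" using nS[of f] that(1) by (simp add: S_def)
    also have "\<dots> \<le> B" using that by (intro sup_norm_le)
    finally show ?thesis .
  qed
  show ?thesis
  proof (rule that[of n])
    show "n \<in> cdual X V"
    proof (rule cdualI[OF _ _ V(1), where C = 1])
      show "n \<in> extensional V"
        unfolding extensional_def
      proof (intro CollectI allI impI)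
        show "n f = undefined" if "f \<notin> V" for f using nS[of f] that by (simp add: S_def)
      qed
      fix a b f g assume fg: "f \<in> V" "g \<in> V"
      have "n \<in> {m. m (\<lambda>x\<in>topspace X. a * f x + b * g x) = a * m f + b * m g}"
        using cdual_lin[OF D(1) fg]
        by (intro closed closed_Collect_eq continuous_intros) auto
      then show "n (\<lambda>x\<in>topspace X. a * f x + b * g x) = a * n f + b * n g" by simp
    qed (use bound in simp)
    show "n f = c" if "f \<in> V" "\<forall>\<^sub>F i in F. D i f = c" for f c
    proof -
      have "n \<in> {m. m f = c}"
        using that by (intro closed closed_Collect_eq continuous_intros) auto
      then show ?thesis by simp
    qed
  qed (rule bound)
qed

section \<open>The factorization lemma\<close>

context
  assumes lc: "locally_compact_space (euclidean :: 'g::{topological_group_add, t2_space} topology)"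
begin

lemma LUC_group_continuous: "f \<in> (LUC_group :: ('g \<Rightarrow> complex) set) \<Longrightarrow> continuous_on UNIV f"
  using LUC_Cb[of f euclidean "(+)"] by simp

lemma LUC_group_lincomb:
  "f \<in> (LUC_group :: ('g \<Rightarrow> complex) set) \<Longrightarrow> g \<in> LUC_group \<Longrightarrow> (\<lambda>s. a * f s + b * g s) \<in> LUC_group"
  using LUC_lincomb[OF G_space_self[OF lc], of f g a b] by (simp add: restrict_UNIV)

lemma evaluation_cdual:
  fixes s :: 'g
  shows "(\<lambda>f\<in>LUC_group. f s) \<in> cdual euclidean LUC_group"
proof (rule cdualI[where C = 1])
  show "LUC_group \<subseteq> mspace (Cb (euclidean :: 'g topology))" using LUC_Cb by blast
qed (auto simp: LUC_group_lincomb restrict_UNIV)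

lemma LUC_group_generalized_limit:
  fixes D :: "'i \<Rightarrow> ('g \<Rightarrow> complex) \<Rightarrow> complex"
  assumes F: "F \<noteq> bot" and D: "\<And>i. D i \<in> cdual euclidean LUC_group"
      "\<And>i f B. f \<in> LUC_group \<Longrightarrow> 0 \<le> B \<Longrightarrow> (\<And>x. cmod (f x) \<le> B) \<Longrightarrow> cmod (D i f) \<le> B"
  obtains n where "n \<in> cdual euclidean LUC_group"
      "\<And>f B. f \<in> LUC_group \<Longrightarrow> 0 \<le> B \<Longrightarrow> (\<And>x. cmod (f x) \<le> B) \<Longrightarrow> cmod (n f) \<le> B"
      "\<And>f c. f \<in> LUC_group \<Longrightarrow> (\<forall>\<^sub>F i in F. D i f = c) \<Longrightarrow> n f = c"
proof (rule generalized_limit[where F = F and D = D and V = "LUC_group :: ('g \<Rightarrow> complex) set"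
      and X = euclidean])
  show "LUC_group \<subseteq> mspace (Cb (euclidean :: 'g topology))" using LUC_Cb by blast
qed (use assms that LUC_group_lincomb in \<open>auto simp: restrict_UNIV\<close>)

text \<open>The function \<open>F\<close> carries a copy of each cut-off \<open>g * h A\<close> near infinitely many far away points
  \<open>x (A, B)\<close>. The functionals \<open>nA A\<close> pick these copies up one at a time, as \<open>B\<close> grows, which gives a
  compactly supported function; \<open>n\<close> is their limit in \<open>A\<close>.\<close>

lemma factorization_at_infinity:
  assumes nc: "\<not> compact (UNIV :: 'g set)" and g: "g \<in> (LUC_group :: ('g \<Rightarrow> complex) set)"
  obtains F n where "F \<in> LUC_group" "n \<in> cdual euclidean LUC_group" "\<And>f. f \<in> Cc \<Longrightarrow> n f = 0"
    "fun_act euclidean (+) n F = g"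
    "\<And>F'. F' \<in> LUC_group \<Longrightarrow> (\<And>n0. n0 \<in> cdual euclidean LUC_group \<Longrightarrow> fun_act euclidean (+) n0 F \<in> Cc \<Longrightarrow>
        n0 F' = 0) \<Longrightarrow> n F' = 0"
proof -
  note G = G_space_self[OF lc]
  obtain h :: "'g set \<Rightarrow> 'g \<Rightarrow> real" and W where W: "compact W" "0 \<in> W"
    and h: "\<And>A s. 0 \<le> h A s" "\<And>A s. h A s \<le> 1" "\<And>A s. s \<in> A \<Longrightarrow> h A s = 1" "\<And>A s. s \<notin> W + A \<Longrightarrow> h A s = 0"
      "\<And>e. 0 < e \<Longrightarrow> \<forall>\<^sub>F t in nhds 0. \<forall>A s. \<bar>h A (t + s) - h A s\<bar> \<le> e"
    by (rule equi_LUC_cutoffs[OF lc]) blast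
  obtain Y :: "'g set" and V where Y: "compact Y" "open V" "0 \<in> V" "V \<subseteq> Y"
    using compact_nhd_0[OF lc] by blast
  obtain KK :: "'g set set" where KK: "\<And>K. K \<in> KK \<Longrightarrow> compact K" "(\<Union>K\<in>KK. interior K) = UNIV" "infinite KK"
    and min: "\<And>F. (\<And>K. K \<in> F \<Longrightarrow> compact K) \<Longrightarrow> (card_of F, card_of KK) \<in> ordLess \<Longrightarrow> \<Union>F \<noteq> (UNIV :: 'g set)"
    by (rule minimal_compact_cover[OF lc nc]) blast
  have cov: "\<exists>K\<in>KK. s \<in> K" for s
  proof -
    have "s \<in> (\<Union>K\<in>KK. interior K)" using KK(2) by simp
    then show ?thesis using interior_subset by blast
  qed
  have compact_U: "compact (\<Union>A)" if "A \<in> Fpow KK" for A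
    using that KK(1) by (intro compact_Union) (auto simp: Fpow_def)
  obtain B where B: "0 \<le> B" "\<And>s. cmod (g s) \<le> B" using LUC_bound[OF g] by auto
  define I where "I = Fpow KK \<times> Fpow KK"
  define S where "S i = W + \<Union>(fst i)" for i :: "'g set set \<times> 'g set set"
  \<comment> \<open>The tile contains the support \<open>S i\<close> moved by any small
    \<open>t\<close> or \<open>- t\<close>, so that a small translation cannot reach another copy.
    It also contains the union of the second component, so that every fixed point lies in the tile
    once \<open>B\<close> is large.\<close>
  define Q where "Q i = ((Y \<union> uminus ` Y) + S i) \<union> \<Union>(snd i)" for i
  \<comment> \<open>Staying outside the union of \<open>B\<close> drives \<open>x (A, B)\<close> out
    of every compact set as \<open>B\<close> grows.\<close>
  define R where "R i = \<Union>(snd i)" for i :: "'g set set \<times> 'g set set"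
  have "(card_of I, card_of KK) \<in> ordLeq"
    unfolding I_def using KK(3) card_of_Fpow_infinite[OF KK(3)]
      card_of_Times_ordLeq_infinite_Field[of "card_of KK" "Fpow KK" "Fpow KK"]
    by (simp add: Field_card_of card_of_card_order_on)
  moreover have "compact (Q i)" "compact (R i)" if "i \<in> I" for i
    using that compact_U unfolding Q_def S_def R_def I_def
    by (auto intro!: compact_Un compact_set_plus compact_uminus W Y)
  ultimately obtain x where x: "\<And>i. i \<in> I \<Longrightarrow> x i \<notin> R i"
    "\<And>i j a b. i \<in> I \<Longrightarrow> j \<in> I \<Longrightarrow> i \<noteq> j \<Longrightarrow> a \<in> Q i \<Longrightarrow> b \<in> Q j \<Longrightarrow> a + x i \<noteq> b + x j"
    using disjoint_translates[OF lc nc KK(3) min, of I Q R] by blast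
  define u where "u i s = g s * of_real (h (\<Union>(fst i)) s)" for i :: "'g set set \<times> 'g set set" and s
  \<comment> \<open>The tiles \<open>Q i + x i\<close> are pairwise disjoint, so the choice of
    \<open>i\<close> is unique.\<close>
  define F where "F s = (if \<exists>i\<in>I. s - x i \<in> Q i then let i = SOME i. i \<in> I \<and> s - x i \<in> Q i in u i (s - x i) else 0)" for s
  have Fval: "F (q + x i) = u i q" if "i \<in> I" "q \<in> Q i" for i q
  proof -
    have "(SOME j. j \<in> I \<and> q + x i - x j \<in> Q j) = i"
    proof (rule some_equality)
      show "i \<in> I \<and> q + x i - x i \<in> Q i" using that by (simp add: add_diff_eq[symmetric])
      fix j assume "j \<in> I \<and> q + x i - x j \<in> Q j"
      then show "j = i" using x(2)[of j i "q + x i - x j" q] that by auto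
    qed
    moreover have "\<exists>j\<in>I. q + x i - x j \<in> Q j" using that by (intro bexI[of _ i]) (simp_all add: add_diff_eq[symmetric])
    ultimately show ?thesis by (simp add: F_def add_diff_eq[symmetric])
  qed
  have uS: "q \<in> S i" if "u i q \<noteq> 0" for i q
    using that h(4)[of q "\<Union>(fst i)"] by (auto simp: u_def S_def)
  have Fnz: "\<exists>i\<in>I. \<exists>q\<in>S i. s = q + x i" if "F s \<noteq> 0" for s
  proof -
    from that have "\<exists>i\<in>I. s - x i \<in> Q i" by (auto simp: F_def split: if_splits)
    then obtain i where i: "i \<in> I" "s - x i \<in> Q i" by blast
    then have "F s = u i (s - x i)" using Fval[OF i] by simp
    with that have "s - x i \<in> S i" using uS by simp
    with i show ?thesis by (intro bexI[of _ i] bexI[of _ "s - x i"]) auto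
  qed
  have ubound: "cmod (u i q) \<le> B" for i q
    using mult_mono[OF B(2)[of q] h(2), of "\<Union>(fst i)" q] h(1) B(1) by (simp add: u_def norm_mult)
  have F_LUC: "F \<in> LUC_group"
  proof (rule LUC_groupI[OF lc])
    show "cmod (F s) \<le> B" for s
      using ubound B(1) by (auto simp: F_def Let_def)
    fix e :: real assume e: "0 < e"
    define d where "d = e / (2 * (B + 1))"
    have d: "0 < d" "B * d \<le> e/2" using e B(1) by (auto simp: d_def field_simps)
    have "0 < e/2" using e by simp
    from LUC_small[OF G g this] h(5)[OF d(1)] eventually_nhds_in_open[OF Y(2,3)]
    show "\<forall>\<^sub>F t in nhds 0. \<forall>s. cmod (F (t + s) - F s) \<le> e"
    proof eventually_elim
      case (elim t)
      have u: "cmod (u i (t + q) - u i q) \<le> e" for i q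
      proof -
        let ?h = "h (\<Union>(fst i))"
        have "u i (t + q) - u i q = (g (t + q) - g q) * of_real (?h (t + q)) + g q * of_real (?h (t + q) - ?h q)"
          by (simp add: u_def algebra_simps)
        then have "cmod (u i (t + q) - u i q) \<le> cmod (g (t + q) - g q) * ?h (t + q) + cmod (g q) * \<bar>?h (t + q) - ?h q\<bar>"
          using norm_triangle_ineq h(1) by (metis abs_of_nonneg norm_mult norm_of_real)
        also have "\<dots> \<le> e/2 * 1 + B * d"
          using elim(1,2) e B h(1,2) by (intro add_mono mult_mono) auto
        finally show ?thesis using d(2) by simp
      qed
      have SQ: "q \<in> Q i" "t + q \<in> Q i" "- t + q \<in> Q i" if "q \<in> S i" for q i
      proof -
        have Yt: "t \<in> Y \<union> uminus ` Y" "- t \<in> Y \<union> uminus ` Y" "0 \<in> Y \<union> uminus ` Y" using elim(3) Y by auto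
        show "q \<in> Q i" using set_plus_intro[OF Yt(3) that] by (simp add: Q_def)
        show "t + q \<in> Q i" "- t + q \<in> Q i"
          using set_plus_intro[OF Yt(1) that] set_plus_intro[OF Yt(2) that] by (simp_all add: Q_def)
      qed
      show ?case
      proof
        fix s
        \<comment> \<open>If one of \<open>s\<close> and \<open>t + s\<close> lies in a translated
          support, the other lies in the same tile and both values come from the same
          \<open>u i\<close>; otherwise both values vanish.\<close>
        consider i q where "i \<in> I" "q \<in> S i" "s = q + x i"
          | i q where "i \<in> I" "q \<in> S i" "t + s = q + x i"
          | "F s = 0" "F (t + s) = 0"
          using Fnz[of s] Fnz[of "t + s"] by blast
        then show "cmod (F (t + s) - F s) \<le> e"
        proof cases
          case 1
          then show ?thesis using Fval[OF 1(1) SQ(1)[OF 1(2)]] Fval[OF 1(1) SQ(2)[OF 1(2)]] u[of i q]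
            by (simp add: add.assoc)
        next
          case 2
          have "s = (- t + q) + x i" using 2(3) by (metis add.assoc add.left_neutral left_minus)
          then have "F s = u i (- t + q)" using Fval[OF 2(1) SQ(3)[OF 2(2)]] by simp
          moreover have "F (t + s) = u i (t + (- t + q))"
            using Fval[OF 2(1) SQ(1)[OF 2(2)]] 2(3) by (simp add: add.assoc[symmetric])
          ultimately show ?thesis using u[of i "- t + q"] by simp
        next
          case 3
          then show ?thesis using e by simp
        qed
      qed
    qed
  qed
  define \<delta> where "\<delta> s = (\<lambda>f\<in>LUC_group. f s)" for s :: 'g
  let ?L = "finite_subsets_at_top KK"
  \<comment> \<open>The limit in \<open>B\<close>. The contraction bound belongs to the claim
    because the second limit, in \<open>A\<close>, needs it for its own compactness.\<close>
  have "\<exists>n. n \<in> cdual euclidean LUC_group \<and>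
      (\<forall>f B. f \<in> LUC_group \<longrightarrow> 0 \<le> B \<longrightarrow> (\<forall>x. cmod (f x) \<le> B) \<longrightarrow> cmod (n f) \<le> B) \<and>
      (\<forall>f c. f \<in> LUC_group \<longrightarrow> (\<forall>\<^sub>F B in ?L. \<delta> (x (A, B)) f = c) \<longrightarrow> n f = c)" for A
    by (rule LUC_group_generalized_limit[where F = ?L and D = "\<lambda>B. \<delta> (x (A, B))"])
      (auto simp: \<delta>_def evaluation_cdual)
  then obtain nA where nA: "\<And>A. nA A \<in> cdual euclidean LUC_group"
      "\<And>A f B. f \<in> LUC_group \<Longrightarrow> 0 \<le> B \<Longrightarrow> (\<And>x. cmod (f x) \<le> B) \<Longrightarrow> cmod (nA A f) \<le> B"
      "\<And>A f c. f \<in> LUC_group \<Longrightarrow> (\<forall>\<^sub>F B in ?L. \<delta> (x (A, B)) f = c) \<Longrightarrow> nA A f = c"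
    by metis
  obtain n where n: "n \<in> cdual euclidean LUC_group"
      "\<And>f c. f \<in> LUC_group \<Longrightarrow> (\<forall>\<^sub>F A in ?L. nA A f = c) \<Longrightarrow> n f = c"
    by (rule LUC_group_generalized_limit[where F = ?L and D = nA]) (use nA(1,2) in auto)
  have tr: "ltrans euclidean (+) s f \<in> LUC_group" if "f \<in> LUC_group" for s and f :: "'g \<Rightarrow> complex"
    by (rule LUC_ltrans[OF G that])
  have evFin: "\<forall>\<^sub>F A in ?L. A \<in> Fpow KK \<and> A0 \<subseteq> A" if "A0 \<in> Fpow KK" for A0
    unfolding eventually_finite_subsets_at_top using that by (intro exI[of _ A0]) (auto simp: Fpow_def)
  have evIn: "\<forall>\<^sub>F A in ?L. A \<in> Fpow KK \<and> s \<in> \<Union>A" for s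
  proof -
    obtain K where K: "K \<in> KK" "s \<in> K" using cov by blast
    have "\<forall>\<^sub>F A in ?L. A \<in> Fpow KK \<and> {K} \<subseteq> A" using K by (intro evFin) (auto simp: Fpow_def)
    then show ?thesis by eventually_elim (use K in auto)
  qed
  \<comment> \<open>\<open>u\<close> depends on its index only through the first component, so
    \<open>{}\<close> may stand for \<open>B\<close>, and the values are eventually constant in
    \<open>B\<close>.\<close>
  have nA_F: "nA A (ltrans euclidean (+) s F) = u (A, {}) s" if A: "A \<in> Fpow KK" for A s
  proof (rule nA(3)[OF tr[OF F_LUC]])
    show "\<forall>\<^sub>F B in ?L. \<delta> (x (A, B)) (ltrans euclidean (+) s F) = u (A, {}) s"
      using evIn[of s]
    proof eventually_elim
      case (elim B)
      then have "F (s + x (A, B)) = u (A, B) s" using A by (intro Fval) (auto simp: I_def Q_def)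
      then show ?case using tr[OF F_LUC, of s] by (simp add: \<delta>_def u_def)
    qed
  qed
  have u_Cc: "u (A, {}) \<in> Cc" if A: "A \<in> Fpow KK" for A
  proof -
    have "(\<lambda>s. of_real (h (\<Union>A) s) :: complex) \<in> LUC_group"
    proof (rule LUC_groupI[OF lc])
      show "cmod (of_real (h (\<Union>A) s)) \<le> 1" for s using h(1,2) by simp
      fix e :: real assume "0 < e"
      from h(5)[OF this] show "\<forall>\<^sub>F t in nhds 0. \<forall>s. cmod (of_real (h (\<Union>A) (t + s)) - of_real (h (\<Union>A) s)) \<le> e"
        by eventually_elim (simp flip: of_real_diff)
    qed
    then have "(\<lambda>s. of_real (h (\<Union>A) s) :: complex) \<in> Cc"
      using h(4) by (intro CcI[OF LUC_group_continuous compact_set_plus[OF W(1) compact_U[OF A]]]) auto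
    from Cc_mult[OF this LUC_group_continuous[OF g]] show ?thesis by (simp add: u_def[abs_def])
  qed
  show ?thesis
  proof (rule that[of F n])
    show "F \<in> LUC_group" "n \<in> cdual euclidean LUC_group" by fact+
  next
    fix f :: "'g \<Rightarrow> complex" assume f: "f \<in> Cc"
    then have fL: "f \<in> LUC_group" using Cc_subset_LUC[OF lc] by blast
    obtain C where C: "compact C" "\<And>s. s \<notin> C \<Longrightarrow> f s = 0" using f by (auto simp: Cc_def)
    \<comment> \<open>Once \<open>B\<close> contains \<open>B0\<close>, the point
      \<open>x (A, B)\<close> lies outside \<open>C\<close> and evaluation there kills
      \<open>f\<close>.\<close>
    obtain B0 where B0: "B0 \<subseteq> KK" "finite B0" "C \<subseteq> (\<Union>K\<in>B0. interior K)"
    proof (rule compactE_image[OF C(1), of KK interior])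
      show "C \<subseteq> (\<Union>K\<in>KK. interior K)" using KK(2) by simp
    qed auto
    then have CB0: "C \<subseteq> \<Union>B0" "B0 \<in> Fpow KK"
      using B0 by (auto simp: Fpow_def dest!: subsetD dest: subsetD[OF interior_subset])
    have "nA A f = 0" if A: "A \<in> Fpow KK" for A
    proof (rule nA(3)[OF fL])
      show "\<forall>\<^sub>F B in ?L. \<delta> (x (A, B)) f = 0"
        using evFin[OF CB0(2)]
      proof eventually_elim
        case (elim B)
        then have "x (A, B) \<notin> C" using x(1)[of "(A, B)"] A CB0 by (auto simp: R_def I_def)
        then show ?case using C(2) fL by (simp add: \<delta>_def)
      qed
    qed
    then show "n f = 0"
      using evFin[of "{}"] by (intro n(2)[OF fL]) (auto simp: Fpow_def elim: eventually_mono)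
  next
    show "fun_act euclidean (+) n F = g"
    proof
      fix s
      have "\<forall>\<^sub>F A in ?L. nA A (ltrans euclidean (+) s F) = g s"
        using evIn[of s] by eventually_elim (simp add: nA_F u_def h(3))
      then show "fun_act euclidean (+) n F s = g s"
        unfolding fun_act_def by (rule n(2)[OF tr[OF F_LUC]])
    qed
  next
    fix F' :: "'g \<Rightarrow> complex"
    assume F': "F' \<in> LUC_group" and kill: "\<And>n0. n0 \<in> cdual euclidean LUC_group \<Longrightarrow>
      fun_act euclidean (+) n0 F \<in> Cc \<Longrightarrow> n0 F' = 0"
    have "nA A F' = 0" if A: "A \<in> Fpow KK" for A
    proof -
      have "fun_act euclidean (+) (nA A) F = u (A, {})"
        using nA_F[OF A] by (simp add: fun_act_def)
      then show ?thesis using u_Cc[OF A] by (intro kill nA) simp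
    qed
    then show "n F' = 0"
      using evFin[of "{}"] by (intro n(2)[OF F']) (auto simp: Fpow_def elim: eventually_mono)
  qed
qed

end

section \<open>Signed and complex measures\<close>

definition signed_borel :: "('a::topological_space set \<Rightarrow> real) \<Rightarrow> bool"
  where "signed_borel \<nu> \<longleftrightarrow> (\<forall>A :: nat \<Rightarrow> 'a set. range A \<subseteq> sets borel \<longrightarrow> disjoint_family A \<longrightarrow>
      (\<lambda>n. \<nu> (A n)) sums \<nu> (\<Union>n. A n))"

lemma signed_borel_sums:
  "signed_borel \<nu> \<Longrightarrow> (\<And>n. A n \<in> sets borel) \<Longrightarrow> disjoint_family A \<Longrightarrow>
    (\<lambda>n::nat. \<nu> (A n)) sums \<nu> (\<Union>n. A n)"
  by (auto simp: signed_borel_def)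

lemma signed_borel_minus: "signed_borel \<nu> \<Longrightarrow> signed_borel (\<lambda>A. - \<nu> A)"
  by (auto simp: signed_borel_def intro: sums_minus)

lemma complex_borel_iff:
  "complex_borel_measure \<mu> \<longleftrightarrow> signed_borel (\<lambda>A. Re (\<mu> A)) \<and> signed_borel (\<lambda>A. Im (\<mu> A))"
  by (auto simp: complex_borel_measure_def signed_borel_def sums_complex_iff)

section \<open>Jordan decomposition of a signed Borel measure\<close>

context
  fixes \<nu> :: "'a::topological_space set \<Rightarrow> real"
  assumes \<nu>: "signed_borel \<nu>"
begin

lemma signed_empty: "\<nu> {} = 0"
proof -
  have "(\<lambda>n::nat. \<nu> {}) sums \<nu> (\<Union>n::nat. {})"
    by (rule signed_borel_sums[OF \<nu>]) (auto simp: disjoint_family_on_def)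
  then have "(\<lambda>n::nat. \<nu> {}) \<longlonglongrightarrow> 0" by (intro summable_LIMSEQ_zero) (rule sums_summable)
  then show ?thesis by (simp add: LIMSEQ_const_iff)
qed

lemma signed_Un:
  assumes "A \<in> sets borel" "B \<in> sets borel" "A \<inter> B = {}"
  shows "\<nu> (A \<union> B) = \<nu> A + \<nu> B"
proof -
  have "(\<lambda>n. \<nu> (binaryset A B n)) sums \<nu> (\<Union>n. binaryset A B n)"
    using assms by (intro signed_borel_sums[OF \<nu>])
      (auto simp: binaryset_def disjoint_family_on_def)
  then show ?thesis
    using binaryset_sums[of \<nu> A B] signed_empty by (simp add: UN_binaryset_eq sums_unique2)
qed

lemma signed_split:
  assumes "A \<in> sets borel" "E \<in> sets borel" "A \<subseteq> E"
  shows "\<nu> E = \<nu> A + \<nu> (E - A)"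
  using signed_Un[of A "E - A"] assms by (simp add: Un_absorb1)

text \<open>If \<open>\<nu>\<close> were unbounded, one could split off pieces of absolute value at least one forever,
  keeping a remainder on which \<open>\<nu>\<close> is unbounded.\<close>

lemma signed_bounded: "\<exists>C. \<forall>A\<in>sets borel. \<bar>\<nu> A\<bar> \<le> C"
proof (rule ccontr)
  define bad where "bad E \<longleftrightarrow> E \<in> sets borel \<and> (\<forall>C. \<exists>A\<in>sets borel. A \<subseteq> E \<and> C < \<bar>\<nu> A\<bar>)" for E
  assume "\<not> ?thesis"
  then have bad0: "bad UNIV" unfolding bad_def by (auto simp: not_le)
  have step: "\<exists>F. bad F \<and> F \<subseteq> E \<and> 1 \<le> \<bar>\<nu> (E - F)\<bar>" if E: "bad E" for E
  proof -
    obtain A where A: "A \<in> sets borel" "A \<subseteq> E" "\<bar>\<nu> E\<bar> + 1 < \<bar>\<nu> A\<bar>"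
      using E unfolding bad_def by blast
    have Eb: "E \<in> sets borel" using E by (simp add: bad_def)
    have split: "\<nu> E = \<nu> A + \<nu> (E - A)" by (rule signed_split[OF A(1) Eb A(2)])
    show ?thesis
    proof (cases "bad A")
      case True
      then show ?thesis using A split by (intro exI[of _ A]) auto
    next
      case False
      then obtain C where C: "\<And>B. B \<in> sets borel \<Longrightarrow> B \<subseteq> A \<Longrightarrow> \<bar>\<nu> B\<bar> \<le> C"
        using A(1) unfolding bad_def by (auto simp: not_less)
      have "bad (E - A)"
        unfolding bad_def
      proof (intro conjI allI)
        show "E - A \<in> sets borel" using A Eb by auto
        fix D
        obtain B where B: "B \<in> sets borel" "B \<subseteq> E" "D + C < \<bar>\<nu> B\<bar>"
          using E unfolding bad_def by blast
        have "\<nu> B = \<nu> (B \<inter> A) + \<nu> (B - B \<inter> A)" using A B by (intro signed_split) auto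
        moreover have "\<bar>\<nu> (B \<inter> A)\<bar> \<le> C" using A B by (intro C) auto
        ultimately have "D < \<bar>\<nu> (B - B \<inter> A)\<bar>" using B(3) by linarith
        then show "\<exists>B\<in>sets borel. B \<subseteq> E - A \<and> D < \<bar>\<nu> B\<bar>"
          using A B by (intro bexI[of _ "B - B \<inter> A"]) auto
      qed
      moreover have "E - (E - A) = A" using A by auto
      ultimately show ?thesis using A by (intro exI[of _ "E - A"]) auto
    qed
  qed
  have "\<exists>E. \<forall>n. bad (E n) \<and> (E (Suc n) \<subseteq> E n \<and> 1 \<le> \<bar>\<nu> (E n - E (Suc n))\<bar>)"
    by (rule dependent_nat_choice) (use bad0 step in blast)+
  then obtain E where E: "\<And>n. bad (E n)" "\<And>n. E (Suc n) \<subseteq> E n" "\<And>n. 1 \<le> \<bar>\<nu> (E n - E (Suc n))\<bar>"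
    by blast
  have mono: "E n \<subseteq> E m" if "m \<le> n" for m n
    using that by (rule lift_Suc_antimono_le[of E, OF E(2)])
  have "(E m - E (Suc m)) \<inter> (E n - E (Suc n)) = {}" if "m < n" for m n
    using mono[of "Suc m" n] that by auto
  then have "disjoint_family (\<lambda>n. E n - E (Suc n))"
    unfolding disjoint_family_on_def by (metis Int_commute nat_neq_iff)
  then have "(\<lambda>n. \<nu> (E n - E (Suc n))) sums \<nu> (\<Union>n. E n - E (Suc n))"
    using E(1) by (intro signed_borel_sums[OF \<nu>]) (auto simp: bad_def)
  then have "(\<lambda>n. \<nu> (E n - E (Suc n))) \<longlonglongrightarrow> 0" by (intro summable_LIMSEQ_zero) (rule sums_summable)
  from tendstoD[OF this, of 1]
  have "\<forall>\<^sub>F n in sequentially. \<bar>\<nu> (E n - E (Suc n))\<bar> < 1" by (simp add: dist_real_def)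
  then obtain n where "\<bar>\<nu> (E n - E (Suc n))\<bar> < 1"
    using eventually_happens'[OF sequentially_bot] by blast
  then show False using E(3)[of n] by simp
qed

text \<open>The set function underlying \<open>pos_part\<close>, isolated so that its additivity can
  be proved before it is known to define a measure.\<close>

definition pos_fun :: "'a set \<Rightarrow> ennreal"
  where "pos_fun E = (SUP A \<in> {A \<in> sets borel. A \<subseteq> E}. ennreal (\<nu> A))"

lemma pos_fun_upper: "A \<in> sets borel \<Longrightarrow> A \<subseteq> E \<Longrightarrow> ennreal (\<nu> A) \<le> pos_fun E"
  unfolding pos_fun_def by (rule SUP_upper) simp

lemma pos_fun_le: "(\<And>A. A \<in> sets borel \<Longrightarrow> A \<subseteq> E \<Longrightarrow> ennreal (\<nu> A) \<le> c) \<Longrightarrow> pos_fun E \<le> c"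
  unfolding pos_fun_def by (auto intro: SUP_least)

text \<open>Test sets inside \<open>E\<close> and \<open>F\<close> are disjoint and unite to one
  inside \<open>E \<union> F\<close>. If one value is negative, its truncation is 0 and the other
  test set alone gives the bound.\<close>

lemma pos_fun_superadditive:
  assumes "E \<in> sets borel" "F \<in> sets borel" "E \<inter> F = {}"
  shows "pos_fun E + pos_fun F \<le> pos_fun (E \<union> F)"
proof -
  have le: "ennreal (\<nu> A) + ennreal (\<nu> B) \<le> pos_fun (E \<union> F)"
    if A: "A \<in> sets borel" "A \<subseteq> E" and B: "B \<in> sets borel" "B \<subseteq> F" for A B
  proof -
    have "ennreal (\<nu> A) \<le> pos_fun (E \<union> F)" "ennreal (\<nu> B) \<le> pos_fun (E \<union> F)"
      "ennreal (\<nu> (A \<union> B)) \<le> pos_fun (E \<union> F)"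
      using A B by (auto intro!: pos_fun_upper)
    moreover have "A \<inter> B = {}" using A B assms(3) by auto
    with A B have "\<nu> (A \<union> B) = \<nu> A + \<nu> B" by (intro signed_Un)
    ultimately show ?thesis by (subst ennreal_plus_if) (simp del: ennreal_plus)
  qed
  have ne: "{A \<in> sets borel. A \<subseteq> E'} \<noteq> {}" for E' :: "'a set"
  proof -
    have "{} \<in> {A \<in> sets borel. A \<subseteq> E'}" by simp
    then show ?thesis by blast
  qed
  have 1: "ennreal (\<nu> A) + pos_fun F \<le> pos_fun (E \<union> F)" if A: "A \<in> sets borel" "A \<subseteq> E" for A
  proof -
    have "pos_fun F + ennreal (\<nu> A) = (SUP B \<in> {B \<in> sets borel. B \<subseteq> F}. ennreal (\<nu> B) + ennreal (\<nu> A))"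
      unfolding pos_fun_def by (rule ennreal_SUP_add_left[OF ne, symmetric])
    also have "\<dots> \<le> pos_fun (E \<union> F)"
      using le[OF A] by (intro SUP_least) (auto simp: add.commute)
    finally show ?thesis by (simp add: add.commute)
  qed
  have "pos_fun E + pos_fun F = (SUP A \<in> {A \<in> sets borel. A \<subseteq> E}. ennreal (\<nu> A) + pos_fun F)"
    unfolding pos_fun_def[of E] by (rule ennreal_SUP_add_left[OF ne, symmetric])
  also have "\<dots> \<le> pos_fun (E \<union> F)" using 1 by (intro SUP_least) auto
  finally show ?thesis .
qed

lemma pos_fun_mono: "E \<subseteq> F \<Longrightarrow> pos_fun E \<le> pos_fun F"
  by (intro pos_fun_le pos_fun_upper) auto

text \<open>On the right negative summands are truncated one by one, on the left only their total
  with the others is.\<close>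

lemma ennreal_sum_le: "ennreal (sum f I) \<le> (\<Sum>i\<in>I. ennreal (f i))"
proof (induction I rule: infinite_finite_induct)
  case (insert i I)
  have "ennreal (f i + sum f I) \<le> ennreal (f i) + ennreal (sum f I)"
    by (subst ennreal_plus_if) (simp add: ennreal_leI del: ennreal_plus)
  also have "\<dots> \<le> ennreal (f i) + (\<Sum>i\<in>I. ennreal (f i))" by (intro add_left_mono insert)
  finally show ?case using insert by simp
qed auto

text \<open>One inequality is superadditivity on finite unions. For the other a test set is cut
  along the \<open>E n\<close>, and countable additivity of \<open>\<nu>\<close> applies to the
  pieces.\<close>

lemma pos_fun_countably_additive: "countably_additive (sets borel) pos_fun"
  unfolding countably_additive_def
proof (intro allI impI)
  fix E :: "nat \<Rightarrow> 'a set"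
  assume E: "range E \<subseteq> sets borel" "disjoint_family E" "(\<Union>n. E n) \<in> sets borel"
  then have Eb: "E n \<in> sets borel" for n by auto
  show "(\<Sum>n. pos_fun (E n)) = pos_fun (\<Union>n. E n)"
  proof (rule antisym)
    have "(\<Sum>n<N. pos_fun (E n)) \<le> pos_fun (\<Union>n<N. E n)" for N
    proof (induction N)
      case (Suc N)
      have "(\<Sum>n<Suc N. pos_fun (E n)) \<le> pos_fun (\<Union>n<N. E n) + pos_fun (E N)"
        using Suc by (simp add: add_right_mono)
      also have "\<dots> \<le> pos_fun ((\<Union>n<N. E n) \<union> E N)"
      proof (intro pos_fun_superadditive)
        have "E n \<inter> E N = {}" if "n < N" for n
          using E(2) that by (simp add: disjoint_family_on_def)
        then show "(\<Union>n<N. E n) \<inter> E N = {}" by auto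
      qed (use Eb in auto)
      finally show ?case by (simp add: lessThan_Suc Un_commute)
    qed simp
    also have "\<dots> N \<le> pos_fun (\<Union>n. E n)" for N by (rule pos_fun_mono) auto
    finally have "(\<Sum>n<N. pos_fun (E n)) \<le> pos_fun (\<Union>n. E n)" for N .
    then show "(\<Sum>n. pos_fun (E n)) \<le> pos_fun (\<Union>n. E n)" by (intro suminf_le_const) auto
  next
    show "pos_fun (\<Union>n. E n) \<le> (\<Sum>n. pos_fun (E n))"
    proof (rule pos_fun_le)
      fix A assume A: "A \<in> sets borel" "A \<subseteq> (\<Union>n. E n)"
      have "(\<lambda>n. \<nu> (A \<inter> E n)) sums \<nu> (\<Union>n. A \<inter> E n)"
      proof (rule signed_borel_sums[OF \<nu>])
        show "disjoint_family (\<lambda>n. A \<inter> E n)" using E(2) unfolding disjoint_family_on_def by blast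
      qed (use A Eb in auto)
      moreover have "(\<Union>n. A \<inter> E n) = A" using A by auto
      ultimately have "(\<lambda>N. ennreal (\<Sum>n<N. \<nu> (A \<inter> E n))) \<longlonglongrightarrow> ennreal (\<nu> A)"
        by (intro tendsto_ennrealI) (simp add: sums_def)
      moreover have "ennreal (\<Sum>n<N. \<nu> (A \<inter> E n)) \<le> (\<Sum>n. pos_fun (E n))" for N
      proof -
        have "ennreal (\<Sum>n<N. \<nu> (A \<inter> E n)) \<le> (\<Sum>n<N. ennreal (\<nu> (A \<inter> E n)))" by (rule ennreal_sum_le)
        also have "\<dots> \<le> (\<Sum>n<N. pos_fun (E n))" using A Eb by (intro sum_mono pos_fun_upper) auto
        also have "\<dots> \<le> (\<Sum>n. pos_fun (E n))" by (intro sum_le_suminf) auto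
        finally show ?thesis .
      qed
      ultimately show "ennreal (\<nu> A) \<le> (\<Sum>n. pos_fun (E n))"
        using LIMSEQ_le_const2 by blast
    qed
  qed
qed

lemma sets_pos_part [simp, measurable_cong]: "sets (pos_part \<nu>) = sets borel"
  and space_pos_part [simp]: "space (pos_part \<nu>) = UNIV"
  using sets.sigma_sets_eq[of borel] by (simp_all add: pos_part_def sets_measure_of_conv space_measure_of_conv)

lemma emeasure_pos_part:
  assumes "E \<in> sets borel"
  shows "emeasure (pos_part \<nu>) E = pos_fun E"
  unfolding pos_part_def pos_fun_def[symmetric, abs_def]
proof (rule emeasure_measure_of_sigma[OF _ _ pos_fun_countably_additive assms])
  show "sigma_algebra UNIV (sets (borel :: 'a measure))" using sets.sigma_algebra_axioms[of borel] by simp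
  show "positive (sets borel) pos_fun"
    using signed_empty by (auto simp: positive_def pos_fun_def intro!: antisym SUP_least)
qed

lemma finite_measure_pos_part: "finite_measure (pos_part \<nu>)"
proof
  obtain C where C: "\<And>A. A \<in> sets borel \<Longrightarrow> \<bar>\<nu> A\<bar> \<le> C" using signed_bounded by blast
  have "pos_fun UNIV \<le> ennreal C" using C by (intro pos_fun_le ennreal_leI) (auto simp: abs_le_iff)
  then have "emeasure (pos_part \<nu>) UNIV < top" by (simp add: emeasure_pos_part le_less_trans)
  then show "emeasure (pos_part \<nu>) (space (pos_part \<nu>)) \<noteq> \<infinity>" by simp
qed

lemma measure_pos_part:
  assumes E: "E \<in> sets borel"
  shows "ennreal (measure (pos_part \<nu>) E) = pos_fun E"
  using finite_measure.emeasure_eq_measure[OF finite_measure_pos_part, of E] emeasure_pos_part[OF E] by simp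

lemma measure_pos_part_upper:
  assumes "A \<in> sets borel" "E \<in> sets borel" "A \<subseteq> E"
  shows "\<nu> A \<le> measure (pos_part \<nu>) E"
proof -
  have "ennreal (\<nu> A) \<le> ennreal (measure (pos_part \<nu>) E)"
    using assms by (simp add: measure_pos_part pos_fun_upper)
  then show ?thesis using measure_nonneg[of "pos_part \<nu>" E] by (simp add: ennreal_le_iff)
qed

lemma measure_pos_part_le:
  assumes "E \<in> sets borel" "0 \<le> c" "\<And>A. A \<in> sets borel \<Longrightarrow> A \<subseteq> E \<Longrightarrow> \<nu> A \<le> c"
  shows "measure (pos_part \<nu>) E \<le> c"
proof -
  have "ennreal (measure (pos_part \<nu>) E) \<le> ennreal c"
    unfolding measure_pos_part[OF assms(1)] using assms by (intro pos_fun_le ennreal_leI)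
  then show ?thesis using assms(2) by (simp add: ennreal_le_iff)
qed

end

text \<open>For \<open>A\<close> inside \<open>E\<close>,
  \<open>\<nu> A = \<nu> E - \<nu> (E - A)\<close> is at most \<open>\<nu> E\<close> plus the
  negative part of \<open>E\<close>. The supremum over \<open>A\<close> gives one inequality, and
  the same argument for \<open>- \<nu>\<close> the other.\<close>

lemma jordan_decomposition:
  assumes \<nu>: "signed_borel \<nu>" and E: "E \<in> sets borel"
  shows "\<nu> E = measure (pos_part \<nu>) E - measure (pos_part (\<lambda>A. - \<nu> A)) E"
proof -
  note \<nu>' = signed_borel_minus[OF \<nu>]
  have *: "measure (pos_part \<nu>) E \<le> \<nu> E + measure (pos_part (\<lambda>A. - \<nu> A)) E" if \<nu>: "signed_borel \<nu>" for \<nu>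
  proof (rule measure_pos_part_le[OF that E])
    note \<nu>' = signed_borel_minus[OF \<nu>]
    have up: "- \<nu> A \<le> measure (pos_part (\<lambda>A. - \<nu> A)) E" if "A \<in> sets borel" "A \<subseteq> E" for A
      using measure_pos_part_upper[OF \<nu>' _ E] that by blast
    show "0 \<le> \<nu> E + measure (pos_part (\<lambda>A. - \<nu> A)) E" using up[OF E] by simp
    fix A assume A: "A \<in> sets borel" "A \<subseteq> E"
    then show "\<nu> A \<le> \<nu> E + measure (pos_part (\<lambda>A. - \<nu> A)) E"
      using up[of "E - A"] signed_split[OF \<nu> A(1) E A(2)] E by auto
  qed
  show ?thesis using *[OF \<nu>] *[OF \<nu>'] by simp
qed

section \<open>Integration against complex measures\<close>

lemma integrable_bounded_borel:
  fixes f :: "'a::topological_space \<Rightarrow> complex"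
  assumes "finite_measure M" "sets M = sets borel" "f \<in> borel_measurable borel" "\<And>x. cmod (f x) \<le> B"
  shows "integrable M f"
proof -
  have "f \<in> borel_measurable M" using assms(2,3) by (simp cong: measurable_cong_sets)
  then show ?thesis using assms(1,4) by (intro finite_measure.integrable_const_bound) auto
qed

text \<open>Each cell has its own error \<open>e i\<close>, because later one cell is the tail
  outside a compact set, where \<open>f\<close> has only a crude bound but the measure is
  small.\<close>

lemma integral_riemann_sum:
  fixes f :: "'a::topological_space \<Rightarrow> complex"
  assumes M: "finite_measure M" "sets M = sets borel"
    and f: "f \<in> borel_measurable borel" "\<And>x. cmod (f x) \<le> B"
    and I: "finite I" "\<And>i. i \<in> I \<Longrightarrow> E i \<in> sets borel" "disjoint_family_on E I" "(\<Union>i\<in>I. E i) = UNIV"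
    and e: "\<And>i x. i \<in> I \<Longrightarrow> x \<in> E i \<Longrightarrow> cmod (f x - c i) \<le> e i"
  shows "cmod ((LINT x|M. f x) - (\<Sum>i\<in>I. c i * of_real (measure M (E i)))) \<le> (\<Sum>i\<in>I. e i * measure M (E i))"
proof -
  interpret finite_measure M by fact
  have sp: "space M = UNIV" using M(2) sets_eq_imp_space_eq by fastforce
  have EM: "E i \<in> sets M" if "i \<in> I" for i using I(2)[OF that] M(2) by simp
  define g where "g x = (\<Sum>i\<in>I. of_real (indicator (E i) x) * c i)" for x
  define k where "k x = (\<Sum>i\<in>I. indicator (E i) x * e i)" for x
  have ind: "integrable M (indicator (E i) :: 'a \<Rightarrow> real)" if "i \<in> I" for i
    using EM[OF that] by (intro integrable_real_indicator) (simp_all add: emeasure_eq_measure)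
  have int_ind: "integrable M (\<lambda>x. indicator (E i) x * e i)" if "i \<in> I" for i
    by (intro integrable_mult_left ind that)
  have int_ind': "integrable M (\<lambda>x. of_real (indicator (E i) x) * c i)" if "i \<in> I" for i
    by (intro integrable_mult_left integrable_of_real ind that)
  have int: "integrable M f" "integrable M g" "integrable M k"
    using integrable_bounded_borel[OF M f] int_ind int_ind' by (auto simp: g_def[abs_def] k_def[abs_def])
  have g: "(LINT x|M. g x) = (\<Sum>i\<in>I. c i * of_real (measure M (E i)))"
    unfolding g_def using int_ind' EM
    by (subst Bochner_Integration.integral_sum) (auto simp: sp mult.commute)
  have k: "(LINT x|M. k x) = (\<Sum>i\<in>I. e i * measure M (E i))"
    unfolding k_def using int_ind EM
    by (subst Bochner_Integration.integral_sum) (auto simp: sp mult.commute)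
  have "cmod (f x - g x) \<le> k x" for x
  proof -
    obtain j where j: "j \<in> I" "x \<in> E j" using I(4) by blast
    have ind: "indicator (E i) x = (if i = j then 1 else 0 :: real)" if "i \<in> I" for i
      using that j I(3) by (auto simp: disjoint_family_on_def indicator_def)
    have "g x = c j" "k x = e j"
      unfolding g_def k_def using j(1) I(1) ind by (simp_all add: if_distrib[of "\<lambda>t. of_real t * _"]
        if_distrib[of "\<lambda>t. t * _"] sum.delta cong: if_cong)
    then show ?thesis using e[OF j] by simp
  qed
  then have "(LINT x|M. cmod (f x - g x)) \<le> (LINT x|M. k x)"
    using int by (intro integral_mono) auto
  then have "cmod (LINT x|M. f x - g x) \<le> (LINT x|M. k x)"
    using integral_norm_bound[of M "\<lambda>x. f x - g x"] by linarith
  then show ?thesis using int g k by simp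
qed

text \<open>The disjoint pieces keep the index of the set containing them, so a value that
  approximates a function on \<open>A i\<close> still does so on \<open>E i\<close>.\<close>

lemma finite_cover_refine:
  assumes "finite I" "\<And>i. i \<in> I \<Longrightarrow> A i \<in> sets M"
  obtains E where "\<And>i. i \<in> I \<Longrightarrow> E i \<in> sets M" "\<And>i. i \<in> I \<Longrightarrow> E i \<subseteq> A i"
    "disjoint_family_on E I" "(\<Union>i\<in>I. E i) = (\<Union>i\<in>I. A i)"
  using assms
proof (induction I arbitrary: thesis rule: finite_induct)
  case empty
  then show ?case by (auto simp: disjoint_family_on_def)
next
  case (insert a I)
  obtain E where E: "\<And>i. i \<in> I \<Longrightarrow> E i \<in> sets M" "\<And>i. i \<in> I \<Longrightarrow> E i \<subseteq> A i"
    "disjoint_family_on E I" "(\<Union>i\<in>I. E i) = (\<Union>i\<in>I. A i)"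
    using insert.IH insert.prems(2) by (metis insertCI)
  define F where "F i = (if i = a then A a - (\<Union>i\<in>I. A i) else E i)" for i
  have FI: "F i = E i" if "i \<in> I" for i using that insert.hyps by (auto simp: F_def)
  show ?case
  proof (rule insert.prems(1)[of F])
    show "F i \<in> sets M" if "i \<in> insert a I" for i
      using that E(1) insert.prems(2) insert.hyps(1) by (auto simp: F_def)
    show "F i \<subseteq> A i" if "i \<in> insert a I" for i
      using that E(2) by (auto simp: F_def)
    have "F a \<inter> F i = {}" if "i \<in> I" for i
      using that E(2)[OF that] by (auto simp: FI) (auto simp: F_def)
    then show "disjoint_family_on F (insert a I)"
      using E(3) FI unfolding disjoint_family_on_def by (metis Int_commute insertE)
    have "(\<Union>i\<in>insert a I. F i) = F a \<union> (\<Union>i\<in>I. E i)" using FI by auto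
    then show "(\<Union>i\<in>insert a I. F i) = (\<Union>i\<in>insert a I. A i)" unfolding E(4) by (auto simp: F_def)
  qed
qed

text \<open>The index of a cell is the centre of a ball from a finite cover of a disc containing the
  range, hence is itself the approximating value.\<close>

lemma bounded_borel_partition:
  fixes f :: "'a::topological_space \<Rightarrow> complex"
  assumes f: "f \<in> borel_measurable borel" "\<And>x. cmod (f x) \<le> B" and e: "0 < e"
  obtains I :: "complex set" and E where "finite I" "\<And>i. i \<in> I \<Longrightarrow> E i \<in> sets borel" "disjoint_family_on E I"
    "(\<Union>i\<in>I. E i) = UNIV" "\<And>i x. i \<in> I \<Longrightarrow> x \<in> E i \<Longrightarrow> cmod (f x - i) \<le> e"
proof -
  obtain I :: "complex set" where I: "finite I" "cball 0 B \<subseteq> (\<Union>i\<in>I. ball i e)"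
  proof (rule compactE_image[OF compact_cball, of UNIV "\<lambda>i. ball i e"])
    show "cball 0 B \<subseteq> (\<Union>i\<in>UNIV. ball i e)"
    proof
      fix x show "x \<in> (\<Union>i\<in>UNIV. ball i e)" using e by (intro UN_I[of x]) auto
    qed
  qed auto
  have meas: "f -` ball i e \<in> sets borel" for i
    using measurable_sets[OF f(1), of "ball i e"] by simp
  obtain E where E: "\<And>i. i \<in> I \<Longrightarrow> E i \<in> sets borel" "\<And>i. i \<in> I \<Longrightarrow> E i \<subseteq> f -` ball i e"
    "disjoint_family_on E I" "(\<Union>i\<in>I. E i) = (\<Union>i\<in>I. f -` ball i e)"
    using finite_cover_refine[OF I(1), of "\<lambda>i. f -` ball i e" borel] meas by blast
  show ?thesis
  proof (rule that[OF I(1) E(1) E(3)])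
    show "(\<Union>i\<in>I. E i) = UNIV" unfolding E(4)
    proof (intro equalityI subset_UNIV subsetI)
      fix x
      have "f x \<in> cball 0 B" using f(2) by simp
      from subsetD[OF I(2) this] show "x \<in> (\<Union>i\<in>I. f -` ball i e)" by auto
    qed
    show "cmod (f x - i) \<le> e" if "i \<in> I" "x \<in> E i" for i x
      using E(2)[OF that(1)] that(2) by (auto simp: dist_norm norm_minus_commute)
  qed
qed

text \<open>Riemann sums over a common partition see the measures only through their differences.
  This frees the integral from the particular decomposition, here the Jordan one.\<close>

lemma integral_eq_of_measure_eq:
  fixes f :: "'a::topological_space \<Rightarrow> complex"
  assumes M: "finite_measure P" "sets P = sets borel" "finite_measure Q" "sets Q = sets borel"
      "finite_measure R" "sets R = sets borel" "finite_measure S" "sets S = sets borel"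
    and eq: "\<And>E. E \<in> sets borel \<Longrightarrow> measure P E - measure Q E = measure R E - measure S E"
    and f: "f \<in> borel_measurable borel" "\<And>x. cmod (f x) \<le> B"
  shows "(LINT x|P. f x) - (LINT x|Q. f x) = (LINT x|R. f x) - (LINT x|S. f x)" (is "?l = ?r")
proof -
  define T where "T = measure P UNIV + measure Q UNIV + measure R UNIV + measure S UNIV"
  have "cmod (?l - ?r) \<le> 0 + d" if d: "0 < d" for d
  proof -
    have T: "0 \<le> T" by (simp add: T_def)
    define e where "e = d / (T + 1)"
    have e: "0 < e" "e * T \<le> d" using d T by (auto simp: e_def field_simps)
    obtain I :: "complex set" and E where I: "finite I" "\<And>i. i \<in> I \<Longrightarrow> E i \<in> sets borel" "disjoint_family_on E I"
      "(\<Union>i\<in>I. E i) = UNIV" "\<And>i x. i \<in> I \<Longrightarrow> x \<in> E i \<Longrightarrow> cmod (f x - i) \<le> e"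
      by (rule bounded_borel_partition[OF f e(1)]) blast
    define s where "s M = (\<Sum>i\<in>I. i * complex_of_real (measure M (E i)))" for M :: "'a measure"
    have *: "cmod ((LINT x|M. f x) - s M) \<le> e * measure M UNIV"
      if M: "finite_measure M" "sets M = sets borel" for M
    proof -
      have "cmod ((LINT x|M. f x) - s M) \<le> (\<Sum>i\<in>I. e * measure M (E i))"
        unfolding s_def by (rule integral_riemann_sum[OF M f I])
      also have "\<dots> = e * measure M (\<Union>i\<in>I. E i)"
        using I M finite_measure.finite_measure_finite_Union[OF M(1), of I E]
        by (subst finite_measure.finite_measure_finite_Union) (auto simp: sum_distrib_left)
      finally show ?thesis using I(4) by simp
    qed
    have "s P - s Q - (s R - s S) = (\<Sum>i\<in>I. i * complex_of_real ((measure P (E i) - measure Q (E i)) - (measure R (E i) - measure S (E i))))"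
      by (simp add: s_def sum_subtractf sum.distrib algebra_simps)
    also have "\<dots> = 0" using eq I(2) by (intro sum.neutral) simp
    finally have eq: "?l - ?r = ((LINT x|P. f x) - s P) - ((LINT x|Q. f x) - s Q) - (((LINT x|R. f x) - s R) - ((LINT x|S. f x) - s S))"
      by (simp add: algebra_simps)
    have "cmod (?l - ?r) \<le> (e * measure P UNIV + e * measure Q UNIV) + (e * measure R UNIV + e * measure S UNIV)"
      unfolding eq using M by (intro order_trans[OF norm_triangle_ineq4] add_mono *)
    also have "\<dots> = e * T" by (simp add: T_def algebra_simps)
    finally show ?thesis using e(2) by simp
  qed
  then have "cmod (?l - ?r) \<le> 0" by (rule field_le_epsilon)
  then show ?thesis by simp
qed

text \<open>For a complex Borel measure this is in general larger than the total variation, but it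
  dominates \<open>cmod (\<mu> E)\<close>, and being a sum of finite measures it is additive and
  monotone at once.\<close>

definition jordan_variation :: "('a::topological_space set \<Rightarrow> complex) \<Rightarrow> 'a set \<Rightarrow> real"
  where "jordan_variation \<mu> E = measure (pos_part (\<lambda>A. Re (\<mu> A))) E + measure (pos_part (\<lambda>A. - Re (\<mu> A))) E +
    measure (pos_part (\<lambda>A. Im (\<mu> A))) E + measure (pos_part (\<lambda>A. - Im (\<mu> A))) E"

section \<open>Estimates for complex integrals through the four Jordan parts\<close>

context
  fixes \<mu> :: "'a::topological_space set \<Rightarrow> complex"
  assumes \<mu>: "complex_borel_measure \<mu>"
begin

abbreviation "re_pos \<equiv> pos_part (\<lambda>A. Re (\<mu> A))"
abbreviation "re_neg \<equiv> pos_part (\<lambda>A. - Re (\<mu> A))"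
abbreviation "im_pos \<equiv> pos_part (\<lambda>A. Im (\<mu> A))"
abbreviation "im_neg \<equiv> pos_part (\<lambda>A. - Im (\<mu> A))"

lemma signed_parts: "signed_borel (\<lambda>A. Re (\<mu> A))" "signed_borel (\<lambda>A. - Re (\<mu> A))"
    "signed_borel (\<lambda>A. Im (\<mu> A))" "signed_borel (\<lambda>A. - Im (\<mu> A))"
  using \<mu> signed_borel_minus unfolding complex_borel_iff by blast+

lemma finite_parts: "finite_measure re_pos" "finite_measure re_neg" "finite_measure im_pos" "finite_measure im_neg"
  by (intro finite_measure_pos_part signed_parts)+

lemma sets_parts: "sets re_pos = sets borel" "sets re_neg = sets borel" "sets im_pos = sets borel" "sets im_neg = sets borel"
  by (intro sets_pos_part signed_parts)+

lemma complex_measure_parts: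
  assumes "E \<in> sets borel"
  shows "\<mu> E = of_real (measure re_pos E - measure re_neg E) + \<i> * of_real (measure im_pos E - measure im_neg E)"
  using jordan_decomposition[OF signed_parts(1) assms] jordan_decomposition[OF signed_parts(3) assms]
  by (simp add: complex_eq_iff)

lemma complex_integral_parts:
  "complex_integral \<mu> f = ((LINT x|re_pos. f x) - (LINT x|re_neg. f x)) + \<i> * ((LINT x|im_pos. f x) - (LINT x|im_neg. f x))"
  by (simp add: complex_integral_def signed_integral_def)

lemma jordan_variation_nonneg: "0 \<le> jordan_variation \<mu> E"
  by (simp add: jordan_variation_def)

lemma jordan_variation_mono:
  "E \<in> sets borel \<Longrightarrow> F \<in> sets borel \<Longrightarrow> E \<subseteq> F \<Longrightarrow> jordan_variation \<mu> E \<le> jordan_variation \<mu> F"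
  unfolding jordan_variation_def
  by (intro add_mono finite_measure.finite_measure_mono finite_parts) (simp_all add: sets_parts)

lemma jordan_variation_finite_Union:
  assumes "finite I" "\<And>i. i \<in> I \<Longrightarrow> E i \<in> sets borel" "disjoint_family_on E I"
  shows "(\<Sum>i\<in>I. jordan_variation \<mu> (E i)) = jordan_variation \<mu> (\<Union>i\<in>I. E i)"
proof -
  have "E ` I \<subseteq> sets borel" using assms by auto
  then show ?thesis
    using assms finite_parts sets_parts unfolding jordan_variation_def sum.distrib
    by (simp add: finite_measure.finite_measure_finite_Union)
qed

lemma complex_integral_riemann_sum:
  fixes f :: "'a \<Rightarrow> complex"
  assumes f: "f \<in> borel_measurable borel" "\<And>x. cmod (f x) \<le> B"
    and I: "finite I" "\<And>i. i \<in> I \<Longrightarrow> E i \<in> sets borel" "disjoint_family_on E I" "(\<Union>i\<in>I. E i) = UNIV"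
    and e: "\<And>i x. i \<in> I \<Longrightarrow> x \<in> E i \<Longrightarrow> cmod (f x - c i) \<le> e i"
  shows "cmod (complex_integral \<mu> f - (\<Sum>i\<in>I. c i * \<mu> (E i))) \<le> (\<Sum>i\<in>I. e i * jordan_variation \<mu> (E i))"
proof -
  define s where "s M = (\<Sum>i\<in>I. c i * complex_of_real (measure M (E i)))" for M :: "'a measure"
  define t where "t M = (\<Sum>i\<in>I. e i * measure M (E i))" for M :: "'a measure"
  have *: "cmod ((LINT x|M. f x) - s M) \<le> t M" if "finite_measure M" "sets M = sets borel" for M
    unfolding s_def t_def by (rule integral_riemann_sum[OF that f I e])
  have "(\<Sum>i\<in>I. c i * \<mu> (E i)) = (\<Sum>i\<in>I. c i * (of_real (measure re_pos (E i) - measure re_neg (E i)) +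
      \<i> * of_real (measure im_pos (E i) - measure im_neg (E i))))"
    using I(2) complex_measure_parts by (intro sum.cong) auto
  also have "\<dots> = s re_pos - s re_neg + \<i> * (s im_pos - s im_neg)"
    by (simp add: s_def algebra_simps sum.distrib sum_subtractf sum_distrib_left)
  finally have eq: "complex_integral \<mu> f - (\<Sum>i\<in>I. c i * \<mu> (E i)) =
      (((LINT x|re_pos. f x) - s re_pos) - ((LINT x|re_neg. f x) - s re_neg)) +
      \<i> * (((LINT x|im_pos. f x) - s im_pos) - ((LINT x|im_neg. f x) - s im_neg))"
    unfolding complex_integral_parts by (simp add: algebra_simps)
  have "cmod (complex_integral \<mu> f - (\<Sum>i\<in>I. c i * \<mu> (E i))) \<le> cmod (((LINT x|re_pos. f x) - s re_pos) - ((LINT x|re_neg. f x) - s re_neg)) +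
      cmod (((LINT x|im_pos. f x) - s im_pos) - ((LINT x|im_neg. f x) - s im_neg))"
    unfolding eq by (rule order_trans[OF norm_triangle_ineq]) (simp add: norm_mult)
  also have "\<dots> \<le> (t re_pos + t re_neg) + (t im_pos + t im_neg)"
    using finite_parts sets_parts by (intro add_mono order_trans[OF norm_triangle_ineq4] *)
  also have "\<dots> = (\<Sum>i\<in>I. e i * jordan_variation \<mu> (E i))"
    by (simp add: t_def jordan_variation_def algebra_simps sum.distrib)
  finally show ?thesis .
qed

lemma complex_integral_lincomb:
  assumes f: "f \<in> borel_measurable borel" "\<And>x. cmod (f x) \<le> B"
    and g: "g \<in> borel_measurable borel" "\<And>x. cmod (g x) \<le> C"
  shows "complex_integral \<mu> (\<lambda>x. a * f x + b * g x) = a * complex_integral \<mu> f + b * complex_integral \<mu> g"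
proof -
  have "(LINT x|M. a * f x + b * g x) = a * (LINT x|M. f x) + b * (LINT x|M. g x)"
    if "finite_measure M" "sets M = sets borel" for M
    using integrable_bounded_borel[OF that f] integrable_bounded_borel[OF that g] by simp
  with finite_parts sets_parts show ?thesis
    unfolding complex_integral_parts by (simp add: algebra_simps)
qed

text \<open>A Riemann sum with the two cells \<open>K\<close> and \<open>- K\<close> and both
  coefficients 0.\<close>

lemma complex_integral_bound2:
  assumes f: "f \<in> borel_measurable borel" "\<And>x. cmod (f x) \<le> B"
    and K: "K \<in> sets borel" "\<And>x. x \<in> K \<Longrightarrow> cmod (f x) \<le> d"
  shows "cmod (complex_integral \<mu> f) \<le> d * jordan_variation \<mu> K + B * jordan_variation \<mu> (- K)"
proof -
  define E where "E b = (if b then K else - K)" for b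
  have "cmod (complex_integral \<mu> f - (\<Sum>b\<in>UNIV. 0 * \<mu> (E b))) \<le> (\<Sum>b\<in>UNIV. (if b then d else B) * jordan_variation \<mu> (E b))"
    by (rule complex_integral_riemann_sum[OF f])
      (use f K in \<open>auto simp: E_def disjoint_family_on_def split: if_splits\<close>)
  then show ?thesis by (simp add: UNIV_bool E_def add.commute)
qed

lemma complex_integral_bound:
  assumes f: "f \<in> borel_measurable borel" "\<And>x. cmod (f x) \<le> B"
  shows "cmod (complex_integral \<mu> f) \<le> B * jordan_variation \<mu> UNIV"
  using complex_integral_bound2[OF f, of UNIV B] f by (simp add: jordan_variation_def)

end

section \<open>Regular complex measures as functionals\<close>

lemma total_variation_upper:
  "(\<And>n. A n \<in> sets borel) \<Longrightarrow> disjoint_family A \<Longrightarrow> (\<Union>n. A n) = E \<Longrightarrow>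
    (\<Sum>n. ennreal (cmod (\<mu> (A n)))) \<le> total_variation \<mu> E"
  unfolding total_variation_def by (rule SUP_upper) auto

lemma total_variation_least:
  "(\<And>A :: nat \<Rightarrow> 'a::topological_space set. (\<And>n. A n \<in> sets borel) \<Longrightarrow> disjoint_family A \<Longrightarrow> (\<Union>n. A n) = E \<Longrightarrow>
    (\<Sum>n. ennreal (cmod (\<mu> (A n)))) \<le> c) \<Longrightarrow> total_variation \<mu> E \<le> c"
  unfolding total_variation_def by (rule SUP_least) auto

text \<open>Serves to enlarge a sequence of disjoint sets by prepending members.\<close>

lemma suminf_case_nat:
  fixes f :: "nat \<Rightarrow> ennreal"
  shows "(\<Sum>n. case n of 0 \<Rightarrow> a | Suc k \<Rightarrow> f k) = a + (\<Sum>n. f n)"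
  using suminf_offset[of "\<lambda>n. case n of 0 \<Rightarrow> a | Suc k \<Rightarrow> f k" 1] by (simp add: add.commute)

lemma compact_borel: "compact (K :: 'a::t2_space set) \<Longrightarrow> K \<in> sets borel"
  by (intro borel_closed compact_imp_closed)

lemma cmod_le_jordan_variation:
  assumes "complex_borel_measure \<mu>" "E \<in> sets borel"
  shows "cmod (\<mu> E) \<le> jordan_variation \<mu> E"
proof -
  let ?m = "\<lambda>\<nu>. measure (pos_part \<nu>) E"
  have "cmod (\<mu> E) \<le> \<bar>Re (\<mu> E)\<bar> + \<bar>Im (\<mu> E)\<bar>" by (rule cmod_le)
  also have "Re (\<mu> E) = ?m (\<lambda>A. Re (\<mu> A)) - ?m (\<lambda>A. - Re (\<mu> A))"
    using complex_measure_parts[OF assms] by simp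
  also have "Im (\<mu> E) = ?m (\<lambda>A. Im (\<mu> A)) - ?m (\<lambda>A. - Im (\<mu> A))"
    using complex_measure_parts[OF assms] by simp
  finally show ?thesis
    unfolding jordan_variation_def
    using measure_nonneg[of "pos_part (\<lambda>A. Re (\<mu> A))" E] measure_nonneg[of "pos_part (\<lambda>A. - Re (\<mu> A))" E]
      measure_nonneg[of "pos_part (\<lambda>A. Im (\<mu> A))" E] measure_nonneg[of "pos_part (\<lambda>A. - Im (\<mu> A))" E]
    by linarith
qed

text \<open>Partial sums over any partition stay below the additive majorant
  \<open>jordan_variation \<mu> UNIV\<close>.\<close>

lemma total_variation_finite:
  assumes \<mu>: "complex_borel_measure \<mu>"
  shows "total_variation \<mu> E < top"
proof -
  have "total_variation \<mu> E \<le> ennreal (jordan_variation \<mu> UNIV)"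
  proof (rule total_variation_least)
    fix A :: "nat \<Rightarrow> 'a set" assume A: "\<And>n. A n \<in> sets borel" "disjoint_family A"
    have "(\<Sum>n<N. ennreal (cmod (\<mu> (A n)))) \<le> ennreal (jordan_variation \<mu> UNIV)" for N
    proof -
      have "(\<Sum>n<N. cmod (\<mu> (A n))) \<le> (\<Sum>n<N. jordan_variation \<mu> (A n))"
        by (intro sum_mono cmod_le_jordan_variation \<mu> A)
      also have "\<dots> = jordan_variation \<mu> (\<Union>n<N. A n)"
        using A by (intro jordan_variation_finite_Union[OF \<mu>]) (auto simp: disjoint_family_on_def)
      also have "\<dots> \<le> jordan_variation \<mu> UNIV"
        using A by (intro jordan_variation_mono[OF \<mu>]) auto
      finally show ?thesis by (simp add: ennreal_leI)
    qed
    then show "(\<Sum>n. ennreal (cmod (\<mu> (A n)))) \<le> ennreal (jordan_variation \<mu> UNIV)"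
      by (intro suminf_le_const) auto
  qed
  then show ?thesis by (simp add: le_less_trans)
qed

text \<open>A partition of \<open>K\<close>, together with \<open>A\<close> and the remaining
  points, is a partition of the whole space.\<close>

lemma total_variation_add_le:
  fixes \<mu> :: "'a::topological_space set \<Rightarrow> complex"
  assumes A: "A \<in> sets borel" "A \<inter> K = {}" and K: "K \<in> sets borel"
  shows "ennreal (cmod (\<mu> A)) + total_variation \<mu> K \<le> total_variation \<mu> UNIV"
proof -
  let ?S = "{B :: nat \<Rightarrow> 'a set. range B \<subseteq> sets borel \<and> disjoint_family B \<and> (\<Union>n. B n) = K}"
  have "binaryset K {} \<in> ?S"
    using K by (auto simp: binaryset_def disjoint_family_on_def UN_binaryset_eq[unfolded binaryset_def] split: if_splits)
  then have ne: "?S \<noteq> {}" by blast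
  have "total_variation \<mu> K + ennreal (cmod (\<mu> A)) =
      (SUP B\<in>?S. (\<Sum>n. ennreal (cmod (\<mu> (B n)))) + ennreal (cmod (\<mu> A)))"
    unfolding total_variation_def by (rule ennreal_SUP_add_left[OF ne, symmetric])
  also have "\<dots> \<le> total_variation \<mu> UNIV"
  proof (rule SUP_least)
    fix B assume "B \<in> ?S"
    then have B: "\<And>n. B n \<in> sets borel" "disjoint_family B" "(\<Union>n. B n) = K" by auto
    define D where "D n = (case n of 0 \<Rightarrow> - K - A | Suc n \<Rightarrow> (case n of 0 \<Rightarrow> A | Suc k \<Rightarrow> B k))" for n :: nat
    have Db: "D n \<in> sets borel" for n
      using A K B(1) by (auto simp: D_def split: nat.split)
    have BK: "B n \<subseteq> K" for n using B(3) by auto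
    have "D m \<inter> D n = {}" if "m < n" for m n
    proof -
      have BB: "B k \<inter> B l = {}" if "k \<noteq> l" for k l using B(2) that by (simp add: disjoint_family_on_def)
      show ?thesis
        using that A(2) BK BB by (auto simp: D_def split: nat.splits)
    qed
    then have "disjoint_family D"
      unfolding disjoint_family_on_def by (metis Int_commute nat_neq_iff)
    moreover have "(\<Union>n. D n) = UNIV"
    proof (intro equalityI subset_UNIV subsetI)
      fix x
      consider "x \<in> D 0" | "x \<in> D 1" | k where "x \<in> D (Suc (Suc k))"
        using B(3) by (auto simp: D_def)
      then show "x \<in> (\<Union>n. D n)" by cases auto
    qed
    ultimately have "(\<Sum>n. ennreal (cmod (\<mu> (D n)))) \<le> total_variation \<mu> UNIV"
      by (intro total_variation_upper Db)
    also have "(\<lambda>n. ennreal (cmod (\<mu> (D n)))) = (\<lambda>n. case n of 0 \<Rightarrow> ennreal (cmod (\<mu> (- K - A))) |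
        Suc n \<Rightarrow> (case n of 0 \<Rightarrow> ennreal (cmod (\<mu> A)) | Suc k \<Rightarrow> ennreal (cmod (\<mu> (B k)))))"
      by (auto simp: D_def fun_eq_iff split: nat.split)
    finally have "ennreal (cmod (\<mu> (- K - A))) + (ennreal (cmod (\<mu> A)) + (\<Sum>n. ennreal (cmod (\<mu> (B n))))) \<le> total_variation \<mu> UNIV"
      by (simp only: suminf_case_nat)
    then show "(\<Sum>n. ennreal (cmod (\<mu> (B n)))) + ennreal (cmod (\<mu> A)) \<le> total_variation \<mu> UNIV"
      by (metis add.commute add_increasing order_trans zero_le order_refl)
  qed
  finally show ?thesis by (simp add: add.commute)
qed

text \<open>If \<open>K\<close> carries the total variation up to e/4, every Borel set
  \<open>A\<close> off \<open>K\<close> has \<open>cmod (\<mu> A) <= e/4\<close>. Suprema over such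
  \<open>A\<close> bound each of the four Jordan parts by e/4.\<close>

lemma regular_complex_measure_tight:
  fixes \<mu> :: "'a::t2_space set \<Rightarrow> complex"
  assumes reg: "regular_complex_measure \<mu>" and e: "0 < e"
  obtains K where "compact K" "jordan_variation \<mu> (- K) \<le> e"
proof -
  have \<mu>: "complex_borel_measure \<mu>" using reg by (simp add: regular_complex_measure_def)
  have sup: "total_variation \<mu> UNIV = (SUP K \<in> {K. compact K \<and> K \<subseteq> UNIV}. total_variation \<mu> K)"
    by (rule conjunct2[OF bspec[OF conjunct2[OF reg[unfolded regular_complex_measure_def]]]]) simp
  have ne: "{K :: 'a set. compact K \<and> K \<subseteq> UNIV} \<noteq> {}" using compact_empty by blast
  have "\<exists>K\<in>{K. compact K \<and> K \<subseteq> UNIV}. total_variation \<mu> UNIV < total_variation \<mu> K + ennreal (e/4)"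
    by (rule SUP_approx_ennreal[OF _ ne sup])
      (use e total_variation_finite[OF \<mu>, of UNIV] in \<open>simp_all add: less_top\<close>)
  then obtain K where K: "compact K" "total_variation \<mu> UNIV < total_variation \<mu> K + ennreal (e/4)" by blast
  have Kb: "K \<in> sets borel" by (rule compact_borel[OF K(1)])
  have small: "cmod (\<mu> A) \<le> e/4" if A: "A \<in> sets borel" "A \<subseteq> - K" for A
  proof -
    have "ennreal (cmod (\<mu> A)) + total_variation \<mu> K \<le> total_variation \<mu> UNIV"
      using A Kb by (intro total_variation_add_le) auto
    also note K(2)
    finally have "total_variation \<mu> K + ennreal (cmod (\<mu> A)) < total_variation \<mu> K + ennreal (e/4)"
      by (simp add: add.commute)
    then have "ennreal (cmod (\<mu> A)) \<le> ennreal (e/4)"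
      by (metis add_left_mono linorder_not_le nle_le)
    then show ?thesis using e by (simp add: ennreal_le_iff)
  qed
  have part: "measure (pos_part \<nu>) (- K) \<le> e/4"
    if "signed_borel \<nu>" "\<And>A. \<nu> A \<le> cmod (\<mu> A)" for \<nu>
  proof (rule measure_pos_part_le[OF that(1)])
    show "\<nu> A \<le> e/4" if "A \<in> sets borel" "A \<subseteq> - K" for A
      using small[OF that] \<open>\<nu> A \<le> cmod (\<mu> A)\<close> by linarith
  qed (use Kb e in auto)
  have "jordan_variation \<mu> (- K) \<le> e/4 + e/4 + e/4 + e/4"
    unfolding jordan_variation_def
    using abs_Re_le_cmod abs_Im_le_cmod
    by (intro add_mono part signed_parts[OF \<mu>]) (metis abs_le_D1 abs_le_D2)+
  then show ?thesis using K(1) that by simp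
qed

text \<open>The points and weights are chosen before \<open>f\<close>. One choice therefore serves
  all functions with controlled variation on the sets \<open>U s\<close>, in particular
  \<open>fun_act X act M F\<close> for every \<open>M\<close> at once, each with its own
  \<open>B\<close> and \<open>d\<close>.\<close>

lemma tight_riemann_sum:
  fixes \<mu> :: "'a::t2_space set \<Rightarrow> complex"
  assumes reg: "regular_complex_measure \<mu>" and U: "\<And>s. open (U s)" "\<And>s. s \<in> U s" and e: "0 < e"
  obtains T w where "finite T" "\<And>f B d. f \<in> borel_measurable borel \<Longrightarrow> (\<And>x. cmod (f x) \<le> B) \<Longrightarrow> 0 \<le> d \<Longrightarrow>
    (\<And>s r. r \<in> U s \<Longrightarrow> cmod (f r - f s) \<le> d) \<Longrightarrow>
    cmod (complex_integral \<mu> f - (\<Sum>s\<in>T. w s * f s)) \<le> d * jordan_variation \<mu> UNIV + B * e"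
proof -
  have \<mu>: "complex_borel_measure \<mu>" using reg by (simp add: regular_complex_measure_def)
  obtain K where K: "compact K" "jordan_variation \<mu> (- K) \<le> e"
    using regular_complex_measure_tight[OF reg e] by blast
  have Kb: "K \<in> sets borel" by (rule compact_borel[OF K(1)])
  obtain T where T: "finite T" "K \<subseteq> (\<Union>s\<in>T. U s)"
  proof (rule compactE_image[OF K(1), of UNIV U])
    show "K \<subseteq> (\<Union>s\<in>UNIV. U s)" using U(2) by blast
  qed (use U(1) in auto)
  \<comment> \<open>\<open>None\<close> stands for the tail off \<open>K\<close>, where the
    approximating value will be 0 and the error \<open>B\<close>.\<close>
  define A where "A i = (case i of None \<Rightarrow> - K | Some s \<Rightarrow> U s)" for i
  have A: "A i \<in> sets borel" for i using Kb U(1) by (auto simp: A_def split: option.split)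
  obtain E where E: "\<And>i. i \<in> insert None (Some ` T) \<Longrightarrow> E i \<in> sets borel"
    "\<And>i. i \<in> insert None (Some ` T) \<Longrightarrow> E i \<subseteq> A i" "disjoint_family_on E (insert None (Some ` T))"
    "(\<Union>i\<in>insert None (Some ` T). E i) = (\<Union>i\<in>insert None (Some ` T). A i)"
    using finite_cover_refine[of "insert None (Some ` T)" A borel] T(1) A by blast
  have UN: "(\<Union>i\<in>insert None (Some ` T). E i) = UNIV"
    unfolding E(4) using T(2) by (auto simp: A_def)
  show ?thesis
  proof (rule that[OF T(1), of "\<lambda>s. \<mu> (E (Some s))"])
    fix f :: "'a \<Rightarrow> complex" and B d
    assume f: "f \<in> borel_measurable borel" "\<And>x. cmod (f x) \<le> B" and d: "0 \<le> d"
      and fU: "\<And>s r. r \<in> U s \<Longrightarrow> cmod (f r - f s) \<le> d"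
    have B: "0 \<le> B" using f(2) norm_ge_zero order_trans by blast
    define c where "c i = (case i of None \<Rightarrow> 0 | Some s \<Rightarrow> f s)" for i
    define b where "b i = (case i of None \<Rightarrow> B | Some s \<Rightarrow> d)" for i :: "'a option"
    have "cmod (complex_integral \<mu> f - (\<Sum>i\<in>insert None (Some ` T). c i * \<mu> (E i)))
        \<le> (\<Sum>i\<in>insert None (Some ` T). b i * jordan_variation \<mu> (E i))"
    proof (rule complex_integral_riemann_sum[OF \<mu> f _ E(1) E(3) UN])
      fix i x assume i: "i \<in> insert None (Some ` T)" "x \<in> E i"
      then have "x \<in> A i" using E(2) by blast
      then show "cmod (f x - c i) \<le> b i"
        using f(2) fU by (auto simp: A_def b_def c_def split: option.splits)
    qed (use T in auto)
    also have "(\<Sum>i\<in>insert None (Some ` T). c i * \<mu> (E i)) = (\<Sum>s\<in>T. \<mu> (E (Some s)) * f s)"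
      using T(1) by (simp add: sum.reindex c_def mult.commute)
    also have "(\<Sum>i\<in>insert None (Some ` T). b i * jordan_variation \<mu> (E i)) =
        B * jordan_variation \<mu> (E None) + d * (\<Sum>i\<in>Some ` T. jordan_variation \<mu> (E i))"
      using T(1) by (simp add: sum.reindex b_def sum_distrib_left)
    also have "(\<Sum>i\<in>Some ` T. jordan_variation \<mu> (E i)) = jordan_variation \<mu> (\<Union>i\<in>Some ` T. E i)"
      using T(1) E(1,3) by (intro jordan_variation_finite_Union[OF \<mu>]) (auto simp: disjoint_family_on_def)
    also have "B * jordan_variation \<mu> (E None) + d * jordan_variation \<mu> (\<Union>i\<in>Some ` T. E i) \<le>
        B * e + d * jordan_variation \<mu> UNIV"
    proof (intro add_mono mult_left_mono B d)
      have "jordan_variation \<mu> (E None) \<le> jordan_variation \<mu> (- K)"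
        using E(1,2)[of None] Kb by (intro jordan_variation_mono[OF \<mu>]) (auto simp: A_def)
      with K(2) show "jordan_variation \<mu> (E None) \<le> e" by simp
      show "jordan_variation \<mu> (\<Union>i\<in>Some ` T. E i) \<le> jordan_variation \<mu> UNIV"
        using E(1) T(1) by (intro jordan_variation_mono[OF \<mu>]) auto
    qed
    finally show "cmod (complex_integral \<mu> f - (\<Sum>s\<in>T. \<mu> (E (Some s)) * f s)) \<le> d * jordan_variation \<mu> UNIV + B * e"
      by (simp add: add.commute)
  qed
qed

lemma LUC_sum:
  assumes G: "G_space X act" and "finite T" "\<And>s. s \<in> T \<Longrightarrow> F s \<in> LUC X act"
  shows "(\<lambda>x\<in>topspace X. \<Sum>s\<in>T. w s * F s x) \<in> LUC X act"
  using assms(2,3)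
proof (induction T rule: finite_induct)
  case empty
  show ?case unfolding sum.empty by (rule LUC_zero[OF G])
next
  case (insert a T)
  have eq: "(\<lambda>x\<in>topspace X. \<Sum>s\<in>insert a T. w s * F s x) =
      (\<lambda>x\<in>topspace X. w a * F a x + 1 * (\<lambda>x\<in>topspace X. \<Sum>s\<in>T. w s * F s x) x)"
    using insert.hyps by (auto simp: restrict_def fun_eq_iff)
  show ?case unfolding eq using insert by (intro LUC_lincomb G) auto
qed

lemma cdual_sum:
  assumes G: "G_space X act" and M: "M \<in> cdual X (LUC X act)"
    and "finite T" "\<And>s. s \<in> T \<Longrightarrow> F s \<in> LUC X act"
  shows "M (\<lambda>x\<in>topspace X. \<Sum>s\<in>T. w s * F s x) = (\<Sum>s\<in>T. w s * M (F s))"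
  using assms(3,4)
proof (induction T rule: finite_induct)
  case empty
  have "M (\<lambda>x\<in>topspace X. 0) = 0"
    using cdual_lin[OF M LUC_zero[OF G] LUC_zero[OF G], of 0 0] by (simp cong: restrict_cong)
  then show ?case unfolding sum.empty .
next
  case (insert a T)
  have eq: "(\<lambda>x\<in>topspace X. \<Sum>s\<in>insert a T. w s * F s x) =
      (\<lambda>x\<in>topspace X. w a * F a x + 1 * (\<lambda>x\<in>topspace X. \<Sum>s\<in>T. w s * F s x) x)"
    using insert.hyps by (auto simp: restrict_def fun_eq_iff)
  have "M (\<lambda>x\<in>topspace X. \<Sum>s\<in>insert a T. w s * F s x) =
      M (\<lambda>x\<in>topspace X. w a * F a x + 1 * (\<lambda>x\<in>topspace X. \<Sum>s\<in>T. w s * F s x) x)"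
    by (rule arg_cong[OF eq])
  also have "\<dots> = w a * M (F a) + 1 * M (\<lambda>x\<in>topspace X. \<Sum>s\<in>T. w s * F s x)"
    using insert by (intro cdual_lin[OF M] LUC_sum G) auto
  also have "M (\<lambda>x\<in>topspace X. \<Sum>s\<in>T. w s * F s x) = (\<Sum>s\<in>T. w s * M (F s))"
    using insert by blast
  also have "w a * M (F a) + 1 * (\<Sum>s\<in>T. w s * M (F s)) = (\<Sum>s\<in>insert a T. w s * M (F s))"
    using insert.hyps by simp
  finally show ?case .
qed

section \<open>Measures on the group and averages of translates\<close>

context
  assumes lc: "locally_compact_space (euclidean :: 'g::{topological_group_add, t2_space} topology)"
begin

lemma LUC_group_borel: "f \<in> (LUC_group :: ('g \<Rightarrow> complex) set) \<Longrightarrow> f \<in> borel_measurable borel"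
  by (intro borel_measurable_continuous_onI LUC_group_continuous[OF lc])

definition measure_functional :: "('g set \<Rightarrow> complex) \<Rightarrow> ('g \<Rightarrow> complex) \<Rightarrow> complex"
  where "measure_functional \<mu> = (\<lambda>f\<in>LUC_group. complex_integral \<mu> f)"

lemma measure_functional_cdual:
  assumes \<mu>: "complex_borel_measure \<mu>"
  shows "measure_functional \<mu> \<in> cdual euclidean LUC_group"
proof (rule cdualI[where C = "jordan_variation \<mu> UNIV"])
  show "measure_functional \<mu> \<in> extensional LUC_group" by (simp add: measure_functional_def)
  show "LUC_group \<subseteq> mspace (Cb (euclidean :: 'g topology))" using LUC_Cb by blast
next
  fix a b and f g :: "'g \<Rightarrow> complex" assume f: "f \<in> LUC_group" and g: "g \<in> LUC_group"
  obtain B where B: "\<And>x. cmod (f x) \<le> B" using LUC_bound[OF f] by auto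
  obtain C where C: "\<And>x. cmod (g x) \<le> C" using LUC_bound[OF g] by auto
  show "measure_functional \<mu> (\<lambda>x\<in>topspace euclidean. a * f x + b * g x) =
      a * measure_functional \<mu> f + b * measure_functional \<mu> g"
    using complex_integral_lincomb[OF \<mu> LUC_group_borel[OF f] B LUC_group_borel[OF g] C]
    by (simp add: measure_functional_def f g LUC_group_lincomb[OF lc] restrict_UNIV)
next
  fix f :: "'g \<Rightarrow> complex" and B assume f: "f \<in> LUC_group" "\<And>x. x \<in> topspace euclidean \<Longrightarrow> cmod (f x) \<le> B"
  then show "cmod (measure_functional \<mu> f) \<le> jordan_variation \<mu> UNIV * B"
    using complex_integral_bound[OF \<mu> LUC_group_borel[OF f(1)], of B]
    by (simp add: measure_functional_def mult.commute)
qed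

text \<open>Multiplying \<open>f\<close> by a cut-off that is 1 on a compact set carrying almost all
  of the measure changes the integral by at most \<open>B\<close> times the small remaining
  mass.\<close>

lemma measure_functional_zero_if_Cc:
  assumes reg: "regular_complex_measure \<mu>" and zero: "\<And>f. f \<in> Cc \<Longrightarrow> complex_integral \<mu> f = 0"
    and f: "f \<in> (LUC_group :: ('g \<Rightarrow> complex) set)"
  shows "complex_integral \<mu> f = 0"
proof -
  have \<mu>: "complex_borel_measure \<mu>" using reg by (simp add: regular_complex_measure_def)
  obtain B where B: "0 \<le> B" "\<And>x. cmod (f x) \<le> B" using LUC_bound[OF f] by auto
  have "cmod (complex_integral \<mu> f) \<le> 0 + d" if d: "0 < d" for d
  proof -
    have "0 < d / (B + 1)" using d B(1) by simp
    from regular_complex_measure_tight[OF reg this]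
    obtain K where K: "compact K" "jordan_variation \<mu> (- K) \<le> d / (B + 1)" by blast
    obtain h :: "'g \<Rightarrow> real" and C where h: "continuous_on UNIV h" "\<And>x. 0 \<le> h x" "\<And>x. h x \<le> 1"
      "\<And>x. x \<in> K \<Longrightarrow> h x = 1" "compact C" "\<And>x. x \<notin> C \<Longrightarrow> h x = 0"
      by (rule Urysohn_compact[OF lc K(1), of UNIV]) auto
    have "(\<lambda>x. of_real (h x) :: complex) \<in> Cc"
      by (rule CcI[OF _ h(5)]) (auto intro!: continuous_intros h(1) simp: h(6))
    from Cc_mult[OF this LUC_group_continuous[OF lc f]]
    have fh: "(\<lambda>x. f x * of_real (h x)) \<in> Cc" .
    have fhb: "(\<lambda>x. f x * of_real (h x)) \<in> LUC_group" using fh Cc_subset_LUC[OF lc] by blast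
    have Bh: "cmod (f x * of_real (h x)) \<le> B" for x
      using mult_mono[OF B(2) h(3) B(1) h(2)] h(2)[of x] by (simp add: norm_mult)
    have Bh': "cmod (f x - f x * of_real (h x)) \<le> B" for x
    proof -
      have "f x - f x * of_real (h x) = f x * of_real (1 - h x)" by (simp add: algebra_simps)
      then have "cmod (f x - f x * of_real (h x)) = cmod (f x) * (1 - h x)"
        using h(3)[of x] by (simp only: norm_mult norm_of_real)
      also have "\<dots> \<le> B * 1" using B(1,2) h(2,3)[of x] by (intro mult_mono) auto
      finally show ?thesis by simp
    qed
    have "complex_integral \<mu> (\<lambda>x. 1 * f x + (-1) * (f x * of_real (h x))) =
        1 * complex_integral \<mu> f + (-1) * complex_integral \<mu> (\<lambda>x. f x * of_real (h x))"
      by (rule complex_integral_lincomb[OF \<mu> LUC_group_borel[OF f] B(2) LUC_group_borel[OF fhb] Bh])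
    then have "complex_integral \<mu> f = complex_integral \<mu> (\<lambda>x. f x - f x * of_real (h x))"
      using zero[OF fh] by simp
    also have "cmod \<dots> \<le> 0 * jordan_variation \<mu> K + B * jordan_variation \<mu> (- K)"
      using LUC_group_borel[OF f] LUC_group_borel[OF fhb] h(4) K(1)
      by (intro complex_integral_bound2[OF \<mu> _ Bh'] compact_borel) auto
    also have "\<dots> \<le> B * (d / (B + 1))" using mult_left_mono[OF K(2) B(1)] by simp
    also have "\<dots> \<le> d" using B(1) d by (simp add: field_simps)
    finally show ?thesis by simp
  qed
  then have "cmod (complex_integral \<mu> f) \<le> 0" by (rule field_le_epsilon)
  then show ?thesis by simp
qed

text \<open>Riemann sums over a tight partition give \<open>M (\<integral> l\<^sub>s F d\<mu>(s)) = \<integral> M (l\<^sub>s F) d\<mu>(s)\<close>.\<close>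

lemma measure_average:
  fixes act :: "'g \<Rightarrow> 'x \<Rightarrow> 'x"
  assumes G: "G_space X act" and reg: "regular_complex_measure \<mu>" and F: "F \<in> LUC X act"
  obtains H where "H \<in> LUC X act"
    "\<And>M. M \<in> cdual X (LUC X act) \<Longrightarrow> complex_integral \<mu> (fun_act X act M F) = M H"
proof -
  have \<mu>: "complex_borel_measure \<mu>" using reg by (simp add: regular_complex_measure_def)
  obtain B where B: "0 \<le> B" "\<And>x. x \<in> topspace X \<Longrightarrow> cmod (F x) \<le> B" using LUC_bound[OF F] by metis
  let ?J = "jordan_variation \<mu> UNIV"
  have J: "0 \<le> ?J" by (rule jordan_variation_nonneg[OF \<mu>])
  define H where "H = (\<lambda>x\<in>topspace X. complex_integral \<mu> (\<lambda>s. F (act s x)))"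
  have ev: "(\<lambda>F\<in>LUC X act. F x) \<in> cdual X (LUC X act)" if "x \<in> topspace X" for x
  proof (rule cdualI[where C = 1])
    show "LUC X act \<subseteq> mspace (Cb X)" using LUC_Cb by blast
  qed (use that LUC_lincomb[OF G] in auto)
  have Fx: "(\<lambda>s. F (act s x)) \<in> LUC_group" if x: "x \<in> topspace X" for x
    using fun_act_LUC[OF lc G ev[OF x] F] LUC_ltrans[OF G F] x by (simp add: fun_act_def)
  \<comment> \<open>\<open>\<Phi>\<close> is chosen before \<open>M\<close>: the same Riemann sum of
    translates approximates \<open>H\<close> uniformly and, up to the factor \<open>C\<close>, the
    average seen by any \<open>M\<close>.\<close>
  have approx: "\<exists>\<Phi>\<in>LUC X act. (\<forall>x\<in>topspace X. cmod (H x - \<Phi> x) \<le> d) \<and>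
      (\<forall>M C. M \<in> cdual X (LUC X act) \<longrightarrow> 0 \<le> C \<longrightarrow> (\<forall>F B. F \<in> LUC X act \<longrightarrow> 0 \<le> B \<longrightarrow>
        (\<forall>x\<in>topspace X. cmod (F x) \<le> B) \<longrightarrow> cmod (M F) \<le> C * B) \<longrightarrow>
        cmod (complex_integral \<mu> (fun_act X act M F) - M \<Phi>) \<le> C * d)" if d: "0 < d" for d
  proof -
    \<comment> \<open>\<open>e1\<close> is the oscillation allowed on a cell, weighed against the
      total mass; \<open>e2\<close> is the mass allowed in the tail, weighed against the bound of
      \<open>F\<close>.\<close>
    define e1 where "e1 = d / (2 * (?J + 1))"
    define e2 where "e2 = d / (2 * (B + 1))"
    have e1: "0 < e1" "e1 * ?J \<le> d/2" using d J by (auto simp: e1_def field_simps)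
    have e2: "0 < e2" "B * e2 \<le> d/2" using d B(1) by (auto simp: e2_def field_simps)
    obtain V where V: "open V" "0 \<in> V" "\<And>t x. t \<in> V \<Longrightarrow> x \<in> topspace X \<Longrightarrow> cmod (F (act t x) - F x) \<le> e1"
      using LUC_small[OF G F e1(1)] unfolding eventually_nhds by blast
    define U where "U s = (\<lambda>r. r - s) -` V" for s
    have U: "open (U s)" "s \<in> U s" for s
      unfolding U_def using V(1,2)
      by (auto intro!: open_vimage continuous_on_diff continuous_on_id continuous_on_const)
    have FU: "cmod (F (act r x) - F (act s x)) \<le> e1" if "r \<in> U s" "x \<in> topspace X" for r s x
      using V(3)[of "r - s" "act s x"] that G_space_act_in[OF G that(2)]
        G_space_act_add[OF G that(2), of "r - s" s] by (simp add: U_def)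
    obtain T w where T: "finite T" and w: "\<And>f B d. f \<in> borel_measurable borel \<Longrightarrow> (\<And>x. cmod (f x) \<le> B) \<Longrightarrow> 0 \<le> d \<Longrightarrow>
        (\<And>s r. r \<in> U s \<Longrightarrow> cmod (f r - f s) \<le> d) \<Longrightarrow>
        cmod (complex_integral \<mu> f - (\<Sum>s\<in>T. w s * f s)) \<le> d * ?J + B * e2"
      by (rule tight_riemann_sum[OF reg U e2(1)]) blast
    define \<Phi> where "\<Phi> = (\<lambda>x\<in>topspace X. \<Sum>s\<in>T. w s * ltrans X act s F x)"
    have \<Phi>: "\<Phi> \<in> LUC X act" unfolding \<Phi>_def by (intro LUC_sum G T LUC_ltrans F)
    have 1: "cmod (H x - \<Phi> x) \<le> d" if x: "x \<in> topspace X" for x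
    proof -
      have "cmod (complex_integral \<mu> (\<lambda>s. F (act s x)) - (\<Sum>s\<in>T. w s * F (act s x))) \<le> e1 * ?J + B * e2"
        using x e1(1) by (intro w LUC_group_borel Fx FU B G_space_act_in[OF G]) auto
      then show ?thesis using x e1(2) e2(2) by (simp add: H_def \<Phi>_def)
    qed
    have 2: "cmod (complex_integral \<mu> (fun_act X act M F) - M \<Phi>) \<le> C * d"
      if M: "M \<in> cdual X (LUC X act)" and C: "0 \<le> C" "\<And>F B. F \<in> LUC X act \<Longrightarrow> 0 \<le> B \<Longrightarrow>
        (\<forall>x\<in>topspace X. cmod (F x) \<le> B) \<Longrightarrow> cmod (M F) \<le> C * B" for M C
    proof -
      have "cmod (fun_act X act M F r - fun_act X act M F s) \<le> C * e1" if "r \<in> U s" for r s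
      proof -
        let ?D = "\<lambda>x\<in>topspace X. 1 * ltrans X act r F x + (-1) * ltrans X act s F x"
        have "?D \<in> LUC X act" by (intro LUC_lincomb G LUC_ltrans F)
        then have "cmod (M ?D) \<le> C * e1" using FU[OF that] e1(1) by (intro C(2)) auto
        also have "M ?D = 1 * M (ltrans X act r F) + (-1) * M (ltrans X act s F)"
          by (intro cdual_lin[OF M] LUC_ltrans G F)
        finally show ?thesis by (simp add: fun_act_def)
      qed
      moreover have "cmod (fun_act X act M F s) \<le> C * B" for s
        unfolding fun_act_def using B G_space_act_in[OF G] by (intro C(2) LUC_ltrans G F) auto
      ultimately have "cmod (complex_integral \<mu> (fun_act X act M F) - (\<Sum>s\<in>T. w s * fun_act X act M F s)) \<le> (C * e1) * ?J + (C * B) * e2"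
        using C(1) e1(1) by (intro w LUC_group_borel fun_act_LUC[OF lc G M F]) auto
      also have "(\<Sum>s\<in>T. w s * fun_act X act M F s) = M \<Phi>"
        unfolding \<Phi>_def fun_act_def by (intro cdual_sum[OF G M T, symmetric] LUC_ltrans G F)
      also have "(C * e1) * ?J + (C * B) * e2 = C * (e1 * ?J + B * e2)" by (simp add: algebra_simps)
      also have "\<dots> \<le> C * d" using e1(2) e2(2) C(1) by (intro mult_left_mono) auto
      finally show ?thesis .
    qed
    show ?thesis using \<Phi> 1 2 by (intro bexI[of _ \<Phi>]) auto
  qed
  have H: "H \<in> LUC X act"
  proof (rule LUC_uniform_limit[OF G])
    show "H \<in> extensional (topspace X)" by (simp add: H_def)
    show "\<exists>\<Phi>\<in>LUC X act. \<forall>x\<in>topspace X. cmod (H x - \<Phi> x) \<le> e" if "0 < e" for e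
      using approx[OF that] by blast
  qed
  show ?thesis
  proof (rule that[OF H])
    fix M assume M: "M \<in> cdual X (LUC X act)"
    obtain C where C: "0 \<le> C" "\<And>F B. F \<in> LUC X act \<Longrightarrow> 0 \<le> B \<Longrightarrow>
        (\<And>x. x \<in> topspace X \<Longrightarrow> cmod (F x) \<le> B) \<Longrightarrow> cmod (M F) \<le> C * B"
      using cdual_bound[OF M] by metis
    have "cmod (complex_integral \<mu> (fun_act X act M F) - M H) \<le> 0 + d" if d: "0 < d" for d
    proof -
      define d' where "d' = d / (2 * (C + 1))"
      have d': "0 < d'" "C * d' \<le> d/2" using d C(1) by (auto simp: d'_def field_simps)
      obtain \<Phi> where \<Phi>: "\<Phi> \<in> LUC X act" "\<And>x. x \<in> topspace X \<Longrightarrow> cmod (H x - \<Phi> x) \<le> d'"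
        "cmod (complex_integral \<mu> (fun_act X act M F) - M \<Phi>) \<le> C * d'"
        using approx[OF d'(1)] M C by blast
      let ?D = "\<lambda>x\<in>topspace X. 1 * H x + (-1) * \<Phi> x"
      have "?D \<in> LUC X act" by (intro LUC_lincomb G H \<Phi>)
      then have "cmod (M ?D) \<le> C * d'" using \<Phi>(2) d'(1) by (intro C(2)) auto
      also have "M ?D = 1 * M H + (-1) * M \<Phi>" by (intro cdual_lin[OF M] H \<Phi>)
      finally have "cmod (M H - M \<Phi>) \<le> C * d'" by simp
      then have "cmod ((complex_integral \<mu> (fun_act X act M F) - M \<Phi>) - (M H - M \<Phi>)) \<le> C * d' + C * d'"
        using \<Phi>(3) norm_triangle_ineq4[of "complex_integral \<mu> (fun_act X act M F) - M \<Phi>" "M H - M \<Phi>"]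
        by linarith
      then show ?thesis using d'(2) by simp
    qed
    then have "cmod (complex_integral \<mu> (fun_act X act M F) - M H) \<le> 0" by (rule field_le_epsilon)
    then show "complex_integral \<mu> (fun_act X act M F) = M H" by simp
  qed
qed

text \<open>Weak-star continuity is tested at each \<open>F\<close> separately, where the map is
  evaluation at the average of the translates of \<open>F\<close>.\<close>

lemma measure_functional_Zcenter:
  fixes act :: "'g \<Rightarrow> 'x \<Rightarrow> 'x"
  assumes G: "G_space X act" and reg: "regular_complex_measure \<mu>"
  shows "measure_functional \<mu> \<in> Zcenter X act"
proof -
  have \<mu>: "complex_borel_measure \<mu>" using reg by (simp add: regular_complex_measure_def)
  note m = measure_functional_cdual[OF \<mu>]
  let ?V = "LUC X act"
  have top: "topspace (weak_star X ?V) = cdual X ?V"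
    by (auto simp: weak_star_def cdual_def PiE_def)
  have "continuous_map (weak_star X ?V) euclidean (\<lambda>M. dual_act X act (measure_functional \<mu>) M F)"
    if F: "F \<in> ?V" for F
  proof -
    obtain H where H: "H \<in> ?V" "\<And>M. M \<in> cdual X ?V \<Longrightarrow> complex_integral \<mu> (fun_act X act M F) = M H"
      using measure_average[OF G reg F] by blast
    have "continuous_map (weak_star X ?V) euclidean (\<lambda>M. M H)"
      unfolding weak_star_def using H(1)
      by (intro continuous_map_from_subtopology continuous_map_product_projection)
    then show ?thesis
    proof (rule continuous_map_eq)
      fix M assume "M \<in> topspace (weak_star X ?V)"
      then have M: "M \<in> cdual X ?V" by (simp add: top)
      then show "M H = dual_act X act (measure_functional \<mu>) M F"
        using H(2)[OF M] fun_act_LUC[OF lc G M F] by (simp add: dual_act_def F measure_functional_def)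
    qed
  qed
  then have "continuous_map (weak_star X ?V) (product_topology (\<lambda>_. euclidean) ?V) (dual_act X act (measure_functional \<mu>))"
    by (simp add: continuous_map_componentwise image_subset_iff dual_act_def)
  then show ?thesis
    using m dual_act_cdual[OF lc G m] unfolding Zcenter_def weak_star_def[of X ?V]
    by (auto simp: continuous_map_in_subtopology top[unfolded weak_star_def])
qed

end

section \<open>The Riesz representation theorem\<close>

definition CcP :: "('a::topological_space \<Rightarrow> real) set"
  where "CcP = {f. continuous_on UNIV f \<and> (\<forall>x. 0 \<le> f x) \<and> (\<exists>K. compact K \<and> (\<forall>x. x \<notin> K \<longrightarrow> f x = 0))}"

lemma CcP_I:
  "continuous_on UNIV f \<Longrightarrow> (\<And>x. 0 \<le> f x) \<Longrightarrow> compact K \<Longrightarrow> (\<And>x. x \<notin> K \<Longrightarrow> f x = 0) \<Longrightarrow> f \<in> CcP"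
  by (auto simp: CcP_def)

lemma CcP_nonneg: "f \<in> CcP \<Longrightarrow> 0 \<le> f x"
  by (simp add: CcP_def)

lemma CcP_continuous: "f \<in> CcP \<Longrightarrow> continuous_on UNIV f"
  by (simp add: CcP_def)

text \<open>\<open>g\<close> inherits a compact support through the zeros of
  \<open>f\<close>.\<close>

lemma CcP_dominated:
  assumes f: "f \<in> CcP" and g: "continuous_on UNIV g" "\<And>x. 0 \<le> g x" "\<And>x. f x = 0 \<Longrightarrow> g x = 0"
  shows "g \<in> CcP"
proof -
  obtain K where "compact K" "\<forall>x. x \<notin> K \<longrightarrow> f x = 0" using f by (auto simp: CcP_def)
  then show ?thesis by (intro CcP_I[of g K]) (auto intro: g)
qed

lemma CcP_add:
  assumes f: "f \<in> CcP" and g: "g \<in> CcP"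
  shows "(\<lambda>x. f x + g x) \<in> CcP"
proof -
  obtain K where K: "compact K" "\<forall>x. x \<notin> K \<longrightarrow> f x = 0" using f by (auto simp: CcP_def)
  obtain L where L: "compact L" "\<forall>x. x \<notin> L \<longrightarrow> g x = 0" using g by (auto simp: CcP_def)
  show ?thesis
    by (rule CcP_I[of _ "K \<union> L"])
      (use K L f g in \<open>auto intro!: continuous_intros CcP_continuous[OF f] CcP_continuous[OF g]
        add_nonneg_nonneg CcP_nonneg[OF f] CcP_nonneg[OF g]\<close>)
qed

lemma CcP_scale:
  assumes "f \<in> CcP" "0 \<le> c"
  shows "(\<lambda>x. c * f x) \<in> CcP"
  by (rule CcP_dominated[OF assms(1)])
    (use assms in \<open>auto intro!: continuous_intros CcP_continuous[OF assms(1)] simp: CcP_nonneg\<close>)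

lemma CcP_bounded:
  assumes "f \<in> CcP"
  obtains B where "0 < B" "\<And>x. f x \<le> B"
proof -
  have "(\<lambda>x. of_real (f x)) \<in> Cc"
    using assms by (auto simp: CcP_def intro!: CcI continuous_intros)
  then obtain B where B: "0 \<le> B" "\<And>x. cmod (of_real (f x)) \<le> B" by (rule Cc_bounded) blast
  have "f x \<le> B + 1" for x using B(2)[of x] by simp
  with B(1) show ?thesis using that[of "B + 1"] by simp
qed

text \<open>The sets where a separating function exceeds 1/2 and where it is at least 1/2.\<close>

lemma compact_between:
  fixes K U :: "'a::t2_space set"
  assumes lc: "locally_compact_space (euclidean :: 'a topology)"
    and K: "compact K" and U: "open U" "K \<subseteq> U"
  obtains V L where "open V" "compact L" "K \<subseteq> V" "V \<subseteq> L" "L \<subseteq> U"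
proof -
  obtain f :: "'a \<Rightarrow> real" and C where f: "continuous_on UNIV f" "\<And>x. x \<in> K \<Longrightarrow> f x = 1"
    "compact C" "C \<subseteq> U" "\<And>x. x \<notin> C \<Longrightarrow> f x = 0"
    using Urysohn_compact[OF lc K U] by metis
  have L: "{x. 1/2 \<le> f x} \<subseteq> C" using f(5) by (auto intro: ccontr)
  have "closed {x. 1/2 \<le> f x}" by (intro closed_Collect_le f(1) continuous_intros)
  then have "compact {x. 1/2 \<le> f x}" using compact_Int_closed[OF f(3)] L by (metis Int_absorb1)
  moreover have "open {x. 1/2 < f x}" by (intro open_Collect_less f(1) continuous_intros)
  ultimately show ?thesis
    using L f(2,4) by (intro that[of "{x. 1/2 < f x}" "{x. 1/2 \<le> f x}"]) auto
qed

text \<open>Inner and outer regularity are merged into one small gap, so that the sets found for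
  several measures combine by uniting the \<open>K\<close> and intersecting the
  \<open>U\<close>.\<close>

definition regular_finite :: "'a::topological_space measure \<Rightarrow> bool"
  where "regular_finite M \<longleftrightarrow> finite_measure M \<and> sets M = sets borel \<and>
    (\<forall>E\<in>sets borel. \<forall>e>0. \<exists>K U. compact K \<and> open U \<and> K \<subseteq> E \<and> E \<subseteq> U \<and> measure M (U - K) \<le> e)"

section \<open>The measure of a positive functional\<close>

context
  fixes p :: "('a::t2_space \<Rightarrow> real) \<Rightarrow> real" and C :: real
  assumes lc: "locally_compact_space (euclidean :: 'a topology)"
    and p_add: "\<And>f g. f \<in> CcP \<Longrightarrow> g \<in> CcP \<Longrightarrow> p (\<lambda>x. f x + g x) = p f + p g"
    and p_scale: "\<And>c f. f \<in> CcP \<Longrightarrow> 0 \<le> c \<Longrightarrow> p (\<lambda>x. c * f x) = c * p f"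
    and p_nonneg: "\<And>f. f \<in> CcP \<Longrightarrow> 0 \<le> p f"
    and p_bound: "\<And>f. f \<in> CcP \<Longrightarrow> (\<And>x. f x \<le> 1) \<Longrightarrow> p f \<le> C"
begin

lemma zero_CcP: "(\<lambda>x::'a. 0) \<in> CcP"
  by (rule CcP_I[of _ "{}"]) auto

lemma p_zero: "p (\<lambda>x. 0) = 0"
  using p_scale[OF zero_CcP, of 0] by simp

lemma p_diff:
  assumes "f \<in> CcP" "g \<in> CcP" "\<And>x. f x \<le> g x"
  shows "(\<lambda>x. g x - f x) \<in> CcP" "p g = p f + p (\<lambda>x. g x - f x)"
proof -
  show d: "(\<lambda>x. g x - f x) \<in> CcP"
  proof (rule CcP_dominated[OF assms(2)])
    show "g x - f x = 0" if "g x = 0" for x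
      using that assms(3)[of x] CcP_nonneg[OF assms(1), of x] by simp
  qed (use assms in \<open>auto intro!: continuous_intros CcP_continuous[OF assms(1)] CcP_continuous[OF assms(2)]\<close>)
  show "p g = p f + p (\<lambda>x. g x - f x)" using p_add[OF assms(1) d] by simp
qed

lemma p_mono: "f \<in> CcP \<Longrightarrow> g \<in> CcP \<Longrightarrow> (\<And>x. f x \<le> g x) \<Longrightarrow> p f \<le> p g"
  using p_diff[of f g] p_nonneg[of "\<lambda>x. g x - f x"] by simp

text \<open>The relation usually written \<open>f \<prec> U\<close> in proofs of the Riesz theorem.
  The compact set lies inside \<open>U\<close>, which is stronger than vanishing off
  \<open>U\<close>.\<close>

definition admissible :: "'a set \<Rightarrow> ('a \<Rightarrow> real) set"
  where "admissible U = {f \<in> CcP. (\<forall>x. f x \<le> 1) \<and> (\<exists>K. compact K \<and> K \<subseteq> U \<and> (\<forall>x. x \<notin> K \<longrightarrow> f x = 0))}"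

lemma admissibleI:
  "continuous_on UNIV f \<Longrightarrow> (\<And>x. 0 \<le> f x) \<Longrightarrow> (\<And>x. f x \<le> 1) \<Longrightarrow> compact K \<Longrightarrow> K \<subseteq> U \<Longrightarrow>
    (\<And>x. x \<notin> K \<Longrightarrow> f x = 0) \<Longrightarrow> f \<in> admissible U"
  by (auto simp: admissible_def CcP_def)

lemma admissible_CcP: "f \<in> admissible U \<Longrightarrow> f \<in> CcP"
  by (simp add: admissible_def)

definition open_content :: "'a set \<Rightarrow> ennreal"
  where "open_content U = (SUP f\<in>admissible U. ennreal (p f))"

lemma open_content_upper: "f \<in> admissible U \<Longrightarrow> ennreal (p f) \<le> open_content U"
  unfolding open_content_def by (rule SUP_upper)

lemma open_content_least: "(\<And>f. f \<in> admissible U \<Longrightarrow> ennreal (p f) \<le> c) \<Longrightarrow> open_content U \<le> c"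
  unfolding open_content_def by (rule SUP_least)

lemma open_content_mono: "U \<subseteq> V \<Longrightarrow> open_content U \<le> open_content V"
  by (intro open_content_least open_content_upper) (auto simp: admissible_def)

lemma open_content_le: "open_content U \<le> ennreal C"
  by (intro open_content_least ennreal_leI p_bound) (auto simp: admissible_def)

lemma open_content_empty: "open_content {} = 0"
proof -
  have "f = (\<lambda>x. 0)" if "f \<in> admissible {}" for f using that by (auto simp: admissible_def)
  then have "open_content {} \<le> 0" by (intro open_content_least) (metis p_zero ennreal_0 order_refl)
  then show ?thesis by simp
qed

lemma open_content_Un:
  assumes U: "open U" and V: "open V"
  shows "open_content (U \<union> V) \<le> open_content U + open_content V"
proof (rule open_content_least)
  fix f assume f: "f \<in> admissible (U \<union> V)"
  then obtain K where K: "compact K" "K \<subseteq> U \<union> V" "\<And>x. x \<notin> K \<Longrightarrow> f x = 0" and f1: "\<And>x. f x \<le> 1"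
    by (auto simp: admissible_def)
  have f0: "0 \<le> f x" for x by (rule CcP_nonneg[OF admissible_CcP[OF f]])
  have fc: "continuous_on UNIV f" by (rule CcP_continuous[OF admissible_CcP[OF f]])
  have "compact (K - V)" using K(1) V by (rule compact_diff)
  moreover have "K - V \<subseteq> U" using K(2) by auto
  \<comment> \<open>The cut-off \<open>h\<close> must be 1 on a whole neighbourhood \<open>W\<close>
    of \<open>K - V\<close>: then \<open>f * (1 - h)\<close> vanishes off the compact set
    \<open>K - W\<close>, which lies in \<open>V\<close>.\<close>
  ultimately obtain W L where W: "open W" "compact L" "K - V \<subseteq> W" "W \<subseteq> L" "L \<subseteq> U"
    using compact_between[OF lc _ U] by metis
  obtain h :: "'a \<Rightarrow> real" and D where h: "continuous_on UNIV h" "\<And>x. 0 \<le> h x" "\<And>x. h x \<le> 1"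
    "\<And>x. x \<in> L \<Longrightarrow> h x = 1" "compact D" "D \<subseteq> U" "\<And>x. x \<notin> D \<Longrightarrow> h x = 0"
    using Urysohn_compact[OF lc W(2) U W(5)] by metis
  have 1: "(\<lambda>x. f x * h x) \<in> admissible U"
    by (rule admissibleI[OF _ _ _ h(5,6)])
      (use f0 f1 h in \<open>auto intro!: continuous_intros fc h(1) mult_le_one simp: mult_nonneg_nonneg\<close>)
  have 2: "(\<lambda>x. f x * (1 - h x)) \<in> admissible V"
  proof (rule admissibleI[of _ "K - W"])
    show "compact (K - W)" using K(1) W(1) by (rule compact_diff)
    show "K - W \<subseteq> V" using W(3) by auto
    show "f x * (1 - h x) = 0" if "x \<notin> K - W" for x
      using that K(3) h(4) W(4) by auto
    show "f x * (1 - h x) \<le> 1" for x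
      using mult_le_one[of "f x" "1 - h x"] f0[of x] f1[of x] h(2,3)[of x] by simp
  qed (use f0 h in \<open>auto intro!: continuous_intros fc h(1)\<close>)
  have "f = (\<lambda>x. f x * h x + f x * (1 - h x))" by (simp add: algebra_simps)
  then have "p f = p (\<lambda>x. f x * h x) + p (\<lambda>x. f x * (1 - h x))"
    using p_add[OF admissible_CcP[OF 1] admissible_CcP[OF 2]] by simp
  then have "ennreal (p f) = ennreal (p (\<lambda>x. f x * h x)) + ennreal (p (\<lambda>x. f x * (1 - h x)))"
    using p_nonneg[OF admissible_CcP[OF 1]] p_nonneg[OF admissible_CcP[OF 2]] by simp
  also have "\<dots> \<le> open_content U + open_content V" by (intro add_mono open_content_upper 1 2)
  finally show "ennreal (p f) \<le> open_content U + open_content V" .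
qed

text \<open>An admissible function lives on a compact set, which finitely many of the
  \<open>U n\<close> already cover.\<close>

lemma open_content_UN:
  fixes U :: "nat \<Rightarrow> 'a set"
  assumes U: "\<And>n. open (U n)"
  shows "open_content (\<Union>n. U n) \<le> (\<Sum>n. open_content (U n))"
proof (rule open_content_least)
  have fin: "open_content (\<Union>n<N. U n) \<le> (\<Sum>n<N. open_content (U n))" for N
  proof (induction N)
    case (Suc N)
    have "open_content (\<Union>n<Suc N. U n) = open_content ((\<Union>n<N. U n) \<union> U N)" by (simp add: lessThan_Suc Un_commute)
    also have "\<dots> \<le> open_content (\<Union>n<N. U n) + open_content (U N)" using U by (intro open_content_Un) auto
    also have "\<dots> \<le> (\<Sum>n<N. open_content (U n)) + open_content (U N)" by (intro add_right_mono Suc)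
    finally show ?case by simp
  qed (simp add: open_content_empty)
  fix f assume f: "f \<in> admissible (\<Union>n. U n)"
  then obtain K where K: "compact K" "K \<subseteq> (\<Union>n. U n)" "\<And>x. x \<notin> K \<Longrightarrow> f x = 0"
    by (auto simp: admissible_def)
  obtain I where I: "finite I" "K \<subseteq> (\<Union>n\<in>I. U n)"
    by (rule compactE_image[OF K(1) _ K(2)]) (use U in auto)
  obtain N where "I \<subseteq> {..<N}" using I(1) finite_nat_iff_bounded by blast
  then have "K \<subseteq> (\<Union>n<N. U n)" using I(2) by blast
  with f K have "f \<in> admissible (\<Union>n<N. U n)" by (auto simp: admissible_def)
  then have "ennreal (p f) \<le> open_content (\<Union>n<N. U n)" by (rule open_content_upper)
  also note fin
  also have "(\<Sum>n<N. open_content (U n)) \<le> (\<Sum>n. open_content (U n))" by (intro sum_le_suminf) auto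
  finally show "ennreal (p f) \<le> (\<Sum>n. open_content (U n))" .
qed

definition riesz_outer :: "'a set \<Rightarrow> ennreal"
  where "riesz_outer E = (INF U\<in>{U. open U \<and> E \<subseteq> U}. open_content U)"

lemma riesz_outer_lower: "open U \<Longrightarrow> E \<subseteq> U \<Longrightarrow> riesz_outer E \<le> open_content U"
  unfolding riesz_outer_def by (rule INF_lower) simp

lemma riesz_outer_greatest: "(\<And>U. open U \<Longrightarrow> E \<subseteq> U \<Longrightarrow> c \<le> open_content U) \<Longrightarrow> c \<le> riesz_outer E"
  unfolding riesz_outer_def by (rule INF_greatest) simp

lemma riesz_outer_open: "open U \<Longrightarrow> riesz_outer U = open_content U"
  by (intro antisym riesz_outer_lower riesz_outer_greatest open_content_mono) auto

lemma riesz_outer_mono: "E \<subseteq> F \<Longrightarrow> riesz_outer E \<le> riesz_outer F"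
  by (intro riesz_outer_greatest riesz_outer_lower) auto

lemma riesz_outer_le: "riesz_outer E \<le> ennreal C"
  using riesz_outer_lower[of UNIV E] open_content_le[of UNIV] by (simp add: order_trans)

lemma riesz_outer_approx:
  assumes "0 < (e::real)"
  obtains U where "open U" "E \<subseteq> U" "open_content U < riesz_outer E + ennreal e"
proof -
  have "riesz_outer E \<noteq> \<infinity>" using riesz_outer_le[of E] by (auto simp: top_unique)
  then have "\<exists>U\<in>{U. open U \<and> E \<subseteq> U}. open_content U < riesz_outer E + ennreal e"
    by (intro INF_approx_ennreal) (use assms in \<open>auto simp: riesz_outer_def\<close>)
  then show ?thesis using that by blast
qed

text \<open>The slack is distributed as \<open>e / 2^(n+1)\<close> over the sets of the
  sequence.\<close>

lemma riesz_outer_measure: "outer_measure_space (Pow UNIV) riesz_outer"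
  unfolding outer_measure_space_def
proof (intro conjI)
  show "positive (Pow UNIV) riesz_outer"
    using riesz_outer_open[of "{}"] by (simp add: positive_def open_content_empty)
  show "increasing (Pow UNIV) riesz_outer"
    by (auto simp: increasing_def intro: riesz_outer_mono)
  show "countably_subadditive (Pow UNIV) riesz_outer"
    unfolding countably_subadditive_def
  proof (intro allI impI)
    fix E :: "nat \<Rightarrow> 'a set"
    show "riesz_outer (\<Union>n. E n) \<le> (\<Sum>n. riesz_outer (E n))"
    proof (rule ennreal_le_epsilon)
      fix e :: real assume e: "0 < e"
      have "\<exists>U. open U \<and> E n \<subseteq> U \<and> open_content U < riesz_outer (E n) + ennreal (e * (1/2)^Suc n)" for n
        by (rule riesz_outer_approx[of "e * (1/2)^Suc n" "E n"]) (use e in auto)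
      then obtain U where U: "\<And>n. open (U n)" "\<And>n. E n \<subseteq> U n"
        "\<And>n. open_content (U n) < riesz_outer (E n) + ennreal (e * (1/2)^Suc n)" by metis
      have "riesz_outer (\<Union>n. E n) \<le> open_content (\<Union>n. U n)" using U(1,2) by (intro riesz_outer_lower) blast+
      also have "\<dots> \<le> (\<Sum>n. open_content (U n))" by (rule open_content_UN[OF U(1)])
      also have "\<dots> \<le> (\<Sum>n. riesz_outer (E n) + ennreal (e * (1/2)^Suc n))"
        using U(3) by (intro suminf_le) (auto intro: less_imp_le)
      also have "\<dots> = (\<Sum>n. riesz_outer (E n)) + (\<Sum>n. ennreal (e * (1/2)^Suc n))"
        by (intro suminf_add[symmetric]) auto
      also have "(\<Sum>n. ennreal (e * (1/2)^Suc n)) = ennreal (e * 1)"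
        using e by (intro suminf_ennreal_eq sums_mult power_half_series) auto
      finally show "riesz_outer (\<Union>n. E n) \<le> (\<Sum>n. riesz_outer (E n)) + ennreal e" by simp
    qed
  qed
qed

text \<open>First \<open>f\<close> is chosen admissible for \<open>U \<inter> V\<close>, carried by
  a compact \<open>K\<close>, and only then \<open>g\<close> admissible for \<open>U - K\<close>.
  Their supports are disjoint, so \<open>f + g\<close> is still bounded by 1 and admissible for
  \<open>U\<close>; suprema over \<open>g\<close> and then \<open>f\<close> give Caratheodory's
  condition.\<close>

lemma open_lambda_system:
  assumes V: "open V"
  shows "V \<in> lambda_system UNIV (Pow UNIV) riesz_outer"
proof -
  interpret algebra UNIV "Pow (UNIV :: 'a set)" by (rule algebra_Pow)
  have le: "riesz_outer (E \<inter> V) + riesz_outer (E - V) \<le> riesz_outer E" for E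
  proof (rule riesz_outer_greatest)
    fix U assume U: "open U" "E \<subseteq> U"
    have one: "ennreal (p f) + riesz_outer (U - V) \<le> open_content U" if f: "f \<in> admissible (U \<inter> V)" for f
    proof -
      obtain K where K: "compact K" "K \<subseteq> U \<inter> V" "\<And>x. x \<notin> K \<Longrightarrow> f x = 0" and f1: "\<And>x. f x \<le> 1"
        using f by (auto simp: admissible_def)
      have UK: "open (U - K)" using U(1) compact_imp_closed[OF K(1)] by (rule open_Diff)
      have two: "ennreal (p g) + ennreal (p f) \<le> open_content U" if g: "g \<in> admissible (U - K)" for g
      proof -
        obtain L where L: "compact L" "L \<subseteq> U - K" "\<And>x. x \<notin> L \<Longrightarrow> g x = 0" and g1: "\<And>x. g x \<le> 1"
          using g by (auto simp: admissible_def)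
        note fP = admissible_CcP[OF f] and gP = admissible_CcP[OF g]
        have "(\<lambda>x. g x + f x) \<in> admissible U"
        proof (rule admissibleI[of _ "K \<union> L"])
          show "g x + f x \<le> 1" for x
          proof (cases "x \<in> K")
            case True
            then have "g x = 0" using L(2,3) by auto
            then show ?thesis using f1 by simp
          next
            case False
            then show ?thesis using K(3) g1 by simp
          qed
        qed (use K L fP gP in \<open>auto intro!: continuous_intros CcP_continuous[OF fP] CcP_continuous[OF gP]
          add_nonneg_nonneg CcP_nonneg[OF fP] CcP_nonneg[OF gP]\<close>)
        then have "ennreal (p (\<lambda>x. g x + f x)) \<le> open_content U" by (rule open_content_upper)
        then show ?thesis using p_add[OF gP fP] p_nonneg[OF fP] p_nonneg[OF gP] by simp
      qed
      have ne: "admissible (U - K) \<noteq> {}"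
        using admissibleI[of "\<lambda>x. 0" "{}" "U - K"] by (auto intro: continuous_intros)
      have "ennreal (p f) + riesz_outer (U - V) \<le> ennreal (p f) + open_content (U - K)"
        using K(2) by (intro add_left_mono riesz_outer_lower UK) auto
      also have "\<dots> = (SUP g\<in>admissible (U - K). ennreal (p g) + ennreal (p f))"
        unfolding open_content_def by (simp add: ennreal_SUP_add_left[OF ne] add.commute)
      also have "\<dots> \<le> open_content U" by (intro SUP_least two)
      finally show ?thesis .
    qed
    have ne: "admissible (U \<inter> V) \<noteq> {}"
      using admissibleI[of "\<lambda>x. 0" "{}" "U \<inter> V"] by (auto intro: continuous_intros)
    have "riesz_outer (E \<inter> V) + riesz_outer (E - V) \<le> open_content (U \<inter> V) + riesz_outer (U - V)"
      using U V by (intro add_mono riesz_outer_lower riesz_outer_mono) auto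
    also have "\<dots> = (SUP f\<in>admissible (U \<inter> V). ennreal (p f) + riesz_outer (U - V))"
      unfolding open_content_def by (simp add: ennreal_SUP_add_left[OF ne])
    also have "\<dots> \<le> open_content U" by (intro SUP_least one)
    finally show "riesz_outer (E \<inter> V) + riesz_outer (E - V) \<le> open_content U" .
  qed
  have ge: "riesz_outer E \<le> riesz_outer (E \<inter> V) + riesz_outer (E - V)" for E
  proof -
    have "subadditive (Pow UNIV) riesz_outer"
      using riesz_outer_measure by (intro countably_subadditive_subadditive) (auto simp: outer_measure_space_def)
    then have "riesz_outer ((E \<inter> V) \<union> (E - V)) \<le> riesz_outer (E \<inter> V) + riesz_outer (E - V)"
      by (intro subadditiveD) auto
    then show ?thesis by (simp add: Int_Diff_Un)
  qed
  show ?thesis unfolding lambda_system_eq using le ge by (auto intro: antisym)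
qed

definition riesz_measure :: "'a measure"
  where "riesz_measure = measure_of UNIV (sets borel) riesz_outer"

lemma sets_riesz [simp]: "sets riesz_measure = sets borel"
  and space_riesz [simp]: "space riesz_measure = UNIV"
  using sets.sigma_sets_eq[of borel]
  by (simp_all add: riesz_measure_def sets_measure_of_conv space_measure_of_conv)

text \<open>By Caratheodory the outer measure is countably additive on a sigma-algebra that contains
  the open sets, hence the Borel sets.\<close>

lemma emeasure_riesz:
  assumes E: "E \<in> sets borel"
  shows "emeasure riesz_measure E = riesz_outer E"
proof -
  interpret sigma_algebra UNIV "Pow (UNIV :: 'a set)" by (rule sigma_algebra_Pow)
  have ms: "measure_space UNIV (lambda_system UNIV (Pow UNIV) riesz_outer) riesz_outer"
    by (rule caratheodory_lemma[OF riesz_outer_measure])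
  interpret L: sigma_algebra UNIV "lambda_system UNIV (Pow (UNIV :: 'a set)) riesz_outer"
    using ms by (simp add: measure_space_def)
  have "sigma_sets UNIV {U :: 'a set. open U} \<subseteq> lambda_system UNIV (Pow UNIV) riesz_outer"
    by (rule L.sigma_sets_subset) (use open_lambda_system in auto)
  then have sub: "sets borel \<subseteq> lambda_system UNIV (Pow (UNIV :: 'a set)) riesz_outer"
    by (simp add: borel_def)
  have "countably_additive (sets borel) riesz_outer"
    using ms sub unfolding measure_space_def countably_additive_def by blast
  moreover have "positive (sets borel) riesz_outer"
    using ms by (auto simp: measure_space_def positive_def)
  moreover have "sigma_algebra UNIV (sets (borel :: 'a measure))"
    using sets.sigma_algebra_axioms[of borel] by simp
  ultimately show ?thesis
    unfolding riesz_measure_def using E by (intro emeasure_measure_of_sigma)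
qed

lemma finite_riesz: "finite_measure riesz_measure"
proof
  have "riesz_outer UNIV < top" by (rule le_less_trans[OF riesz_outer_le]) simp
  then show "emeasure riesz_measure (space riesz_measure) \<noteq> \<infinity>" by (simp add: emeasure_riesz)
qed

interpretation R: finite_measure riesz_measure by (rule finite_riesz)

text \<open>\<open>f\<close> is admissible for every open set containing \<open>K\<close>, so
  \<open>p f\<close> lies below the infimum that defines the measure of \<open>K\<close>.\<close>

lemma riesz_compact_ge:
  assumes f: "f \<in> CcP" "\<And>x. f x \<le> 1" and K: "compact K" "\<And>x. x \<notin> K \<Longrightarrow> f x = 0"
  shows "p f \<le> measure riesz_measure K"
proof -
  have "ennreal (p f) \<le> riesz_outer K"
    using f K by (intro riesz_outer_greatest open_content_upper) (auto simp: admissible_def)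
  also have "\<dots> = ennreal (measure riesz_measure K)"
    using emeasure_riesz[OF compact_borel[OF K(1)]] R.emeasure_eq_measure by simp
  finally show ?thesis by (simp add: ennreal_le_iff)
qed

lemma riesz_open_approx:
  assumes U: "open U" and e: "0 < e"
  obtains f K where "f \<in> CcP" "\<And>x. f x \<le> 1" "compact K" "K \<subseteq> U" "\<And>x. x \<notin> K \<Longrightarrow> f x = 0"
    "measure riesz_measure U \<le> p f + e"
proof -
  have ne: "admissible U \<noteq> {}" using admissibleI[of "\<lambda>x. 0" "{}" U] by (auto intro: continuous_intros)
  have "open_content U \<noteq> \<infinity>" using open_content_le[of U] by (auto simp: top_unique)
  then obtain f where f: "f \<in> admissible U" "open_content U < ennreal (p f) + ennreal e"
    using SUP_approx_ennreal[OF _ ne open_content_def, of e] e by auto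
  have "ennreal (measure riesz_measure U) = open_content U"
    using emeasure_riesz[of U] R.emeasure_eq_measure[of U] U by (simp add: riesz_outer_open)
  with f(2) have "ennreal (measure riesz_measure U) \<le> ennreal (p f + e)"
    using p_nonneg[OF admissible_CcP[OF f(1)]] e by simp
  then have "measure riesz_measure U \<le> p f + e"
    using p_nonneg[OF admissible_CcP[OF f(1)]] e by (simp add: ennreal_le_iff del: ennreal_plus)
  with f(1) show ?thesis using that by (auto simp: admissible_def)
qed

lemma riesz_outer_regular:
  assumes E: "E \<in> sets borel" and e: "0 < e"
  obtains U where "open U" "E \<subseteq> U" "measure riesz_measure (U - E) \<le> e"
proof -
  obtain U where U: "open U" "E \<subseteq> U" "open_content U < riesz_outer E + ennreal e" using riesz_outer_approx[OF e] by blast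
  have "ennreal (measure riesz_measure U) = open_content U" "ennreal (measure riesz_measure E) = riesz_outer E"
    using emeasure_riesz[of U] emeasure_riesz[OF E] R.emeasure_eq_measure U(1) by (simp_all add: riesz_outer_open)
  with U(3) have "ennreal (measure riesz_measure U) \<le> ennreal (measure riesz_measure E + e)"
    using e by simp
  then have "measure riesz_measure U \<le> measure riesz_measure E + e"
    using e by (simp add: ennreal_le_iff add_nonneg_nonneg del: ennreal_plus)
  moreover have "measure riesz_measure (U - E) = measure riesz_measure U - measure riesz_measure E"
    using E U by (intro R.finite_measure_Diff) auto
  ultimately show ?thesis using U that by simp
qed

text \<open>Inner regularity comes from outer regularity of the complement, cut down to a compact
  set: if \<open>K\<close> carries all but e/3 of the mass and \<open>W\<close> is open around
  \<open>- E\<close>, then \<open>K - W\<close> is compact inside \<open>E\<close>, and the gap to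
  \<open>U\<close> splits into three parts of mass at most e/3.\<close>

lemma regular_riesz: "regular_finite riesz_measure"
  unfolding regular_finite_def
proof (intro conjI ballI allI impI finite_riesz sets_riesz)
  fix E :: "'a set" and e :: real assume E: "E \<in> sets borel" and e: "0 < e"
  have e3: "0 < e/3" using e by simp
  obtain U where U: "open U" "E \<subseteq> U" "measure riesz_measure (U - E) \<le> e/3"
    using riesz_outer_regular[OF E e3] by blast
  obtain W where W: "open W" "- E \<subseteq> W" "measure riesz_measure (W - - E) \<le> e/3"
    using riesz_outer_regular[of "- E", OF _ e3] E by (metis borel_comp)
  obtain f K where f: "f \<in> CcP" "\<And>x. f x \<le> 1" "compact K" "\<And>x. x \<notin> K \<Longrightarrow> f x = 0"
    "measure riesz_measure UNIV \<le> p f + e/3"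
    using riesz_open_approx[OF open_UNIV e3] by metis
  have Kb: "K \<in> sets borel" by (rule compact_borel[OF f(3)])
  have "measure riesz_measure (- K) = measure riesz_measure UNIV - measure riesz_measure K"
    using R.finite_measure_compl[of K] Kb by (simp add: Compl_eq_Diff_UNIV)
  then have mK: "measure riesz_measure (- K) \<le> e/3"
    using f(5) riesz_compact_ge[OF f(1,2,3,4)] by simp
  have "U - (K - W) \<subseteq> (U - E) \<union> ((W - - E) \<union> - K)" by auto
  then have "measure riesz_measure (U - (K - W)) \<le> measure riesz_measure ((U - E) \<union> ((W - - E) \<union> - K))"
    using U W Kb E by (intro R.finite_measure_mono) auto
  also have "\<dots> \<le> measure riesz_measure (U - E) + measure riesz_measure ((W - - E) \<union> - K)"
    using U W Kb E by (intro measure_Un_le) auto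
  also have "\<dots> \<le> measure riesz_measure (U - E) + (measure riesz_measure (W - - E) + measure riesz_measure (- K))"
    using U W Kb E by (intro add_left_mono measure_Un_le) auto
  also have "\<dots> \<le> e" using U(3) W(3) mK by simp
  finally have "measure riesz_measure (U - (K - W)) \<le> e" .
  moreover have "compact (K - W)" using f(3) W(1) by (rule compact_diff)
  moreover have "K - W \<subseteq> E" using W(2) by auto
  ultimately show "\<exists>K U. compact K \<and> open U \<and> K \<subseteq> E \<and> E \<subseteq> U \<and> measure riesz_measure (U - K) \<le> e"
    using U by blast
qed

lemma integrable_CcP: "f \<in> CcP \<Longrightarrow> integrable riesz_measure f"
proof -
  assume f: "f \<in> CcP"
  obtain B where B: "\<And>x. f x \<le> B" using CcP_bounded[OF f] by metis
  have "f \<in> borel_measurable riesz_measure"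
    using borel_measurable_continuous_onI[OF CcP_continuous[OF f]] by (simp cong: measurable_cong_sets)
  then show ?thesis
    using B CcP_nonneg[OF f] by (intro R.integrable_const_bound[of _ B]) auto
qed

text \<open>Cutting \<open>f\<close> into \<open>n\<close> horizontal slices of height \<open>1 / n\<close> compares both sides with the same
  sums of measures of level sets.\<close>

lemma riesz_le_integral:
  assumes f: "f \<in> CcP" "\<And>x. f x \<le> 1"
  shows "p f \<le> (LINT x|riesz_measure. f x)"
proof (rule field_le_epsilon)
  fix e :: real assume e: "0 < e"
  let ?m = "measure riesz_measure"
  \<comment> \<open>The sums over the level sets \<open>S k\<close> and \<open>S (Suc k)\<close>
    differ by at most the single term \<open>?m (S 0) / n\<close>, which this choice of
    \<open>n\<close> pushes below \<open>e\<close>.\<close>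
  obtain n :: nat where n: "?m UNIV / e < real n" using reals_Archimedean2 by blast
  then have n0: "0 < real n" using e by (meson divide_nonneg_pos le_less_trans measure_nonneg)
  obtain K where K: "compact K" "\<And>x. x \<notin> K \<Longrightarrow> f x = 0" using f(1) by (auto simp: CcP_def)
  define S where "S k = K \<inter> {x. real k / real n \<le> f x}" for k :: nat
  \<comment> \<open>Each slice has its full height \<open>1 / n\<close> on \<open>S (Suc k)\<close>
    and vanishes off \<open>S k\<close>.\<close>
  define F where "F k x = min (f x) (real (Suc k) / n) - min (f x) (real k / n)" for k :: nat and x
  have fc: "continuous_on UNIV f" by (rule CcP_continuous[OF f(1)])
  have f0: "0 \<le> f x" for x by (rule CcP_nonneg[OF f(1)])
  have S: "compact (S k)" for k
    unfolding S_def using K(1) by (intro compact_Int_closed closed_Collect_le fc continuous_intros)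
  have step: "real (Suc k) / n = real k / n + 1 / n" for k by (simp add: add_divide_distrib)
  have F0: "0 \<le> F k x" "F k x \<le> 1 / n" for k x
  proof -
    have "0 \<le> min t (a + b) - min t a \<and> min t (a + b) - min t a \<le> b" if "0 \<le> b" for t a b :: real
      using that by (auto simp: min_def)
    from this[of "1 / n" "f x" "real k / n"] show "0 \<le> F k x" "F k x \<le> 1 / n"
      using n0 unfolding F_def step by auto
  qed
  have FP: "F k \<in> CcP" for k
    by (rule CcP_dominated[OF f(1)]) (use F0 n0 in \<open>auto simp: F_def intro!: continuous_intros fc\<close>)
  have sum: "(\<Sum>k<N. F k x) = min (f x) (real N / n)" for N x
    using f0[of x] by (induction N) (auto simp: F_def)
  have sumf: "(\<Sum>k<n. F k x) = f x" for x using sum[where N = n and x = x] f(2)[of x] n0 by simp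
  have p_sum: "p (\<lambda>x. \<Sum>k<N. F k x) = (\<Sum>k<N. p (F k))" "(\<lambda>x. \<Sum>k<N. F k x) \<in> CcP" for N
    using FP by (induction N) (auto simp: p_zero zero_CcP p_add CcP_add)
  have upper: "p (F k) \<le> ?m (S k) / n" for k
  proof -
    have "p (\<lambda>x. n * F k x) \<le> ?m (S k)"
    proof (rule riesz_compact_ge[OF CcP_scale[OF FP] _ S])
      show "n * F k x \<le> 1" for x using F0(2)[of k x] n0 by (simp add: field_simps)
      show "n * F k x = 0" if "x \<notin> S k" for x
      proof -
        have "f x \<le> real k / n" using that K(2)[of x] n0 by (auto simp: S_def)
        moreover have "0 \<le> 1 / real n" by simp
        moreover have "min t (a + b) - min t a = 0" if "t \<le> a" "0 \<le> b" for t a b :: real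
          using that by (auto simp: min_def)
        ultimately have "F k x = 0" unfolding F_def step by blast
        then show ?thesis by simp
      qed
    qed (use n0 in simp)
    then show ?thesis using p_scale[OF FP] n0 by (simp add: field_simps)
  qed
  have lower: "?m (S (Suc k)) / n \<le> (LINT x|riesz_measure. F k x)" for k
  proof -
    have Sb: "S (Suc k) \<in> sets riesz_measure" using compact_borel[OF S] by simp
    have "(LINT x|riesz_measure. indicator (S (Suc k)) x * (1 / n)) \<le> (LINT x|riesz_measure. F k x)"
    proof (rule integral_mono[OF _ integrable_CcP[OF FP]])
      show "integrable riesz_measure (\<lambda>x. indicator (S (Suc k)) x * (1 / real n))"
        using Sb by (intro integrable_mult_left integrable_real_indicator) (simp_all add: R.emeasure_eq_measure)
      show "indicator (S (Suc k)) x * (1 / real n) \<le> F k x" for x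
      proof (cases "x \<in> S (Suc k)")
        case True
        then have "real k / n + 1 / n \<le> f x" unfolding S_def step by simp
        moreover have "0 \<le> 1 / real n" by simp
        moreover have "b \<le> min t (a + b) - min t a" if "a + b \<le> t" "0 \<le> b" for t a b :: real
          using that by (auto simp: min_def)
        ultimately have "1 / n \<le> F k x" unfolding F_def step by blast
        with True show ?thesis by simp
      qed (use F0(1)[of k x] in simp)
    qed
    then show ?thesis using Sb by simp
  qed
  have "p f = (\<Sum>k<n. p (F k))" using p_sum(1)[of n] by (simp add: sumf)
  also have "\<dots> \<le> (\<Sum>k<n. ?m (S k) / n)" by (intro sum_mono upper)
  also have "\<dots> \<le> (\<Sum>k<Suc n. ?m (S k) / n)" by simp
  also have "\<dots> = ?m (S 0) / n + (\<Sum>k<n. ?m (S (Suc k)) / n)" by (rule sum.lessThan_Suc_shift)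
  also have "\<dots> \<le> ?m (S 0) / n + (\<Sum>k<n. LINT x|riesz_measure. F k x)"
    by (intro add_left_mono sum_mono lower)
  also have "(\<Sum>k<n. LINT x|riesz_measure. F k x) = (LINT x|riesz_measure. (\<Sum>k<n. F k x))"
    by (rule Bochner_Integration.integral_sum[symmetric]) (rule integrable_CcP[OF FP])
  also have "\<dots> = (LINT x|riesz_measure. f x)" by (simp add: sumf)
  also have "?m (S 0) / n \<le> ?m UNIV / n"
    using n0 by (intro divide_right_mono R.finite_measure_mono) auto
  also have "?m UNIV / n \<le> e" using n n0 e by (simp add: field_simps)
  finally show "p f \<le> (LINT x|riesz_measure. f x) + e" by simp
qed

text \<open>The previous inequality is applied to \<open>h - f\<close>, where \<open>h\<close>
  dominates \<open>f\<close>, stays below 1 and has \<open>p h\<close> within \<open>e\<close> of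
  the total mass.\<close>

lemma riesz_ge_integral:
  assumes f: "f \<in> CcP" "\<And>x. f x \<le> 1"
  shows "(LINT x|riesz_measure. f x) \<le> p f"
proof (rule field_le_epsilon)
  fix e :: real assume e: "0 < e"
  let ?m = "measure riesz_measure"
  obtain K where K: "compact K" "\<And>x. x \<notin> K \<Longrightarrow> f x = 0" using f(1) by (auto simp: CcP_def)
  obtain g where g: "g \<in> CcP" "\<And>x. g x \<le> 1" "?m UNIV \<le> p g + e"
    using riesz_open_approx[OF open_UNIV e] by metis
  obtain k :: "'a \<Rightarrow> real" and D where k: "continuous_on UNIV k" "\<And>x. 0 \<le> k x" "\<And>x. k x \<le> 1"
    "\<And>x. x \<in> K \<Longrightarrow> k x = 1" "compact D" "\<And>x. x \<notin> D \<Longrightarrow> k x = 0"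
    using Urysohn_compact[OF lc K(1) open_UNIV subset_UNIV] by metis
  have kP: "k \<in> CcP" by (rule CcP_I[OF k(1,2,5,6)])
  \<comment> \<open>\<open>g\<close> nearly exhausts the mass and \<open>k\<close> is 1 wherever
    \<open>f\<close> can be nonzero; their maximum does both.\<close>
  define h where "h x = max (g x) (k x)" for x
  have hP: "h \<in> CcP"
    by (rule CcP_dominated[OF CcP_add[OF g(1) kP]])
      (use CcP_nonneg[OF g(1)] k(2) in \<open>auto simp: h_def le_max_iff_disj add_nonneg_eq_0_iff
        intro!: continuous_intros CcP_continuous[OF g(1)] k(1)\<close>)
  have h1: "h x \<le> 1" "g x \<le> h x" for x using g(2) k(3) by (auto simp: h_def)
  have fh: "f x \<le> h x" for x
  proof (cases "x \<in> K")
    case True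
    then show ?thesis using f(2)[of x] k(4) by (simp add: h_def le_max_iff_disj)
  next
    case False
    then show ?thesis using K(2) CcP_nonneg[OF hP] by simp
  qed
  note d = p_diff[OF f(1) hP fh]
  have "h x - f x \<le> 1" for x using h1(1)[of x] CcP_nonneg[OF f(1), of x] by simp
  then have "p (\<lambda>x. h x - f x) \<le> (LINT x|riesz_measure. h x - f x)" by (rule riesz_le_integral[OF d(1)])
  also have "\<dots> = (LINT x|riesz_measure. h x) - (LINT x|riesz_measure. f x)"
    by (intro Bochner_Integration.integral_diff integrable_CcP hP f(1))
  also have "(LINT x|riesz_measure. h x) \<le> (LINT x|riesz_measure. 1)"
    using h1(1) by (intro integral_mono integrable_CcP[OF hP]) auto
  also have "\<dots> = ?m UNIV" by simp
  also have "?m UNIV \<le> p h + e" using g(3) p_mono[OF g(1) hP h1(2)] by simp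
  finally show "(LINT x|riesz_measure. f x) \<le> p f + e" using d(2) by simp
qed

lemma riesz_integral:
  assumes f: "f \<in> CcP"
  shows "(LINT x|riesz_measure. f x) = p f"
proof -
  obtain B where B: "0 < B" "\<And>x. f x \<le> B" using CcP_bounded[OF f] by metis
  have g: "(\<lambda>x. (1/B) * f x) \<in> CcP" using B by (intro CcP_scale f) auto
  have "(1/B) * f x \<le> 1" for x using B by (simp add: field_simps)
  then have "(LINT x|riesz_measure. (1/B) * f x) = p (\<lambda>x. (1/B) * f x)"
    by (intro antisym riesz_le_integral riesz_ge_integral g)
  then show ?thesis using p_scale[OF f, of "1/B"] B(1) by simp
qed

end

section \<open>The positive part of a bounded functional on the cone\<close>

context
  fixes l :: "('a::t2_space \<Rightarrow> real) \<Rightarrow> real" and C :: real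
  assumes l_add: "\<And>f g. f \<in> CcP \<Longrightarrow> g \<in> CcP \<Longrightarrow> l (\<lambda>x. f x + g x) = l f + l g"
    and l_scale: "\<And>c f. f \<in> CcP \<Longrightarrow> 0 \<le> c \<Longrightarrow> l (\<lambda>x. c * f x) = c * l f"
    and l_bound: "\<And>f. f \<in> CcP \<Longrightarrow> (\<And>x. f x \<le> 1) \<Longrightarrow> l f \<le> C"
begin

text \<open>The lattice-theoretic positive part: the supremum runs over \<open>0 <= g <= f\<close>,
  the lower bound being built into \<open>CcP\<close>.\<close>

definition positive_part :: "('a \<Rightarrow> real) \<Rightarrow> real"
  where "positive_part f = Sup (l ` {g \<in> CcP. \<forall>x. g x \<le> f x})"

lemma positive_part_upper:
  assumes f: "f \<in> CcP" and g: "g \<in> CcP" "\<And>x. g x \<le> f x"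
  shows "l g \<le> positive_part f"
proof -
  obtain B where B: "0 < B" "\<And>x. f x \<le> B" using CcP_bounded[OF f] by metis
  have "l h \<le> B * C" if h: "h \<in> CcP" "\<And>x. h x \<le> f x" for h
  proof -
    have hB: "(\<lambda>x. (1/B) * h x) \<in> CcP" using B by (intro CcP_scale h) auto
    have "(1/B) * h x \<le> 1" for x using order_trans[OF h(2) B(2)] B(1) by (simp add: field_simps)
    then have "l (\<lambda>x. (1/B) * h x) \<le> C" by (rule l_bound[OF hB])
    then have "(1/B) * l h \<le> C" using l_scale[OF h(1), of "1/B"] B(1) by simp
    then show ?thesis using B(1) by (simp add: field_simps)
  qed
  then have "bdd_above (l ` {g \<in> CcP. \<forall>x. g x \<le> f x})" by (auto intro!: bdd_aboveI2)
  then show ?thesis unfolding positive_part_def using g by (intro cSup_upper) auto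
qed

lemma positive_part_least:
  assumes f: "f \<in> CcP" and c: "\<And>g. g \<in> CcP \<Longrightarrow> (\<And>x. g x \<le> f x) \<Longrightarrow> l g \<le> c"
  shows "positive_part f \<le> c"
  unfolding positive_part_def using f c by (intro cSup_least) auto

text \<open>Riesz decomposition: a test function \<open>h <= f + g\<close> splits into
  \<open>min (h x) (f x)\<close> and a remainder below \<open>g\<close>. Conversely, test functions
  for \<open>f\<close> and \<open>g\<close> add up.\<close>

lemma positive_part_add:
  assumes f: "f \<in> CcP" and g: "g \<in> CcP"
  shows "positive_part (\<lambda>x. f x + g x) = positive_part f + positive_part g"
proof (rule antisym)
  show "positive_part (\<lambda>x. f x + g x) \<le> positive_part f + positive_part g"
  proof (rule positive_part_least[OF CcP_add[OF f g]])
    fix h assume h: "h \<in> CcP" "\<And>x. h x \<le> f x + g x"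
    define h1 where "h1 x = min (h x) (f x)" for x
    define h2 where "h2 x = h x - min (h x) (f x)" for x
    have 1: "h1 \<in> CcP"
    proof (rule CcP_dominated[OF h(1)])
      show "continuous_on UNIV h1"
        unfolding h1_def by (intro continuous_on_min CcP_continuous h(1) f)
      show "h1 x = 0" if "h x = 0" for x using that CcP_nonneg[OF f, of x] by (simp add: h1_def)
    qed (use CcP_nonneg[OF h(1)] CcP_nonneg[OF f] in \<open>simp add: h1_def\<close>)
    have 2: "h2 \<in> CcP"
    proof (rule CcP_dominated[OF h(1)])
      show "h2 x = 0" if "h x = 0" for x using that CcP_nonneg[OF f, of x] by (simp add: h2_def)
    qed (auto simp: h2_def intro!: continuous_intros CcP_continuous[OF h(1)] CcP_continuous[OF f])
    have "h = (\<lambda>x. h1 x + h2 x)" by (simp add: h1_def h2_def)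
    then have "l h = l h1 + l h2" using l_add[OF 1 2] by simp
    also have "l h1 \<le> positive_part f" by (rule positive_part_upper[OF f 1]) (simp add: h1_def)
    also have "l h2 \<le> positive_part g"
    proof (rule positive_part_upper[OF g 2])
      show "h2 x \<le> g x" for x using h(2)[of x] CcP_nonneg[OF g, of x] by (auto simp: h2_def min_def)
    qed
    finally show "l h \<le> positive_part f + positive_part g" by simp
  qed
  have "positive_part f \<le> positive_part (\<lambda>x. f x + g x) - positive_part g"
  proof (rule positive_part_least[OF f])
    fix h assume h: "h \<in> CcP" "\<And>x. h x \<le> f x"
    have "positive_part g \<le> positive_part (\<lambda>x. f x + g x) - l h"
    proof (rule positive_part_least[OF g])
      fix k assume k: "k \<in> CcP" "\<And>x. k x \<le> g x"
      have "l (\<lambda>x. h x + k x) \<le> positive_part (\<lambda>x. f x + g x)"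
        using h(2) k(2) by (intro positive_part_upper CcP_add f g h(1) k(1) add_mono)
      then show "l k \<le> positive_part (\<lambda>x. f x + g x) - l h" using l_add[OF h(1) k(1)] by simp
    qed
    then show "l h \<le> positive_part (\<lambda>x. f x + g x) - positive_part g" by simp
  qed
  then show "positive_part f + positive_part g \<le> positive_part (\<lambda>x. f x + g x)" by simp
qed

lemma l_zero: "l (\<lambda>x. 0) = 0"
proof -
  have "(\<lambda>x::'a. 0) \<in> CcP" by (rule CcP_I[of _ "{}"]) auto
  from l_scale[OF this, of 0] show ?thesis by simp
qed

lemma positive_part_nonneg: "f \<in> CcP \<Longrightarrow> 0 \<le> positive_part f"
proof -
  assume f: "f \<in> CcP"
  have "(\<lambda>x::'a. 0) \<in> CcP" by (rule CcP_I[of _ "{}"]) auto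
  from positive_part_upper[OF f this] show ?thesis using CcP_nonneg[OF f] by (simp add: l_zero)
qed

text \<open>For \<open>c > 0\<close> one inequality suffices, because its instance for
  \<open>1 / c\<close> is the other.\<close>

lemma positive_part_scale:
  assumes f: "f \<in> CcP" and c: "0 \<le> c"
  shows "positive_part (\<lambda>x. c * f x) = c * positive_part f"
proof -
  have le: "positive_part (\<lambda>x. c * f x) \<le> c * positive_part f" if f: "f \<in> CcP" and c: "0 < c" for c f
  proof (rule positive_part_least)
    show "(\<lambda>x. c * f x) \<in> CcP" using c by (intro CcP_scale f) auto
    fix g assume g: "g \<in> CcP" "\<And>x. g x \<le> c * f x"
    have "(\<lambda>x. (1/c) * g x) \<in> CcP" using c by (intro CcP_scale g) auto
    then have "l (\<lambda>x. (1/c) * g x) \<le> positive_part f"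
      using g(2) c by (intro positive_part_upper[OF f]) (simp_all add: field_simps)
    then have "(1/c) * l g \<le> positive_part f" using l_scale[OF g(1), of "1/c"] c by simp
    then show "l g \<le> c * positive_part f" using c by (simp add: field_simps)
  qed
  show ?thesis
  proof (cases "c = 0")
    case True
    have z: "(\<lambda>x::'a. 0) \<in> CcP" by (rule CcP_I[of _ "{}"]) auto
    have "positive_part (\<lambda>x. 0) \<le> 0"
    proof (rule positive_part_least[OF z])
      fix g :: "'a \<Rightarrow> real" assume "g \<in> CcP" "\<And>x. g x \<le> 0"
      then have "g = (\<lambda>x. 0)" using CcP_nonneg by (auto intro!: antisym ext)
      then show "l g \<le> 0" by (simp add: l_zero)
    qed
    with positive_part_nonneg[OF z] True show ?thesis by simp
  next
    case False
    with c have c: "0 < c" by simp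
    have "positive_part (\<lambda>x. (1/c) * (c * f x)) \<le> (1/c) * positive_part (\<lambda>x. c * f x)"
      using c by (intro le CcP_scale f) auto
    then have "c * positive_part f \<le> positive_part (\<lambda>x. c * f x)" using c by (simp add: field_simps)
    with le[OF f c] show ?thesis by simp
  qed
qed

lemma positive_part_bound: "f \<in> CcP \<Longrightarrow> (\<And>x. f x \<le> 1) \<Longrightarrow> positive_part f \<le> C"
  by (intro positive_part_least l_bound) (auto intro: order_trans)

end

lemma riesz_positive:
  fixes l :: "('a::t2_space \<Rightarrow> real) \<Rightarrow> real"
  assumes lc: "locally_compact_space (euclidean :: 'a topology)"
    and l: "\<And>f g. f \<in> CcP \<Longrightarrow> g \<in> CcP \<Longrightarrow> l (\<lambda>x. f x + g x) = l f + l g"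
      "\<And>c f. f \<in> CcP \<Longrightarrow> 0 \<le> c \<Longrightarrow> l (\<lambda>x. c * f x) = c * l f"
      "\<And>f. f \<in> CcP \<Longrightarrow> (\<And>x. f x \<le> 1) \<Longrightarrow> l f \<le> C"
  obtains M where "regular_finite M" "\<And>f. f \<in> CcP \<Longrightarrow> (LINT x|M. f x) = positive_part l f"
proof (rule that)
  note positive_part = positive_part_add[of l C, OF l] positive_part_scale[of l C, OF l] positive_part_nonneg[of l C, OF l] positive_part_bound[of l C, OF l]
  show "regular_finite (riesz_measure (positive_part l))"
    by (rule regular_riesz[of "positive_part l" C, OF lc positive_part])
  show "(LINT x|riesz_measure (positive_part l). f x) = positive_part l f" if "f \<in> CcP" for f
    by (rule riesz_integral[of "positive_part l" C, OF lc positive_part that])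
qed

text \<open>Replacing a test function \<open>g\<close> by \<open>f - g\<close> shows that the
  positive parts of \<open>l\<close> and of \<open>- l\<close> differ by \<open>l\<close>, just as
  in the Jordan decomposition of a measure.\<close>

lemma riesz_signed:
  fixes l :: "('a::t2_space \<Rightarrow> real) \<Rightarrow> real"
  assumes lc: "locally_compact_space (euclidean :: 'a topology)"
    and l: "\<And>f g. f \<in> CcP \<Longrightarrow> g \<in> CcP \<Longrightarrow> l (\<lambda>x. f x + g x) = l f + l g"
      "\<And>c f. f \<in> CcP \<Longrightarrow> 0 \<le> c \<Longrightarrow> l (\<lambda>x. c * f x) = c * l f"
      "\<And>f. f \<in> CcP \<Longrightarrow> (\<And>x. f x \<le> 1) \<Longrightarrow> \<bar>l f\<bar> \<le> C"
  obtains M N where "regular_finite M" "regular_finite N"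
    "\<And>f. f \<in> CcP \<Longrightarrow> l f = (LINT x|M. f x) - (LINT x|N. f x)"
proof -
  have l': "\<And>f g. f \<in> CcP \<Longrightarrow> g \<in> CcP \<Longrightarrow> - l (\<lambda>x. f x + g x) = - l f + - l g"
      "\<And>c f. f \<in> CcP \<Longrightarrow> 0 \<le> c \<Longrightarrow> - l (\<lambda>x. c * f x) = c * - l f"
      "\<And>f. f \<in> CcP \<Longrightarrow> (\<And>x. f x \<le> 1) \<Longrightarrow> - l f \<le> C"
    using l by (simp, simp, metis abs_le_D2)
  have l3: "\<And>f. f \<in> CcP \<Longrightarrow> (\<And>x. f x \<le> 1) \<Longrightarrow> l f \<le> C"
    using l(3) by (metis abs_le_D1)
  obtain M where M: "regular_finite M" "\<And>f. f \<in> CcP \<Longrightarrow> (LINT x|M. f x) = positive_part l f"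
    by (rule riesz_positive[of l C, OF lc l(1,2) l3]) blast+
  obtain N where N: "regular_finite N" "\<And>f. f \<in> CcP \<Longrightarrow> (LINT x|N. f x) = positive_part (\<lambda>f. - l f) f"
    by (rule riesz_positive[of "\<lambda>f. - l f" C, OF lc l']) blast+
  have diff: "(\<lambda>x. f x - g x) \<in> CcP" "l f = l g + l (\<lambda>x. f x - g x)"
    if f: "f \<in> CcP" and g: "g \<in> CcP" "\<And>x. g x \<le> f x" for f g
  proof -
    show "(\<lambda>x. f x - g x) \<in> CcP"
    proof (rule CcP_dominated[OF f])
      show "f x - g x = 0" if "f x = 0" for x
        using that g(2)[of x] CcP_nonneg[OF g(1), of x] by simp
    qed (use g(2) in \<open>auto intro!: continuous_intros CcP_continuous[OF f] CcP_continuous[OF g(1)]\<close>)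
    from l(1)[OF g(1) this] show "l f = l g + l (\<lambda>x. f x - g x)" by simp
  qed
  have "l f = positive_part l f - positive_part (\<lambda>f. - l f) f" if f: "f \<in> CcP" for f
  proof -
    have "positive_part l f \<le> l f + positive_part (\<lambda>f. - l f) f"
    proof (rule positive_part_least[of l C, OF l(1,2) l3 f])
      fix g assume g: "g \<in> CcP" "\<And>x. g x \<le> f x"
      have "- l (\<lambda>x. f x - g x) \<le> positive_part (\<lambda>f. - l f) f"
        by (rule positive_part_upper[of "\<lambda>f. - l f" C, OF l' f diff(1)[OF f g]]) (use CcP_nonneg[OF g(1)] in auto)
      then show "l g \<le> l f + positive_part (\<lambda>f. - l f) f" using diff(2)[OF f g] by simp
    qed
    moreover have "positive_part (\<lambda>f. - l f) f \<le> positive_part l f - l f"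
    proof (rule positive_part_least[of "\<lambda>f. - l f" C, OF l' f])
      fix g assume g: "g \<in> CcP" "\<And>x. g x \<le> f x"
      have "l (\<lambda>x. f x - g x) \<le> positive_part l f"
        by (rule positive_part_upper[of l C, OF l(1,2) l3 f diff(1)[OF f g]]) (use CcP_nonneg[OF g(1)] in auto)
      then show "- l g \<le> positive_part l f - l f" using diff(2)[OF f g] by simp
    qed
    ultimately show ?thesis by simp
  qed
  with M N that show ?thesis by simp
qed

section \<open>From positive measures to regular complex measures\<close>

lemma signed_borel_measure:
  assumes "finite_measure M" "sets M = sets borel"
  shows "signed_borel (measure M)"
  unfolding signed_borel_def
  using finite_measure.finite_measure_UNION[OF assms(1)] assms(2) by simp

lemma signed_borel_add: "signed_borel \<nu> \<Longrightarrow> signed_borel \<rho> \<Longrightarrow> signed_borel (\<lambda>A. \<nu> A + \<rho> A)"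
  by (auto simp: signed_borel_def intro!: sums_add)

lemma signed_borel_diff: "signed_borel \<nu> \<Longrightarrow> signed_borel \<rho> \<Longrightarrow> signed_borel (\<lambda>A. \<nu> A - \<rho> A)"
  by (auto simp: signed_borel_def intro!: sums_diff)

lemma total_variation_mono:
  fixes \<mu> :: "'a::topological_space set \<Rightarrow> complex"
  assumes E: "E \<in> sets borel" and U: "U \<in> sets borel" "E \<subseteq> U"
  shows "total_variation \<mu> E \<le> total_variation \<mu> U"
proof (rule total_variation_least)
  fix A :: "nat \<Rightarrow> 'a set" assume A: "\<And>n. A n \<in> sets borel" "disjoint_family A" "(\<Union>n. A n) = E"
  define D where "D n = (case n of 0 \<Rightarrow> U - E | Suc k \<Rightarrow> A k)" for n :: nat
  have AE: "A n \<subseteq> E" for n using A(3) by auto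
  have "D m \<inter> D n = {}" if "m < n" for m n
  proof -
    have "A k \<inter> A l = {}" if "k \<noteq> l" for k l using A(2) that by (simp add: disjoint_family_on_def)
    then show ?thesis using that AE by (auto simp: D_def split: nat.splits)
  qed
  then have "disjoint_family D" unfolding disjoint_family_on_def by (metis Int_commute nat_neq_iff)
  moreover have "(\<Union>n. D n) = U"
  proof -
    have "x \<in> (\<Union>n. D n)" if "x \<in> U" for x
    proof (cases "x \<in> E")
      case True
      then obtain n where "x \<in> D (Suc n)" using A(3) by (auto simp: D_def)
      then show ?thesis by blast
    next
      case False
      with that have "x \<in> D 0" by (simp add: D_def)
      then show ?thesis by blast
    qed
    moreover have "D n \<subseteq> U" for n using AE U(2) by (auto simp: D_def split: nat.split)
    ultimately show ?thesis by blast
  qed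
  moreover have "D n \<in> sets borel" for n using A(1) E U by (auto simp: D_def split: nat.split)
  ultimately have "(\<Sum>n. ennreal (cmod (\<mu> (D n)))) \<le> total_variation \<mu> U"
    by (intro total_variation_upper)
  also have "(\<lambda>n. ennreal (cmod (\<mu> (D n)))) =
      (\<lambda>n. case n of 0 \<Rightarrow> ennreal (cmod (\<mu> (U - E))) | Suc k \<Rightarrow> ennreal (cmod (\<mu> (A k))))"
    by (auto simp: D_def fun_eq_iff split: nat.split)
  finally show "(\<Sum>n. ennreal (cmod (\<mu> (A n)))) \<le> total_variation \<mu> U"
    unfolding suminf_case_nat by (metis add_increasing order_trans zero_le order_refl)
qed

text \<open>Enlarging a Borel set raises the total variation by at most the added
  \<open>T\<close>-mass, since \<open>T\<close> is additive and dominates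
  \<open>cmod (\<mu> E)\<close>. Both regularity equations thereby reduce to the gap condition on
  \<open>T\<close>.\<close>

lemma regular_complex_measureI:
  fixes \<mu> :: "'a::t2_space set \<Rightarrow> complex"
  assumes \<mu>: "complex_borel_measure \<mu>" and T: "signed_borel T" "\<And>E. 0 \<le> T E"
    and le: "\<And>E. E \<in> sets borel \<Longrightarrow> cmod (\<mu> E) \<le> T E"
    and reg: "\<And>E e. E \<in> sets borel \<Longrightarrow> 0 < e \<Longrightarrow>
      \<exists>K U. compact K \<and> open U \<and> K \<subseteq> E \<and> E \<subseteq> U \<and> T (U - K) \<le> e"
  shows "regular_complex_measure \<mu>"
proof -
  have tv: "total_variation \<mu> U \<le> total_variation \<mu> E + ennreal (T (U - E))"
    if E: "E \<in> sets borel" and U: "U \<in> sets borel" "E \<subseteq> U" for E U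
  proof (rule total_variation_least)
    fix A :: "nat \<Rightarrow> 'a set" assume A: "\<And>n. A n \<in> sets borel" "disjoint_family A" "(\<Union>n. A n) = U"
    have dis: "disjoint_family (\<lambda>n. A n \<inter> E)" "disjoint_family (\<lambda>n. A n - E)"
      using A(2) unfolding disjoint_family_on_def by blast+
    have "cmod (\<mu> (A n)) \<le> cmod (\<mu> (A n \<inter> E)) + T (A n - E)" for n
    proof -
      have "Re (\<mu> (A n)) = Re (\<mu> (A n \<inter> E)) + Re (\<mu> (A n - A n \<inter> E))"
        "Im (\<mu> (A n)) = Im (\<mu> (A n \<inter> E)) + Im (\<mu> (A n - A n \<inter> E))"
        using signed_split[of "\<lambda>A. Re (\<mu> A)" "A n \<inter> E" "A n"] signed_split[of "\<lambda>A. Im (\<mu> A)" "A n \<inter> E" "A n"]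
          \<mu> A(1) E by (auto simp: complex_borel_iff)
      then have eq: "\<mu> (A n) = \<mu> (A n \<inter> E) + \<mu> (A n - A n \<inter> E)" by (simp add: complex_eq_iff)
      have Diff: "A n - A n \<inter> E = A n - E" by auto
      have "cmod (\<mu> (A n - E)) \<le> T (A n - E)" using A(1) E by (intro le) auto
      then show ?thesis
        unfolding eq[unfolded Diff] by (intro order_trans[OF norm_triangle_ineq] add_left_mono)
    qed
    then have "ennreal (cmod (\<mu> (A n))) \<le> ennreal (cmod (\<mu> (A n \<inter> E))) + ennreal (T (A n - E))" for n
      using T(2) by (simp add: ennreal_leI flip: ennreal_plus)
    then have "(\<Sum>n. ennreal (cmod (\<mu> (A n)))) \<le> (\<Sum>n. ennreal (cmod (\<mu> (A n \<inter> E))) + ennreal (T (A n - E)))"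
      by (intro suminf_le) auto
    also have "\<dots> = (\<Sum>n. ennreal (cmod (\<mu> (A n \<inter> E)))) + (\<Sum>n. ennreal (T (A n - E)))"
      by (intro suminf_add[symmetric]) auto
    also have "(\<Sum>n. ennreal (T (A n - E))) = ennreal (T (U - E))"
    proof (rule suminf_ennreal_eq[OF T(2)])
      have "(\<lambda>n. T (A n - E)) sums T (\<Union>n. A n - E)"
        using A(1) E dis(2) by (intro signed_borel_sums[OF T(1)]) auto
      moreover have "(\<Union>n. A n - E) = U - E" using A(3) by auto
      ultimately show "(\<lambda>n. T (A n - E)) sums T (U - E)" by simp
    qed
    also have "(\<Sum>n. ennreal (cmod (\<mu> (A n \<inter> E)))) + ennreal (T (U - E)) \<le>
        total_variation \<mu> E + ennreal (T (U - E))"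
      using A U(2) E dis(1) by (intro add_right_mono total_variation_upper) auto
    finally show "(\<Sum>n. ennreal (cmod (\<mu> (A n)))) \<le> total_variation \<mu> E + ennreal (T (U - E))" .
  qed
  have T_mono: "T A \<le> T B" if "A \<in> sets borel" "B \<in> sets borel" "A \<subseteq> B" for A B
    using signed_split[OF T(1) that] T(2)[of "B - A"] by simp
  show ?thesis
    unfolding regular_complex_measure_def
  proof (intro conjI \<mu> ballI)
    fix E :: "'a set" assume E: "E \<in> sets borel"
    show "total_variation \<mu> E = (INF U\<in>{U. open U \<and> E \<subseteq> U}. total_variation \<mu> U)"
    proof (rule antisym)
      show "total_variation \<mu> E \<le> (INF U\<in>{U. open U \<and> E \<subseteq> U}. total_variation \<mu> U)"
        using E by (intro INF_greatest total_variation_mono) auto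
      show "(INF U\<in>{U. open U \<and> E \<subseteq> U}. total_variation \<mu> U) \<le> total_variation \<mu> E"
      proof (rule ennreal_le_epsilon)
        fix e :: real assume "0 < e"
        from reg[OF E this] obtain K U where KU: "compact K" "open U" "K \<subseteq> E" "E \<subseteq> U" "T (U - K) \<le> e" by blast
        have "T (U - E) \<le> e"
          using KU E compact_borel[OF KU(1)] by (intro order_trans[OF T_mono KU(5)]) auto
        then have Te: "ennreal (T (U - E)) \<le> ennreal e" by (rule ennreal_leI)
        have "(INF U\<in>{U. open U \<and> E \<subseteq> U}. total_variation \<mu> U) \<le> total_variation \<mu> U"
          using KU by (intro INF_lower) auto
        also have "\<dots> \<le> total_variation \<mu> E + ennreal (T (U - E))" using KU E by (intro tv) auto
        also have "\<dots> \<le> total_variation \<mu> E + ennreal e" using Te by (rule add_left_mono)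
        finally show "(INF U\<in>{U. open U \<and> E \<subseteq> U}. total_variation \<mu> U) \<le> total_variation \<mu> E + ennreal e" .
      qed
    qed
    show "total_variation \<mu> E = (SUP K\<in>{K. compact K \<and> K \<subseteq> E}. total_variation \<mu> K)"
    proof (rule antisym)
      show "(SUP K\<in>{K. compact K \<and> K \<subseteq> E}. total_variation \<mu> K) \<le> total_variation \<mu> E"
        using E by (intro SUP_least total_variation_mono) (auto intro: compact_borel)
      show "total_variation \<mu> E \<le> (SUP K\<in>{K. compact K \<and> K \<subseteq> E}. total_variation \<mu> K)"
      proof (rule ennreal_le_epsilon)
        fix e :: real assume "0 < e"
        from reg[OF E this] obtain K U where KU: "compact K" "open U" "K \<subseteq> E" "E \<subseteq> U" "T (U - K) \<le> e" by blast
        have Kb: "K \<in> sets borel" by (rule compact_borel[OF KU(1)])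
        have "T (E - K) \<le> e"
          using KU E Kb by (intro order_trans[OF T_mono KU(5)]) auto
        then have "ennreal (T (E - K)) \<le> ennreal e" by (rule ennreal_leI)
        moreover have "total_variation \<mu> E \<le> total_variation \<mu> K + ennreal (T (E - K))"
          by (rule tv[OF Kb E KU(3)])
        moreover have "total_variation \<mu> K \<le> (SUP K\<in>{K. compact K \<and> K \<subseteq> E}. total_variation \<mu> K)"
          using KU by (intro SUP_upper) auto
        ultimately show "total_variation \<mu> E \<le> (SUP K\<in>{K. compact K \<and> K \<subseteq> E}. total_variation \<mu> K) + ennreal e"
          by (meson add_mono order_trans)
      qed
    qed
  qed
qed

text \<open>The real and the imaginary part of \<open>L\<close> on nonnegative functions yield two
  finite regular measures each, and \<open>\<mu>\<close> is assembled from their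
  differences.\<close>

lemma riesz_complex:
  fixes L :: "('a::t2_space \<Rightarrow> complex) \<Rightarrow> complex"
  assumes lc: "locally_compact_space (euclidean :: 'a topology)"
    and lin: "\<And>a b f g. f \<in> Cc \<Longrightarrow> g \<in> Cc \<Longrightarrow> L (\<lambda>x. a * f x + b * g x) = a * L f + b * L g"
    and bound: "\<And>f B. f \<in> Cc \<Longrightarrow> 0 \<le> B \<Longrightarrow> (\<And>x. cmod (f x) \<le> B) \<Longrightarrow> cmod (L f) \<le> C * B"
  obtains \<mu> where "regular_complex_measure \<mu>" "\<And>f. f \<in> Cc \<Longrightarrow> complex_integral \<mu> f = L f"
proof -
  define R where "R f = (\<lambda>x. complex_of_real (f x))" for f :: "'a \<Rightarrow> real"
  have R: "R f \<in> Cc" if "f \<in> CcP" for f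
    using that by (auto simp: CcP_def R_def intro!: CcI continuous_intros)
  have R_add: "L (R (\<lambda>x. f x + g x)) = L (R f) + L (R g)" if "f \<in> CcP" "g \<in> CcP" for f g
    using lin[OF R[OF that(1)] R[OF that(2)], of 1 1] by (simp add: R_def)
  have R_scale: "L (R (\<lambda>x. c * f x)) = of_real c * L (R f)" if "f \<in> CcP" for c f
    using lin[OF R[OF that] R[OF that], of "of_real c" 0] by (simp add: R_def)
  have R_bound: "cmod (L (R f)) \<le> C" if "f \<in> CcP" "\<And>x. f x \<le> 1" for f
    using bound[OF R[OF that(1)], of 1] that CcP_nonneg[OF that(1)] by (simp add: R_def)
  obtain M1 N1 where 1: "regular_finite M1" "regular_finite N1"
      "\<And>f. f \<in> CcP \<Longrightarrow> Re (L (R f)) = (LINT x|M1. f x) - (LINT x|N1. f x)"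
  proof (rule riesz_signed[OF lc, of "\<lambda>f. Re (L (R f))" C])
    show "\<bar>Re (L (R f))\<bar> \<le> C" if "f \<in> CcP" "\<And>x. f x \<le> 1" for f
      using R_bound[OF that] abs_Re_le_cmod order_trans by blast
  qed (simp_all add: R_add R_scale)
  obtain M2 N2 where 2: "regular_finite M2" "regular_finite N2"
      "\<And>f. f \<in> CcP \<Longrightarrow> Im (L (R f)) = (LINT x|M2. f x) - (LINT x|N2. f x)"
  proof (rule riesz_signed[OF lc, of "\<lambda>f. Im (L (R f))" C])
    show "\<bar>Im (L (R f))\<bar> \<le> C" if "f \<in> CcP" "\<And>x. f x \<le> 1" for f
      using R_bound[OF that] abs_Im_le_cmod order_trans by blast
  qed (simp_all add: R_add R_scale)
  note fin = 1(1,2)[unfolded regular_finite_def] 2(1,2)[unfolded regular_finite_def]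
  define \<mu> where "\<mu> E = Complex (measure M1 E - measure N1 E) (measure M2 E - measure N2 E)" for E
  define T where "T E = (measure M1 E + measure N1 E) + (measure M2 E + measure N2 E)" for E
  have \<mu>: "complex_borel_measure \<mu>"
    unfolding complex_borel_iff \<mu>_def using fin
    by (auto intro!: signed_borel_diff signed_borel_measure)
  have reg: "regular_complex_measure \<mu>"
  proof (rule regular_complex_measureI[OF \<mu>])
    show "signed_borel T"
      unfolding T_def using fin by (intro signed_borel_add signed_borel_measure) auto
    show "0 \<le> T E" for E by (simp add: T_def)
    show "cmod (\<mu> E) \<le> T E" for E
      using cmod_le[of "\<mu> E"] measure_nonneg[of M1 E] measure_nonneg[of N1 E]
        measure_nonneg[of M2 E] measure_nonneg[of N2 E] unfolding \<mu>_def T_def complex.sel by linarith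
    fix E :: "'a set" and e :: real assume E: "E \<in> sets borel" and "0 < e"
    then have e: "0 < e/4" by simp
    obtain K1 U1 where 1: "compact K1" "open U1" "K1 \<subseteq> E" "E \<subseteq> U1" "measure M1 (U1 - K1) \<le> e/4"
      using fin(1) E e by blast
    obtain K2 U2 where 2: "compact K2" "open U2" "K2 \<subseteq> E" "E \<subseteq> U2" "measure N1 (U2 - K2) \<le> e/4"
      using fin(2) E e by blast
    obtain K3 U3 where 3: "compact K3" "open U3" "K3 \<subseteq> E" "E \<subseteq> U3" "measure M2 (U3 - K3) \<le> e/4"
      using fin(3) E e by blast
    obtain K4 U4 where 4: "compact K4" "open U4" "K4 \<subseteq> E" "E \<subseteq> U4" "measure N2 (U4 - K4) \<le> e/4"
      using fin(4) E e by blast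
    \<comment> \<open>One gap for all four measures: this \<open>?U - ?K\<close> is contained in
      each of the four individual gaps.\<close>
    let ?K = "(K1 \<union> K2) \<union> (K3 \<union> K4)" and ?U = "(U1 \<inter> U2) \<inter> (U3 \<inter> U4)"
    have mono: "measure M (?U - ?K) \<le> measure M (V - D)"
      if "finite_measure M" "sets M = sets borel" "open V" "compact D" "?U - ?K \<subseteq> V - D" for M V D
    proof (rule finite_measure.finite_measure_mono[OF that(1,5)])
      show "V - D \<in> sets M" using that(2-4) compact_borel[of D] by auto
    qed
    have "T (?U - ?K) \<le> (e/4 + e/4) + (e/4 + e/4)"
      unfolding T_def
      by (intro add_mono order_trans[OF mono 1(5)] order_trans[OF mono 2(5)]
          order_trans[OF mono 3(5)] order_trans[OF mono 4(5)]) (use fin 1 2 3 4 in auto)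
    then have "T (?U - ?K) \<le> e" by simp
    then show "\<exists>K U. compact K \<and> open U \<and> K \<subseteq> E \<and> E \<subseteq> U \<and> T (U - K) \<le> e"
      using 1 2 3 4 by (intro exI[of _ ?K] exI[of _ ?U]) auto
  qed
  have Cc_meas: "f \<in> borel_measurable borel" if "f \<in> Cc" for f :: "'a \<Rightarrow> complex"
    using that by (intro borel_measurable_continuous_onI) (auto simp: Cc_def)
  have repr: "complex_integral \<mu> (R f) = L (R f)" if f: "f \<in> CcP" for f
  proof -
    obtain B where B: "\<And>x. cmod (R f x) \<le> B" using Cc_bounded[OF R[OF f]] by metis
    \<comment> \<open>\<open>M1\<close>, \<open>N1\<close> and \<open>M2\<close>, \<open>N2\<close>
      need not be the Jordan parts entering \<open>complex_integral\<close>; only their differences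
      agree with those of the Jordan parts.\<close>
    note eq = integral_eq_of_measure_eq[OF _ _ _ _ _ _ _ _ _ Cc_meas[OF R[OF f]] B]
    have "(LINT x|re_pos \<mu>. R f x) - (LINT x|re_neg \<mu>. R f x) = (LINT x|M1. R f x) - (LINT x|N1. R f x)"
    proof (rule eq)
      show "measure (re_pos \<mu>) E - measure (re_neg \<mu>) E = measure M1 E - measure N1 E" if "E \<in> sets borel" for E
        using jordan_decomposition[OF signed_parts(1)[OF \<mu>] that] by (simp add: \<mu>_def)
    qed (use fin in \<open>simp_all add: finite_parts[OF \<mu>] sets_parts[OF \<mu>]\<close>)
    moreover have "(LINT x|im_pos \<mu>. R f x) - (LINT x|im_neg \<mu>. R f x) = (LINT x|M2. R f x) - (LINT x|N2. R f x)"
    proof (rule eq)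
      show "measure (im_pos \<mu>) E - measure (im_neg \<mu>) E = measure M2 E - measure N2 E" if "E \<in> sets borel" for E
        using jordan_decomposition[OF signed_parts(3)[OF \<mu>] that] by (simp add: \<mu>_def)
    qed (use fin in \<open>simp_all add: finite_parts[OF \<mu>] sets_parts[OF \<mu>]\<close>)
    ultimately have "complex_integral \<mu> (R f) =
        of_real ((LINT x|M1. f x) - (LINT x|N1. f x)) + \<i> * of_real ((LINT x|M2. f x) - (LINT x|N2. f x))"
      unfolding complex_integral_parts[OF \<mu>] by (simp add: R_def)
    also have "\<dots> = L (R f)" using 1(3)[OF f] 2(3)[OF f] by (simp add: complex_eq_iff)
    finally show ?thesis .
  qed
  have "complex_integral \<mu> f = L f" if f: "f \<in> Cc" for f
  proof -
    have cont: "continuous_on UNIV f" using f by (auto simp: Cc_def)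
    obtain K where K: "compact K" "\<And>x. x \<notin> K \<Longrightarrow> f x = 0" using f by (auto simp: Cc_def)
    have pos: "(\<lambda>x. max 0 (v x)) \<in> CcP" if "continuous_on UNIV v" "\<And>x. x \<notin> K \<Longrightarrow> v x = 0" for v :: "'a \<Rightarrow> real"
      using that K(1) by (intro CcP_I[of _ K]) (auto intro!: continuous_intros)
    define u0 where "u0 x = max 0 (Re (f x))" for x
    define u1 where "u1 x = max 0 (- Re (f x))" for x
    define u2 where "u2 x = max 0 (Im (f x))" for x
    define u3 where "u3 x = max 0 (- Im (f x))" for x
    have u: "u0 \<in> CcP" "u1 \<in> CcP" "u2 \<in> CcP" "u3 \<in> CcP"
      unfolding u0_def[abs_def] u1_def[abs_def] u2_def[abs_def] u3_def[abs_def]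
      using K(2) by (auto intro!: pos continuous_intros cont)
    define g where "g x = 1 * R u0 x + (-1) * R u1 x" for x
    define h where "h x = 1 * R u2 x + (-1) * R u3 x" for x
    have f_eq: "f = (\<lambda>x. 1 * g x + \<i> * h x)"
      by (auto simp: fun_eq_iff complex_eq_iff R_def g_def h_def u0_def u1_def u2_def u3_def max_def)
    have gh: "g \<in> Cc" "h \<in> Cc" unfolding g_def[abs_def] h_def[abs_def] by (intro Cc_lincomb R u)+
    have J: "complex_integral \<mu> (\<lambda>x. a * p x + b * q x) = a * complex_integral \<mu> p + b * complex_integral \<mu> q"
      if pq: "p \<in> Cc" "q \<in> Cc" for a b p q
    proof -
      obtain A where A: "\<And>x. cmod (p x) \<le> A" using Cc_bounded[OF pq(1)] by metis
      obtain B where B: "\<And>x. cmod (q x) \<le> B" using Cc_bounded[OF pq(2)] by metis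
      show ?thesis by (rule complex_integral_lincomb[OF \<mu> Cc_meas[OF pq(1)] A Cc_meas[OF pq(2)] B])
    qed
    have "complex_integral \<mu> g = L g"
      unfolding g_def[abs_def] J[OF R[OF u(1)] R[OF u(2)]] lin[OF R[OF u(1)] R[OF u(2)]] by (simp only: repr u)
    moreover have "complex_integral \<mu> h = L h"
      unfolding h_def[abs_def] J[OF R[OF u(3)] R[OF u(4)]] lin[OF R[OF u(3)] R[OF u(4)]] by (simp only: repr u)
    ultimately show ?thesis using J[OF gh, of 1 \<i>] lin[OF gh, of 1 \<i>] f_eq by simp
  qed
  with reg show ?thesis by (rule that)
qed

section \<open>The three assertions\<close>

interpretation cfun: vector_space "\<lambda>(c::complex) f s. c * f s"
  by standard (auto simp: fun_eq_iff algebra_simps)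

text \<open>Induction on \<open>T\<close>: if evaluation at \<open>F\<close> is not already zero on
  the common zeros of the other evaluations, subtracting a suitable multiple of it from
  \<open>\<phi>\<close> makes the difference vanish on those zeros.\<close>

lemma combination_of_evaluations:
  fixes W :: "(('v \<Rightarrow> complex) \<Rightarrow> complex) set" and V :: "('v \<Rightarrow> complex) set"
  assumes W: "\<And>a b M N. M \<in> W \<Longrightarrow> N \<in> W \<Longrightarrow> (\<lambda>F\<in>V. a * M F + b * N F) \<in> W"
    and "finite T" "T \<subseteq> V"
    and "\<And>a b M N. M \<in> W \<Longrightarrow> N \<in> W \<Longrightarrow> \<phi> (\<lambda>F\<in>V. a * M F + b * N F) = a * \<phi> M + b * \<phi> N"
    and "\<And>N. N \<in> W \<Longrightarrow> (\<And>F. F \<in> T \<Longrightarrow> N F = 0) \<Longrightarrow> \<phi> N = 0"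
  shows "\<exists>c. \<forall>N\<in>W. \<phi> N = (\<Sum>F\<in>T. c F * N F)"
  using assms(2-)
proof (induction T arbitrary: \<phi> rule: finite_induct)
  case empty
  then show ?case by simp
next
  case (insert F T)
  note lin = insert.prems(2) and ker = insert.prems(3)
  show ?case
  proof (cases "\<exists>N0\<in>W. (\<forall>H\<in>T. N0 H = 0) \<and> N0 F \<noteq> 0")
    case False
    have "\<exists>c. \<forall>N\<in>W. \<phi> N = (\<Sum>F\<in>T. c F * N F)"
    proof (rule insert.IH[OF _ lin])
      show "T \<subseteq> V" using insert.prems by blast
      fix N assume "N \<in> W" "\<And>H. H \<in> T \<Longrightarrow> N H = 0"
      with False show "\<phi> N = 0" by (intro ker) auto
    qed
    then obtain c where c: "\<And>N. N \<in> W \<Longrightarrow> \<phi> N = (\<Sum>F\<in>T. c F * N F)" by blast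
    have "(\<Sum>H\<in>insert F T. (c(F := 0)) H * N H) = (\<Sum>H\<in>T. c H * N H)" for N :: "('v \<Rightarrow> complex) \<Rightarrow> complex"
      using insert.hyps by (auto intro!: sum.cong)
    with c show ?thesis by (intro exI[of _ "c(F := 0)"]) simp
  next
    case True
    then obtain N0 where N0: "N0 \<in> W" "\<And>H. H \<in> T \<Longrightarrow> N0 H = 0" "N0 F \<noteq> 0" by blast
    define k where "k = \<phi> N0 / N0 F"
    define \<psi> where "\<psi> N = \<phi> N - k * N F" for N
    have "\<exists>c. \<forall>N\<in>W. \<psi> N = (\<Sum>H\<in>T. c H * N H)"
    proof (rule insert.IH)
      show "T \<subseteq> V" using insert.prems by blast
      show "\<psi> (\<lambda>F\<in>V. a * M F + b * N F) = a * \<psi> M + b * \<psi> N" if "M \<in> W" "N \<in> W" for a b M N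
        unfolding \<psi>_def lin[OF that] using insert.prems(1) by (simp add: algebra_simps)
      fix N assume N: "N \<in> W" "\<And>H. H \<in> T \<Longrightarrow> N H = 0"
      let ?D = "\<lambda>H\<in>V. 1 * N H + (- (N F / N0 F)) * N0 H"
      have "\<phi> ?D = 0"
        using N N0 insert.prems(1) by (intro ker W) auto
      also have "\<phi> ?D = 1 * \<phi> N + (- (N F / N0 F)) * \<phi> N0" by (rule lin[OF N(1) N0(1)])
      finally show "\<psi> N = 0" by (simp add: \<psi>_def k_def)
    qed
    then obtain c where c: "\<And>N. N \<in> W \<Longrightarrow> \<psi> N = (\<Sum>H\<in>T. c H * N H)" by blast
    have "(\<Sum>H\<in>insert F T. (c(F := k)) H * N H) = k * N F + (\<Sum>H\<in>T. c H * N H)" for N :: "('v \<Rightarrow> complex) \<Rightarrow> complex"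
      using insert.hyps by (auto intro!: sum.cong)
    then show ?thesis using c by (intro exI[of _ "c(F := k)"]) (simp add: \<psi>_def algebra_simps)
  qed
qed

lemma topspace_weak_star: "topspace (weak_star X V) = cdual X V"
  by (auto simp: weak_star_def cdual_def PiE_def)

text \<open>A basic neighbourhood of 0 on which \<open>\<phi>\<close> stays below 1 restricts only
  finitely many coordinates \<open>T\<close>. Functionals vanishing on \<open>T\<close> may be
  rescaled freely inside it, so \<open>\<phi>\<close> vanishes on them and is a combination of
  evaluations.\<close>

lemma weak_star_continuous_functional:
  fixes act :: "'g::topological_group_add \<Rightarrow> 'x \<Rightarrow> 'x"
  assumes G: "G_space X act"
    and cont: "continuous_map (weak_star X (LUC X act)) euclidean \<phi>"
    and lin: "\<And>a b M N. M \<in> cdual X (LUC X act) \<Longrightarrow> N \<in> cdual X (LUC X act) \<Longrightarrow>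
      \<phi> (\<lambda>F\<in>LUC X act. a * M F + b * N F) = a * \<phi> M + b * \<phi> (N :: ('x \<Rightarrow> complex) \<Rightarrow> complex)"
  obtains H where "H \<in> LUC X act" "\<And>N. N \<in> cdual X (LUC X act) \<Longrightarrow> \<phi> N = N H"
proof -
  let ?V = "LUC X act" and ?W = "cdual X (LUC X act)"
  have W: "(\<lambda>F\<in>?V. a * M F + b * N F) \<in> ?W" if "M \<in> ?W" "N \<in> ?W" for a b M N
    by (rule cdual_lincomb) (use that LUC_lincomb[OF G] LUC_Cb in blast)+
  define z :: "('x \<Rightarrow> complex) \<Rightarrow> complex" where "z = (\<lambda>F\<in>?V. 0)"
  have zero: "z \<in> ?W"
    unfolding z_def by (rule zero_cdual) (use LUC_lincomb[OF G] LUC_Cb in blast)+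
  have "(\<lambda>F\<in>?V. 0 * z F + 0 * z F) = z" unfolding z_def by (rule ext) simp
  then have phi0: "\<phi> z = 0" using lin[OF zero zero, of 0 0] by simp
  define S where "S = {N \<in> ?W. \<phi> N \<in> ball 0 1}"
  have "openin (weak_star X ?V) {N \<in> topspace (weak_star X ?V). \<phi> N \<in> ball 0 1}"
    by (rule openin_continuous_map_preimage[OF cont]) simp
  then have "openin (subtopology (product_topology (\<lambda>_. euclidean) ?V) ?W) S"
    unfolding topspace_weak_star S_def[symmetric] unfolding weak_star_def .
  then obtain O' where O': "openin (product_topology (\<lambda>_. euclidean) ?V) O'" "S = O' \<inter> ?W"
    unfolding openin_subtopology by blast
  have "z \<in> S" using zero phi0 by (simp add: S_def)
  then have "z \<in> O'" using O'(2) by blast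
  with O'(1) have "\<exists>U. finite {F \<in> ?V. U F \<noteq> topspace euclidean} \<and> (\<forall>F\<in>?V. openin euclidean (U F)) \<and>
      z \<in> PiE ?V U \<and> PiE ?V U \<subseteq> O'"
    unfolding openin_product_topology_alt by (rule bspec)
  then obtain U where U: "finite {F \<in> ?V. U F \<noteq> topspace euclidean}" "z \<in> PiE ?V U" "PiE ?V U \<subseteq> O'"
    by (elim exE conjE)
  define T where "T = {F \<in> ?V. U F \<noteq> (UNIV :: complex set)}"
  have T: "finite T" "T \<subseteq> ?V" using U(1) by (auto simp: T_def)
  have small: "cmod (\<phi> N) < 1" if N: "N \<in> ?W" "\<And>F. F \<in> T \<Longrightarrow> N F = 0" for N
  proof -
    have "N F \<in> U F" if "F \<in> ?V" for F
    proof (cases "F \<in> T")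
      case True
      have "z F \<in> U F" using U(2) that by (rule PiE_mem)
      then show ?thesis using N(2)[OF True] that by (simp add: z_def)
    qed (use that in \<open>auto simp: T_def\<close>)
    then have "N \<in> PiE ?V U" using cdual_extensional[OF N(1)] by (simp add: PiE_iff)
    then have "N \<in> S" using U(3) O'(2) N(1) by blast
    then show ?thesis by (simp add: S_def)
  qed
  have "\<exists>c. \<forall>N\<in>?W. \<phi> N = (\<Sum>F\<in>T. c F * N F)"
  proof (rule combination_of_evaluations[OF W T lin])
    fix N assume N: "N \<in> ?W" "\<And>F. F \<in> T \<Longrightarrow> N F = 0"
    show "\<phi> N = 0"
    proof (rule ccontr)
      assume nz: "\<phi> N \<noteq> 0"
      let ?N = "\<lambda>F\<in>?V. (1 / \<phi> N) * N F + 0 * N F"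
      have "cmod (\<phi> ?N) < 1" using N T(2) by (intro small W) auto
      also have "\<phi> ?N = (1 / \<phi> N) * \<phi> N + 0 * \<phi> N" by (rule lin[OF N(1) N(1)])
      finally show False using nz by simp
    qed
  qed
  then obtain c where c: "\<And>N. N \<in> ?W \<Longrightarrow> \<phi> N = (\<Sum>F\<in>T. c F * N F)" by blast
  show ?thesis
  proof (rule that)
    show "(\<lambda>x\<in>topspace X. \<Sum>F\<in>T. c F * F x) \<in> ?V" using T by (intro LUC_sum G) auto
    show "\<phi> N = N (\<lambda>x\<in>topspace X. \<Sum>F\<in>T. c F * F x)" if N: "N \<in> ?W" for N
      unfolding c[OF N] by (rule cdual_sum[OF G N T(1), where F = "\<lambda>F. F", symmetric]) (use T(2) in blast)
  qed
qed

section \<open>The annihilator of the action and the closed span\<close>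

context
  fixes X :: "'x topology" and act :: "'g::{topological_group_add, t2_space} \<Rightarrow> 'x \<Rightarrow> 'x"
  assumes lc: "locally_compact_space (euclidean :: 'g topology)" and G: "G_space X act"
begin

definition generators :: "('g \<Rightarrow> complex) set"
  where "generators = {fun_act X act M F | M F. M \<in> cdual X (LUC X act) \<and> F \<in> LUC X act}"

lemma group_cdual_lin:
  "m \<in> cdual euclidean (LUC_group :: ('g \<Rightarrow> complex) set) \<Longrightarrow> f \<in> LUC_group \<Longrightarrow> g \<in> LUC_group \<Longrightarrow>
    m (\<lambda>s. a * f s + b * g s) = a * m f + b * m g"
  using cdual_lin[of m "euclidean :: 'g topology" LUC_group f g a b] by (simp add: restrict_UNIV)

lemma group_cdual_lincomb:
  assumes "m \<in> cdual euclidean (LUC_group :: ('g \<Rightarrow> complex) set)" "n \<in> cdual euclidean LUC_group"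
  shows "(\<lambda>f\<in>LUC_group. a * m f + b * n f) \<in> cdual euclidean (LUC_group :: ('g \<Rightarrow> complex) set)"
  by (rule cdual_lincomb) (use assms LUC_lincomb[OF G_space_self[OF lc]] LUC_Cb in blast)+

lemma LUC_group_const_zero: "(\<lambda>s. 0) \<in> (LUC_group :: ('g \<Rightarrow> complex) set)"
  using LUC_zero[OF G_space_self[OF lc]] by (simp add: restrict_UNIV)

lemma subspace_LUC_group: "cfun.subspace (LUC_group :: ('g \<Rightarrow> complex) set)"
  unfolding cfun.subspace_def zero_fun_def plus_fun_def
proof (intro conjI ballI allI LUC_group_const_zero)
  fix f g :: "'g \<Rightarrow> complex" assume "f \<in> LUC_group" "g \<in> LUC_group"
  from LUC_group_lincomb[OF lc this, of 1 1] show "(\<lambda>x. f x + g x) \<in> LUC_group" by simp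
next
  fix c and f :: "'g \<Rightarrow> complex" assume f: "f \<in> LUC_group"
  from LUC_group_lincomb[OF lc f f, of c 0] show "(\<lambda>x. c * f x) \<in> LUC_group" by simp
qed

lemma span_generators_subset: "cfun.span generators \<subseteq> LUC_group"
  by (rule cfun.span_minimal[OF _ subspace_LUC_group]) (auto simp: generators_def intro: fun_act_LUC[OF lc G])

lemma CLS_iff:
  "g \<in> CLS X act \<longleftrightarrow> g \<in> LUC_group \<and> (\<forall>e>0. \<exists>h\<in>cfun.span generators. \<forall>s. cmod (g s - h s) \<le> e)"
proof -
  let ?C = "Cb (euclidean :: 'g topology)"
  have span: "LUC_group \<inter> cfun.span generators = cfun.span generators"
    using span_generators_subset by blast
  have "CLS X act = LUC_group \<inter> (mtopology_of ?C closure_of cfun.span generators)"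
    unfolding CLS_def closure_of_subtopology generators_def[symmetric] span ..
  also have "mtopology_of ?C closure_of cfun.span generators =
      {x \<in> mspace ?C. \<forall>r>0. \<exists>y\<in>cfun.span generators. y \<in> Metric_space.mball (mspace ?C) (mdist ?C) x r}"
    unfolding mtopology_of_def by (rule Metric_space.metric_closure_of[OF Metric_space_mspace_mdist])
  finally have *: "g \<in> CLS X act \<longleftrightarrow> g \<in> LUC_group \<and>
      (\<forall>r>0. \<exists>y\<in>cfun.span generators. y \<in> mspace ?C \<and> mdist ?C g y < r)"
    using LUC_Cb by (auto simp: Metric_space.in_mball[OF Metric_space_mspace_mdist] simp del: mspace_cfunspace)
  show ?thesis
    unfolding *
  proof (intro conj_cong refl iffI allI impI)
    fix e :: real
    assume g: "g \<in> LUC_group" and "\<forall>r>0. \<exists>y\<in>cfun.span generators. y \<in> mspace ?C \<and> mdist ?C g y < r" "0 < e"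
    then obtain y where y: "y \<in> cfun.span generators" "y \<in> mspace ?C" "mdist ?C g y < e" by blast
    have "cmod (g s - y s) \<le> e" for s
      using mdist_cfunspace_imp_mdist_le[OF LUC_Cb[OF g] y(2) less_imp_le[OF y(3)], of s] by (simp add: dist_norm)
    with y(1) show "\<exists>h\<in>cfun.span generators. \<forall>s. cmod (g s - h s) \<le> e" by blast
  next
    fix r :: real
    assume "\<forall>e>0. \<exists>h\<in>cfun.span generators. \<forall>s. cmod (g s - h s) \<le> e" and r: "0 < r"
    then obtain h where h: "h \<in> cfun.span generators" "\<forall>s. cmod (g s - h s) \<le> r/2" using half_gt_zero by blast
    have "mdist ?C g h \<le> r/2" using h(2) r by (intro mdist_cfunspace_le) (auto simp: dist_norm)
    moreover have "h \<in> mspace ?C" using h(1) span_generators_subset LUC_Cb by blast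
    ultimately show "\<exists>y\<in>cfun.span generators. y \<in> mspace ?C \<and> mdist ?C g y < r" using h(1) r by force
  qed
qed

text \<open>Associativity on functionals, \<open>(m . n) . M = m . (n . M)\<close>, written out at
  \<open>F\<close>; it makes the annihilator of the action stable under passing from
  \<open>m\<close> to \<open>m . n\<close>.\<close>

lemma dual_act_group_fun_act:
  assumes m: "m \<in> cdual euclidean LUC_group" and n: "n \<in> cdual euclidean LUC_group"
    and M: "M \<in> cdual X (LUC X act)" and F: "F \<in> LUC X act"
  shows "dual_act euclidean (+) m n (fun_act X act M F) = dual_act X act m (dual_act X act n M) F"
  using fun_act_LUC[OF lc G M F] by (simp add: dual_act_def[of euclidean] fun_act_fun_act[OF G F])
    (simp add: dual_act_def F)

lemma faithful_if_CLS:
  assumes "CLS X act = LUC_group"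
  shows "faithful_action X act"
  unfolding faithful_action_def
proof (intro ballI impI)
  fix m :: "('g \<Rightarrow> complex) \<Rightarrow> complex"
  assume m: "m \<in> cdual euclidean LUC_group"
    and ker: "\<forall>M\<in>cdual X (LUC X act). dual_act X act m M = (\<lambda>F\<in>LUC X act. 0)"
  have "cfun.span generators \<subseteq> {f \<in> LUC_group. m f = 0}"
  proof (rule cfun.span_minimal)
    show "generators \<subseteq> {f \<in> LUC_group. m f = 0}"
    proof
      fix f assume "f \<in> generators"
      then obtain M F where MF: "f = fun_act X act M F" "M \<in> cdual X (LUC X act)" "F \<in> LUC X act"
        by (auto simp: generators_def)
      have "dual_act X act m M F = 0" using ker MF by simp
      then show "f \<in> {f \<in> LUC_group. m f = 0}"
        using MF fun_act_LUC[OF lc G] by (simp add: dual_act_def)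
    qed
    have "m (\<lambda>s. 0) = 0" using group_cdual_lin[OF m LUC_group_const_zero LUC_group_const_zero, of 0 0] by simp
    moreover have "m (\<lambda>x. f x + g x) = m f + m g" if "f \<in> LUC_group" "g \<in> LUC_group" for f g
      using group_cdual_lin[OF m that, of 1 1] by simp
    moreover have "m (\<lambda>x. c * f x) = c * m f" if "f \<in> LUC_group" for c f
      using group_cdual_lin[OF m that that, of c 0] by simp
    ultimately show "cfun.subspace {f \<in> LUC_group. m f = 0}"
      using subspace_LUC_group unfolding cfun.subspace_def zero_fun_def plus_fun_def by auto
  qed
  then have span: "m h = 0" "h \<in> LUC_group" if "h \<in> cfun.span generators" for h using that by auto
  obtain C where C: "0 \<le> C" "\<And>F B. F \<in> LUC_group \<Longrightarrow> 0 \<le> B \<Longrightarrow>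
      (\<And>x. x \<in> topspace (euclidean :: 'g topology) \<Longrightarrow> cmod (F x) \<le> B) \<Longrightarrow> cmod (m F) \<le> C * B"
    using cdual_bound[OF m] by metis
  have "m g = 0" if g: "g \<in> LUC_group" for g
  proof -
    have "cmod (m g) \<le> 0 + d" if d: "0 < d" for d
    proof -
      have e: "0 < d / (C + 1)" "C * (d / (C + 1)) \<le> d" using d C(1) by (auto simp: field_simps)
      obtain h where h: "h \<in> cfun.span generators" "\<And>s. cmod (g s - h s) \<le> d / (C + 1)"
        using g e(1) assms CLS_iff by blast
      have "(\<lambda>s. 1 * g s + (-1) * h s) \<in> LUC_group" by (intro LUC_group_lincomb[OF lc] g span(2) h(1))
      then have "cmod (m (\<lambda>s. 1 * g s + (-1) * h s)) \<le> C * (d / (C + 1))"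
        using h(2) e(1) by (intro C(2)) auto
      then show ?thesis
        using group_cdual_lin[OF m g span(2)[OF h(1)], of 1 "-1"] span(1)[OF h(1)] e(2) by simp
    qed
    then have "cmod (m g) \<le> 0" by (rule field_le_epsilon)
    then show ?thesis by simp
  qed
  then show "m = (\<lambda>f\<in>LUC_group. 0)"
    using cdual_extensional[OF m] by (intro extensionalityI[of _ LUC_group]) auto
qed

text \<open>The majorant for Hahn--Banach is the distance to the span: the functional obtained
  vanishes on the span, and its real part at \<open>g\<close> equals a distance of at least
  \<open>e\<close>.\<close>

lemma CLS_if_faithful:
  assumes faithful: "faithful_action X act"
  shows "CLS X act = LUC_group"
proof (rule ccontr)
  assume "CLS X act \<noteq> LUC_group"
  then obtain g e where g: "g \<in> LUC_group" and e: "0 < e" and far: "\<And>h. h \<in> cfun.span generators \<Longrightarrow> \<not> (\<forall>s. cmod (g s - h s) \<le> e)"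
    using CLS_iff by blast
  \<comment> \<open>The radii within which the span reaches \<open>f\<close>; their infimum
    \<open>p\<close> is the distance in the supremum norm.\<close>
  define D where "D f = {r. 0 \<le> r \<and> (\<exists>h\<in>cfun.span generators. \<forall>s. cmod (f s - h s) \<le> r)}" for f :: "'g \<Rightarrow> complex"
  define p where "p f = Inf (D f)" for f
  have sp_zero: "(\<lambda>s. 0) \<in> cfun.span generators"
    using cfun.span_zero[of generators] by (simp add: zero_fun_def)
  have sp_add: "(\<lambda>s. f s + h s) \<in> cfun.span generators" if "f \<in> cfun.span generators" "h \<in> cfun.span generators" for f h
    using cfun.span_add[OF that] by (simp add: plus_fun_def)
  have sp_scale: "(\<lambda>s. c * f s) \<in> cfun.span generators" if "f \<in> cfun.span generators" for c f
    using cfun.span_scale[OF that, of c] .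
  have bdd: "bdd_below (D f)" for f by (rule bdd_belowI[of _ 0]) (simp add: D_def)
  have le: "p f \<le> r" if "r \<in> D f" for f r unfolding p_def by (rule cInf_lower[OF that bdd])
  have ne: "D f \<noteq> {}" if "f \<in> LUC_group" for f
  proof -
    obtain B where "0 \<le> B" "\<And>s. cmod (f s) \<le> B" using LUC_bound[OF \<open>f \<in> LUC_group\<close>] by auto
    then have "B \<in> D f" using sp_zero by (auto simp: D_def intro!: bexI[of _ "\<lambda>s. 0"])
    then show ?thesis by blast
  qed
  have ge: "c \<le> p f" if "f \<in> LUC_group" "\<And>r. r \<in> D f \<Longrightarrow> c \<le> r" for f c
    unfolding p_def using that ne by (intro cInf_greatest) auto
  have add: "r + r' \<in> D (\<lambda>s. f s + f' s)" if r: "r \<in> D f" and r': "r' \<in> D f'" for f f' r r'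
  proof -
    obtain h h' where h: "h \<in> cfun.span generators" "\<forall>s. cmod (f s - h s) \<le> r"
      "h' \<in> cfun.span generators" "\<forall>s. cmod (f' s - h' s) \<le> r'" using r r' unfolding D_def by blast
    have "cmod ((f s + f' s) - (h s + h' s)) \<le> r + r'" for s
      using norm_triangle_ineq[of "f s - h s" "f' s - h' s"] h(2,4) by (simp add: algebra_simps) (meson add_mono order_trans)
    then have "\<exists>k\<in>cfun.span generators. \<forall>s. cmod ((f s + f' s) - k s) \<le> r + r'"
      using sp_add[OF h(1,3)] by (intro bexI[of _ "\<lambda>s. h s + h' s"]) auto
    then show ?thesis using r r' unfolding D_def by simp
  qed
  have scale: "cmod c * r \<in> D (\<lambda>s. c * f s)" if r: "r \<in> D f" for f r c
  proof -
    obtain h where h: "h \<in> cfun.span generators" "\<forall>s. cmod (f s - h s) \<le> r" using r unfolding D_def by blast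
    have "cmod (c * f s - c * h s) \<le> cmod c * r" for s
      using h(2) by (simp add: mult_left_mono norm_mult flip: right_diff_distrib)
    then have "\<exists>k\<in>cfun.span generators. \<forall>s. cmod (c * f s - k s) \<le> cmod c * r"
      using sp_scale[OF h(1), of c] by (intro bexI[of _ "\<lambda>s. c * h s"]) auto
    then show ?thesis using r unfolding D_def by simp
  qed
  have LUC_add: "(\<lambda>s. f s + h s) \<in> LUC_group" if "f \<in> LUC_group" "h \<in> LUC_group" for f h :: "'g \<Rightarrow> complex"
    using LUC_group_lincomb[OF lc that, of 1 1] by simp
  have LUC_scale: "(\<lambda>s. c * f s) \<in> LUC_group" if "f \<in> LUC_group" for c and f :: "'g \<Rightarrow> complex"
    using LUC_group_lincomb[OF lc that that, of c 0] by simp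
  have p_add: "p (\<lambda>s. f s + h s) \<le> p f + p h" if f: "f \<in> LUC_group" and h: "h \<in> LUC_group" for f h
  proof -
    have "p (\<lambda>s. f s + h s) - p h \<le> r" if r: "r \<in> D f" for r
    proof -
      have "p (\<lambda>s. f s + h s) - r \<le> p h"
      proof (rule ge[OF h])
        show "p (\<lambda>s. f s + h s) - r \<le> r'" if "r' \<in> D h" for r'
          using le[OF add[OF r that]] by simp
      qed
      then show ?thesis by simp
    qed
    then have "p (\<lambda>s. f s + h s) - p h \<le> p f" by (rule ge[OF f])
    then show ?thesis by simp
  qed
  have p_scale_le: "p (\<lambda>s. c * f s) \<le> cmod c * p f" if f: "f \<in> LUC_group" for c f
  proof (cases "c = 0")
    case True
    have "0 \<in> D (\<lambda>s. 0)" using sp_zero by (auto simp: D_def intro!: bexI[of _ "\<lambda>s. 0"])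
    from le[OF this] True show ?thesis by simp
  next
    case False
    then have c: "0 < cmod c" by simp
    have "p (\<lambda>s. c * f s) / cmod c \<le> p f"
      using le[OF scale] c by (intro ge[OF f]) (simp add: field_simps)
    then show ?thesis using c by (simp add: field_simps)
  qed
  have p_nonneg: "0 \<le> p f" if "f \<in> LUC_group" for f by (rule ge[OF that]) (simp add: D_def)
  have p_scale: "p (\<lambda>s. c * f s) = cmod c * p f" if f: "f \<in> LUC_group" for c f
  proof (cases "c = 0")
    case True
    then show ?thesis using p_scale_le[OF f, of 0] p_nonneg[OF LUC_scale[OF f, of 0]] by simp
  next
    case False
    have "p (\<lambda>s. inverse c * (c * f s)) \<le> cmod (inverse c) * p (\<lambda>s. c * f s)"
      by (rule p_scale_le[OF LUC_scale[OF f]])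
    moreover have "(\<lambda>s. inverse c * (c * f s)) = f" using False by (simp add: fun_eq_iff)
    ultimately have "p f \<le> inverse (cmod c) * p (\<lambda>s. c * f s)" by (simp only: norm_inverse)
    moreover have "0 < cmod c" using False by simp
    ultimately have "cmod c * p f \<le> p (\<lambda>s. c * f s)" by (simp add: field_simps)
    with p_scale_le[OF f] show ?thesis by (simp add: antisym)
  qed
  obtain m where m: "\<And>a b f h. f \<in> LUC_group \<Longrightarrow> h \<in> LUC_group \<Longrightarrow> m (\<lambda>s. a * f s + b * h s) = a * m f + b * m h"
      "\<And>f. f \<in> LUC_group \<Longrightarrow> cmod (m f) \<le> p f" "Re (m g) = p g"
    using hahn_banach_complex[of "LUC_group :: ('g \<Rightarrow> complex) set" p g, OF LUC_add LUC_scale p_add p_scale g] by blast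
  define m' where "m' = (\<lambda>f\<in>LUC_group. m f)"
  have "m' \<in> cdual euclidean LUC_group"
  proof (rule cdualI[where C = 1])
    show "LUC_group \<subseteq> mspace (Cb (euclidean :: 'g topology))" using LUC_Cb by blast
    show "m' \<in> extensional LUC_group" by (simp add: m'_def)
    show "m' (\<lambda>x\<in>topspace euclidean. a * f x + b * h x) = a * m' f + b * m' h" if "f \<in> LUC_group" "h \<in> LUC_group" for a b f h
      using m(1)[OF that] LUC_group_lincomb[OF lc that] that by (simp add: m'_def restrict_UNIV)
    fix f :: "'g \<Rightarrow> complex" and B
    assume f: "f \<in> LUC_group" "0 \<le> B" "\<And>x. x \<in> topspace euclidean \<Longrightarrow> cmod (f x) \<le> B"
    then have "B \<in> D f" using sp_zero by (auto simp: D_def intro!: bexI[of _ "\<lambda>s. 0"])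
    then show "cmod (m' f) \<le> 1 * B" using m(2)[OF f(1)] le[of B f] f(1) by (simp add: m'_def)
  qed
  moreover have "dual_act X act m' M = (\<lambda>F\<in>LUC X act. 0)" if M: "M \<in> cdual X (LUC X act)" for M
  proof -
    have "m' (fun_act X act M F) = 0" if F: "F \<in> LUC X act" for F
    proof -
      have L: "fun_act X act M F \<in> LUC_group" by (rule fun_act_LUC[OF lc G M F])
      have "fun_act X act M F \<in> generators" using M F by (auto simp: generators_def)
      then have "fun_act X act M F \<in> cfun.span generators" by (rule cfun.span_base)
      then have "0 \<in> D (fun_act X act M F)" unfolding D_def by force
      then have "cmod (m (fun_act X act M F)) \<le> 0" by (rule order_trans[OF m(2)[OF L] le])
      then show ?thesis using L by (simp add: m'_def)
    qed
    then show ?thesis by (auto simp: dual_act_def fun_eq_iff)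
  qed
  ultimately have "m' = (\<lambda>f\<in>LUC_group. 0)" using faithful unfolding faithful_action_def by blast
  then have "m g = 0" using g by (metis m'_def restrict_apply')
  moreover have "e \<le> p g"
  proof (rule ge[OF g])
    fix r assume "r \<in> D g"
    then obtain h where h: "h \<in> cfun.span generators" "\<forall>s. cmod (g s - h s) \<le> r" by (auto simp: D_def)
    show "e \<le> r"
    proof (rule ccontr)
      assume "\<not> e \<le> r"
      then have "\<forall>s. cmod (g s - h s) \<le> e" using h(2) by (meson le_cases order_trans)
      with far[OF h(1)] show False by blast
    qed
  qed
  ultimately show False using m(3) e by simp
qed

text \<open>Central functionals and measures are both representable at every \<open>f\<close>, whereas the factorization
  lemma shows that a nonzero functional vanishing on \<open>Cc\<close> is not.\<close>

definition representable :: "(('g \<Rightarrow> complex) \<Rightarrow> complex) \<Rightarrow> ('g \<Rightarrow> complex) \<Rightarrow> bool"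
  where "representable m f \<longleftrightarrow> (\<exists>f'\<in>LUC_group. \<forall>n\<in>cdual euclidean LUC_group. m (fun_act euclidean (+) n f) = n f')"

lemma representable_lincomb:
  assumes m: "m \<in> cdual euclidean LUC_group"
    and f: "f \<in> LUC_group" "representable m f" and g: "g \<in> LUC_group" "representable m g"
  shows "representable m (\<lambda>s. a * f s + b * g s)"
proof -
  obtain f' where f': "f' \<in> LUC_group" "\<And>n. n \<in> cdual euclidean LUC_group \<Longrightarrow> m (fun_act euclidean (+) n f) = n f'"
    using f(2) unfolding representable_def by blast
  obtain g' where g': "g' \<in> LUC_group" "\<And>n. n \<in> cdual euclidean LUC_group \<Longrightarrow> m (fun_act euclidean (+) n g) = n g'"
    using g(2) unfolding representable_def by blast
  have "m (fun_act euclidean (+) n (\<lambda>s. a * f s + b * g s)) = n (\<lambda>s. a * f' s + b * g' s)"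
    if n: "n \<in> cdual euclidean LUC_group" for n
  proof -
    note mn = dual_act_cdual[OF lc G_space_self[OF lc] m n]
    have "dual_act euclidean (+) m n (\<lambda>s. a * f s + b * g s) =
        a * dual_act euclidean (+) m n f + b * dual_act euclidean (+) m n g"
      by (rule group_cdual_lin[OF mn f(1) g(1)])
    then show ?thesis
      using f'(2)[OF n] g'(2)[OF n] group_cdual_lin[OF n f'(1) g'(1)] LUC_group_lincomb[OF lc f(1) g(1)] f(1) g(1)
      by (simp add: dual_act_def)
  qed
  then show ?thesis unfolding representable_def using LUC_group_lincomb[OF lc f'(1) g'(1)] by blast
qed

text \<open>A uniform error between \<open>f\<close> and \<open>h\<close> passes with the factor
  \<open>C\<close> to the representing functions, so these converge as well.\<close>

lemma representable_closed:
  assumes m: "m \<in> cdual euclidean LUC_group" and f: "f \<in> LUC_group"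
    and lim: "\<And>e. 0 < e \<Longrightarrow> \<exists>h\<in>LUC_group. representable m h \<and> (\<forall>s. cmod (f s - h s) \<le> e)"
  shows "representable m f"
proof -
  note G' = G_space_self[OF lc]
  define \<delta> where "\<delta> s = (\<lambda>f\<in>LUC_group. f s)" for s :: 'g
  have \<delta>: "\<delta> s \<in> cdual euclidean LUC_group" for s unfolding \<delta>_def by (rule evaluation_cdual[OF lc])
  \<comment> \<open>Evaluation functionals leave no other choice: \<open>n = \<delta> s\<close> in
    the defining identity gives the value at \<open>s\<close>.\<close>
  define f' where "f' s = m (fun_act euclidean (+) (\<delta> s) f)" for s
  obtain C where C: "0 \<le> C" "\<And>F B. F \<in> LUC_group \<Longrightarrow> 0 \<le> B \<Longrightarrow>
      (\<And>x. x \<in> topspace (euclidean :: 'g topology) \<Longrightarrow> cmod (F x) \<le> B) \<Longrightarrow> cmod (m F) \<le> C * B"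
    using cdual_bound[OF m] by metis
  have diff_LUC: "(\<lambda>s. 1 * u s + (-1) * h s) \<in> LUC_group" if "u \<in> LUC_group" "h \<in> LUC_group" for u h :: "'g \<Rightarrow> complex"
    by (rule LUC_group_lincomb[OF lc that])
  have approx: "\<exists>h h'. h \<in> LUC_group \<and> h' \<in> LUC_group \<and> (\<forall>s. cmod (f s - h s) \<le> e) \<and> (\<forall>s. cmod (f' s - h' s) \<le> e) \<and>
      (\<forall>n\<in>cdual euclidean LUC_group. m (fun_act euclidean (+) n h) = n h')" if e: "0 < e" for e
  proof -
    define d where "d = e / (C + 1)"
    have d: "0 < d" "C * d \<le> e" "d \<le> e" using e C(1) by (auto simp: d_def field_simps)
    obtain h where h: "h \<in> LUC_group" "representable m h" "\<And>s. cmod (f s - h s) \<le> d"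
      using lim[OF d(1)] by blast
    obtain h' where h': "h' \<in> LUC_group" "\<And>n. n \<in> cdual euclidean LUC_group \<Longrightarrow> m (fun_act euclidean (+) n h) = n h'"
      using h(2) unfolding representable_def by blast
    have "cmod (f' s - h' s) \<le> e" for s
    proof -
      let ?D = "\<lambda>t. 1 * fun_act euclidean (+) (\<delta> s) f t + (-1) * fun_act euclidean (+) (\<delta> s) h t"
      have L: "fun_act euclidean (+) (\<delta> s) f \<in> LUC_group" "fun_act euclidean (+) (\<delta> s) h \<in> LUC_group"
        by (intro fun_act_LUC[OF lc G' \<delta>] f h(1))+
      have "fun_act euclidean (+) (\<delta> s) u t = u (t + s)" if "u \<in> LUC_group" for u t
        using LUC_ltrans[OF G' that, of t] by (simp add: fun_act_def \<delta>_def ltrans_euclidean)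
      then have "cmod (?D t) \<le> d" for t using h(3) f h(1) by simp
      then have "cmod (m ?D) \<le> C * d" using d(1) by (intro C(2) diff_LUC L) auto
      moreover have "m ?D = 1 * m (fun_act euclidean (+) (\<delta> s) f) + (-1) * m (fun_act euclidean (+) (\<delta> s) h)"
        by (rule group_cdual_lin[OF m L])
      moreover have "m (fun_act euclidean (+) (\<delta> s) h) = h' s" using h'(2)[OF \<delta>] h'(1) by (simp add: \<delta>_def)
      ultimately show ?thesis using d(2) by (simp add: f'_def)
    qed
    moreover have "cmod (f s - h s) \<le> e" for s using order_trans[OF h(3) d(3)] .
    ultimately show ?thesis using h(1) h' by blast
  qed
  have f': "f' \<in> LUC_group"
    by (rule LUC_uniform_limit[OF G']) (use approx in \<open>simp, blast\<close>)
  have "m (fun_act euclidean (+) n f) = n f'" if n: "n \<in> cdual euclidean LUC_group" for n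
  proof -
    note mn = dual_act_cdual[OF lc G' m n]
    obtain A where A: "0 \<le> A" "\<And>F B. F \<in> LUC_group \<Longrightarrow> 0 \<le> B \<Longrightarrow>
        (\<And>x. x \<in> topspace (euclidean :: 'g topology) \<Longrightarrow> cmod (F x) \<le> B) \<Longrightarrow> cmod (dual_act euclidean (+) m n F) \<le> A * B"
      using cdual_bound[OF mn] by metis
    obtain B where B: "0 \<le> B" "\<And>F b. F \<in> LUC_group \<Longrightarrow> 0 \<le> b \<Longrightarrow>
        (\<And>x. x \<in> topspace (euclidean :: 'g topology) \<Longrightarrow> cmod (F x) \<le> b) \<Longrightarrow> cmod (n F) \<le> B * b"
      using cdual_bound[OF n] by metis
    have "cmod (dual_act euclidean (+) m n f - n f') \<le> 0 + d" if d: "0 < d" for d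
    proof -
      define e where "e = d / (A + B + 1)"
      have e: "0 < e" "A * e + B * e \<le> d"
      proof -
        have pos: "0 < A + B + 1" using A(1) B(1) by simp
        then show e0: "0 < e" using d by (simp add: e_def)
        have "A * e + B * e \<le> (A + B + 1) * e" using e0 by (simp add: distrib_right)
        also have "\<dots> = d" using pos by (simp add: e_def)
        finally show "A * e + B * e \<le> d" .
      qed
      obtain h h' where h: "h \<in> LUC_group" "h' \<in> LUC_group" "\<And>s. cmod (f s - h s) \<le> e" "\<And>s. cmod (f' s - h' s) \<le> e"
        "m (fun_act euclidean (+) n h) = n h'" using approx[OF e(1)] n by blast
      have 1: "cmod (dual_act euclidean (+) m n f - n h') \<le> A * e"
      proof -
        have "cmod (dual_act euclidean (+) m n (\<lambda>s. 1 * f s + (-1) * h s)) \<le> A * e"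
          using h(3) e(1) by (intro A(2) diff_LUC f h(1)) auto
        then show ?thesis using group_cdual_lin[OF mn f h(1), of 1 "-1"] h(1,5) by (simp add: dual_act_def[of _ _ _ _ ])
      qed
      have 2: "cmod (n f' - n h') \<le> B * e"
      proof -
        have "cmod (n (\<lambda>s. 1 * f' s + (-1) * h' s)) \<le> B * e"
          using h(4) e(1) by (intro B(2) diff_LUC f' h(2)) auto
        then show ?thesis using group_cdual_lin[OF n f' h(2), of 1 "-1"] by simp
      qed
      have "cmod ((dual_act euclidean (+) m n f - n h') - (n f' - n h')) \<le> A * e + B * e"
        using 1 2 norm_triangle_ineq4[of "dual_act euclidean (+) m n f - n h'" "n f' - n h'"] by linarith
      then show ?thesis using e(2) by simp
    qed
    then have "cmod (dual_act euclidean (+) m n f - n f') \<le> 0" by (rule field_le_epsilon)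
    then show ?thesis using f by (simp add: dual_act_def)
  qed
  then show ?thesis unfolding representable_def using f' by blast
qed

text \<open>For \<open>f = M F\<close>, the weak-star continuous map sending \<open>N\<close> to
  \<open>(m . N) F\<close> is evaluation at some \<open>H\<close>; the choice
  \<open>N = n . M\<close> gives \<open>m (n (M F)) = n (M H)\<close>, so \<open>M H\<close>
  represents. Linear combinations and uniform limits then reach all of \<open>CLS\<close>.\<close>

lemma representable_if_Zcenter:
  assumes CLS: "CLS X act = LUC_group" and m: "m \<in> Zcenter X act" and f: "f \<in> LUC_group"
  shows "representable m f"
proof -
  have md: "m \<in> cdual euclidean LUC_group"
    and cont: "continuous_map (weak_star X (LUC X act)) (weak_star X (LUC X act)) (dual_act X act m)"
    using m by (auto simp: Zcenter_def)
  have gen: "representable m (fun_act X act M F)" if M: "M \<in> cdual X (LUC X act)" and F: "F \<in> LUC X act" for M F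
  proof -
    have ev: "continuous_map (weak_star X (LUC X act)) euclidean (\<lambda>N. N F)"
      unfolding weak_star_def using F by (intro continuous_map_from_subtopology continuous_map_product_projection)
    have cont': "continuous_map (weak_star X (LUC X act)) euclidean (\<lambda>N. dual_act X act m N F)"
      using continuous_map_compose[OF cont ev] by (simp add: o_def)
    have lin: "dual_act X act m (\<lambda>F\<in>LUC X act. a * N F + b * N' F) F = a * dual_act X act m N F + b * dual_act X act m N' F"
      if N: "N \<in> cdual X (LUC X act)" "N' \<in> cdual X (LUC X act)" for a b N N'
    proof -
      have "fun_act X act (\<lambda>F\<in>LUC X act. a * N F + b * N' F) F = (\<lambda>s. a * fun_act X act N F s + b * fun_act X act N' F s)"
        using LUC_ltrans[OF G F] by (simp add: fun_act_def)
      then show ?thesis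
        using group_cdual_lin[OF md fun_act_LUC[OF lc G N(1) F] fun_act_LUC[OF lc G N(2) F]] F by (simp add: dual_act_def)
    qed
    obtain H where H: "H \<in> LUC X act" "\<And>N. N \<in> cdual X (LUC X act) \<Longrightarrow> dual_act X act m N F = N H"
      using weak_star_continuous_functional[OF G cont' lin] by blast
    have "m (fun_act euclidean (+) n (fun_act X act M F)) = n (fun_act X act M H)" if n: "n \<in> cdual euclidean LUC_group" for n
    proof -
      have "m (fun_act euclidean (+) n (fun_act X act M F)) = dual_act X act m (dual_act X act n M) F"
        using F by (simp add: fun_act_fun_act[OF G F] dual_act_def[of X act m])
      also have "\<dots> = dual_act X act n M H" by (rule H(2)[OF dual_act_cdual[OF lc G n M]])
      also have "\<dots> = n (fun_act X act M H)" using H(1) by (simp add: dual_act_def)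
      finally show ?thesis .
    qed
    then show ?thesis unfolding representable_def using fun_act_LUC[OF lc G M H(1)] by blast
  qed
  have zero: "representable m (\<lambda>s. 0)"
  proof -
    have "m (fun_act euclidean (+) n (\<lambda>s. 0)) = n (\<lambda>s. 0)" if n: "n \<in> cdual euclidean LUC_group" for n
    proof -
      have z: "k (\<lambda>s. 0) = 0" if "k \<in> cdual euclidean LUC_group" for k :: "('g \<Rightarrow> complex) \<Rightarrow> complex"
        using group_cdual_lin[OF that LUC_group_const_zero LUC_group_const_zero, of 0 0] by simp
      show ?thesis using z[OF n] z[OF md] by (simp add: fun_act_def ltrans_euclidean)
    qed
    then show ?thesis unfolding representable_def using LUC_group_const_zero by blast
  qed
  have "cfun.span generators \<subseteq> {f \<in> LUC_group. representable m f}"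
  proof (rule cfun.span_minimal)
    show "generators \<subseteq> {f \<in> LUC_group. representable m f}"
      using gen fun_act_LUC[OF lc G] by (auto simp: generators_def)
    have "representable m (\<lambda>x. f x + g x)" if "f \<in> LUC_group" "representable m f" "g \<in> LUC_group" "representable m g" for f g
      using representable_lincomb[OF md that, of 1 1] by simp
    moreover have "representable m (\<lambda>x. c * f x)" if "f \<in> LUC_group" "representable m f" for c f
      using representable_lincomb[OF md that that, of c 0] by simp
    ultimately show "cfun.subspace {f \<in> LUC_group. representable m f}"
      using subspace_LUC_group zero unfolding cfun.subspace_def zero_fun_def plus_fun_def by auto
  qed
  then show ?thesis
    using f CLS CLS_iff[of f] by (intro representable_closed[OF md f]) blast
qed

section \<open>Central functionals versus measures\<close>

lemma Zcenter_subset_measures: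
  assumes nc: "\<not> compact (UNIV :: 'g set)" and CLS: "CLS X act = LUC_group" and m: "m \<in> Zcenter X act"
  obtains \<mu> where "regular_complex_measure \<mu>" "m = measure_functional \<mu>"
proof -
  note G' = G_space_self[OF lc]
  have md: "m \<in> cdual euclidean LUC_group" using m by (simp add: Zcenter_def)
  obtain C where C: "0 \<le> C" "\<And>F B. F \<in> LUC_group \<Longrightarrow> 0 \<le> B \<Longrightarrow>
      (\<And>x. x \<in> topspace (euclidean :: 'g topology) \<Longrightarrow> cmod (F x) \<le> B) \<Longrightarrow> cmod (m F) \<le> C * B"
    using cdual_bound[OF md] by metis
  have CcL: "f \<in> LUC_group" if "f \<in> Cc" for f :: "'g \<Rightarrow> complex" using Cc_subset_LUC[OF lc] that by blast
  obtain \<mu> where \<mu>: "regular_complex_measure \<mu>" "\<And>f. f \<in> Cc \<Longrightarrow> complex_integral \<mu> f = m f"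
  proof (rule riesz_complex[OF lc, of m C])
    show "m (\<lambda>x. a * f x + b * g x) = a * m f + b * m g" if "f \<in> Cc" "g \<in> Cc" for a b f g
      by (rule group_cdual_lin[OF md CcL[OF that(1)] CcL[OF that(2)]])
    show "cmod (m f) \<le> C * B" if "f \<in> Cc" "0 \<le> B" "\<And>x. cmod (f x) \<le> B" for f B
      by (rule C(2)[OF CcL[OF that(1)] that(2,3)])
  qed blast
  have J: "measure_functional \<mu> \<in> cdual euclidean LUC_group"
    using \<mu>(1) by (intro measure_functional_cdual[OF lc]) (simp add: regular_complex_measure_def)
  define d where "d = (\<lambda>f\<in>LUC_group. 1 * m f + (-1) * measure_functional \<mu> f)"
  have d: "d \<in> cdual euclidean LUC_group" unfolding d_def by (rule group_cdual_lincomb[OF md J])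
  have d_Cc: "d f = 0" if "f \<in> Cc" for f
    using \<mu>(2)[OF that] CcL[OF that] by (simp add: d_def measure_functional_def[OF lc])
  have rep: "representable d f" if f: "f \<in> LUC_group" for f
  proof -
    obtain f1 where f1: "f1 \<in> LUC_group" "\<And>n. n \<in> cdual euclidean LUC_group \<Longrightarrow> m (fun_act euclidean (+) n f) = n f1"
      using representable_if_Zcenter[OF CLS m f] unfolding representable_def by blast
    obtain f2 where f2: "f2 \<in> LUC_group" "\<And>n. n \<in> cdual euclidean LUC_group \<Longrightarrow> complex_integral \<mu> (fun_act euclidean (+) n f) = n f2"
      using measure_average[OF lc G' \<mu>(1) f] by blast
    have "d (fun_act euclidean (+) n f) = n (\<lambda>s. 1 * f1 s + (-1) * f2 s)" if n: "n \<in> cdual euclidean LUC_group" for n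
      using f1(2)[OF n] f2(2)[OF n] fun_act_LUC[OF lc G' n f] group_cdual_lin[OF n f1(1) f2(1), of 1 "-1"]
      by (simp add: d_def measure_functional_def[OF lc])
    then show ?thesis unfolding representable_def using LUC_group_lincomb[OF lc f1(1) f2(1)] by blast
  qed
  have "d g = 0" if g: "g \<in> LUC_group" for g
  proof -
    obtain F n where F: "F \<in> LUC_group" "n \<in> cdual euclidean LUC_group" "fun_act euclidean (+) n F = g"
      and key: "\<And>F'. F' \<in> LUC_group \<Longrightarrow> (\<And>n0. n0 \<in> cdual euclidean LUC_group \<Longrightarrow> fun_act euclidean (+) n0 F \<in> Cc \<Longrightarrow>
        n0 F' = 0) \<Longrightarrow> n F' = 0"
      by (rule factorization_at_infinity[OF lc nc g]) blast
    obtain F' where F': "F' \<in> LUC_group" "\<And>n. n \<in> cdual euclidean LUC_group \<Longrightarrow> d (fun_act euclidean (+) n F) = n F'"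
      using rep[OF F(1)] unfolding representable_def by blast
    have "n F' = 0"
    proof (rule key[OF F'(1)])
      fix n0 assume "n0 \<in> cdual euclidean LUC_group" "fun_act euclidean (+) n0 F \<in> Cc"
      then show "n0 F' = 0" using F'(2)[of n0] d_Cc by simp
    qed
    then show ?thesis using F'(2)[OF F(2)] F(3) by simp
  qed
  then have "m f = measure_functional \<mu> f" if "f \<in> LUC_group" for f using that by (force simp: d_def)
  then have "m = measure_functional \<mu>" by (rule cdual_eqI[OF md J])
  with \<mu>(1) show ?thesis by (rule that)
qed

lemma faithful_if_Zcenter:
  assumes nc: "\<not> compact (UNIV :: 'g set)"
    and Z: "\<And>m. m \<in> Zcenter X act \<Longrightarrow> \<exists>\<mu>. regular_complex_measure \<mu> \<and> m = measure_functional \<mu>"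
  shows "faithful_action X act"
  unfolding faithful_action_def
proof (intro ballI impI)
  note G' = G_space_self[OF lc]
  fix m :: "('g \<Rightarrow> complex) \<Rightarrow> complex"
  assume m: "m \<in> cdual euclidean LUC_group"
    and ker: "\<forall>M\<in>cdual X (LUC X act). dual_act X act m M = (\<lambda>F\<in>LUC X act. 0)"
  have m0: "m (\<lambda>s. 0) = 0" using group_cdual_lin[OF m LUC_group_const_zero LUC_group_const_zero, of 0 0] by simp
  have "m g = 0" if g: "g \<in> LUC_group" for g
  proof -
    obtain F n where F: "F \<in> LUC_group" "n \<in> cdual euclidean LUC_group" "\<And>f. f \<in> Cc \<Longrightarrow> n f = 0"
        "fun_act euclidean (+) n F = g"
      by (rule factorization_at_infinity[OF lc nc g]) blast
    define q where "q = dual_act euclidean (+) m n"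
    have q: "q \<in> cdual euclidean LUC_group" unfolding q_def by (rule dual_act_cdual[OF lc G' m F(2)])
    have qM: "dual_act X act q M = (\<lambda>F\<in>LUC X act. 0)" if M: "M \<in> cdual X (LUC X act)" for M
    proof
      fix H
      show "dual_act X act q M H = (\<lambda>F\<in>LUC X act. 0) H"
      proof (cases "H \<in> LUC X act")
        case True
        then have "dual_act X act q M H = dual_act X act m (dual_act X act n M) H"
          using dual_act_group_fun_act[OF m F(2) M True] by (simp add: q_def dual_act_def[of X act])
        also have "\<dots> = 0" using ker dual_act_cdual[OF lc G F(2) M] True by simp
        finally show ?thesis using True by simp
      qed (simp add: dual_act_def)
    qed
    have "(\<lambda>F\<in>LUC X act. 0) \<in> cdual X (LUC X act)"
      by (rule zero_cdual) (use LUC_lincomb[OF G] LUC_Cb in blast)+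
    then have "continuous_map (weak_star X (LUC X act)) (weak_star X (LUC X act)) (\<lambda>M. \<lambda>F\<in>LUC X act. 0)"
      by (simp add: topspace_weak_star)
    then have "continuous_map (weak_star X (LUC X act)) (weak_star X (LUC X act)) (dual_act X act q)"
      by (rule continuous_map_eq) (simp add: qM topspace_weak_star)
    with q have "q \<in> Zcenter X act" by (simp add: Zcenter_def)
    then obtain \<mu> where \<mu>: "regular_complex_measure \<mu>" "q = measure_functional \<mu>" using Z by blast
    have "complex_integral \<mu> f = 0" if f: "f \<in> Cc" for f
    proof -
      have fL: "f \<in> LUC_group" using f Cc_subset_LUC[OF lc] by blast
      \<comment> \<open>Translates of \<open>f\<close> stay in \<open>Cc\<close>, where
        \<open>n\<close> vanishes, so \<open>n f\<close> is the zero function and \<open>q\<close>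
        annihilates \<open>f\<close>.\<close>
      have "ltrans euclidean (+) s f \<in> Cc" for s
      proof -
        obtain K where K: "compact K" "\<And>x. x \<notin> K \<Longrightarrow> f x = 0" "continuous_on UNIV f" using f by (auto simp: Cc_def)
        show ?thesis unfolding ltrans_euclidean
        proof (rule CcI[of _ "{- s} + K"])
          show "continuous_on UNIV (\<lambda>x. f (s + x))"
            by (intro continuous_on_compose2[OF K(3)] continuous_intros) auto
          show "compact ({- s} + K)" using K(1) by (intro compact_set_plus) auto
          show "f (s + x) = 0" if "x \<notin> {- s} + K" for x
          proof (rule K(2), rule notI)
            assume "s + x \<in> K"
            then have "- s + (s + x) \<in> {- s} + K" by (intro set_plus_intro) auto
            with that show False by (simp add: add.assoc[symmetric])
          qed
        qed
      qed
      then have "fun_act euclidean (+) n f = (\<lambda>s. 0)" using F(3) by (simp add: fun_act_def)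
      then have "q f = 0" using fL m0 by (simp add: q_def dual_act_def)
      then show ?thesis using \<mu>(2) fL by (simp add: measure_functional_def[OF lc])
    qed
    \<comment> \<open>Vanishing on \<open>Cc\<close> extends to \<open>F\<close> by tightness, which
      is why \<open>q\<close> has to be a measure.\<close>
    then have "complex_integral \<mu> F = 0" by (rule measure_functional_zero_if_Cc[OF lc \<mu>(1) _ F(1)])
    then have "q F = 0" using \<mu>(2) F(1) by (simp add: measure_functional_def[OF lc])
    then show ?thesis using F(1,4) by (simp add: q_def dual_act_def)
  qed
  then show "m = (\<lambda>f\<in>LUC_group. 0)"
    using cdual_extensional[OF m] by (intro extensionalityI[of _ LUC_group]) auto
qed

end

theorem theorem4p7:
  fixes X :: "'x topology"
    and act :: "'g::{topological_group_add, t2_space} \<Rightarrow> 'x \<Rightarrow> 'x"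
  assumes "locally_compact_space (euclidean :: 'g topology)"
    and "\<not> compact (UNIV :: 'g set)"
    and "G_space X act"
  shows "(Zcenter X act = measure_functionals \<longleftrightarrow> CLS X act = LUC_group) \<and>
         (CLS X act = LUC_group \<longleftrightarrow> faithful_action X act)"
proof -
  note lc = assms(1) and nc = assms(2) and G = assms(3)
  have meas: "measure_functionals = {measure_functional \<mu> | \<mu> :: 'g set \<Rightarrow> complex. regular_complex_measure \<mu>}"
    unfolding measure_functionals_def measure_functional_def[OF lc] ..
  have ba: "Zcenter X act = measure_functionals" if "CLS X act = LUC_group"
  proof
    show "Zcenter X act \<subseteq> measure_functionals"
      unfolding meas using Zcenter_subset_measures[OF lc G nc that] by blast
    show "measure_functionals \<subseteq> Zcenter X act"
      unfolding meas using measure_functional_Zcenter[OF lc G] by blast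
  qed
  have ac: "faithful_action X act" if Z: "Zcenter X act = measure_functionals"
  proof (rule faithful_if_Zcenter[OF lc G nc])
    show "\<exists>\<mu>. regular_complex_measure \<mu> \<and> m = measure_functional \<mu>" if "m \<in> Zcenter X act" for m
      using that unfolding Z meas by blast
  qed
  show ?thesis
    using ba ac CLS_if_faithful[OF lc G] faithful_if_CLS[OF lc G] by blast
qed

end
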